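(* Let $X$ and $Y$ be $\mathcal D$-measurable $D([0,1]^m)$-valued random variables ($m\ge1$), and let $s>0$. Suppose that $\mathbb E\|X\|^s<\infty$ and $\mathbb E\|Y\|^s<\infty$. Then the following are equivalent. (i) The Zolotarev distance $\zeta_s(X,Y)<\infty$. (ii) For every positive integer $\ell<s$ and every $t_1,\dots,t_\ell\in[0,1]^m$, $$\mathbb E\Bigl(\prod_{i=1}^\ell X(t_i)\Bigr)=\mathbb E\Bigl(\prod_{i=1}^\ell Y(t_i)\Bigr).$$
   Context: $D([0,1]^m)$ is the set of functions $f:[0,1]^m\to\mathbb R$ such that at every $t=(t_1,\dots,t_m)\in[0,1]^m$ the limit of $f(s)$ exists (as a finite real number) as $s\to t$ within each set $J_1\times\dots\times J_m$, where each $J_i$ is either $[t_i,1]$ or $[0,t_i)$ (the latter only if $t_i>0$). It is a Banach space with the norm $\|f\|=\sup_{t\in[0,1]^m}|f(t)|$. $\mathcal D$ is the $\sigma$-field on it generated by all point evaluations $f\mapsto f(t)$. A $\mathcal D$-measurable $D([0,1]^m)$-valued random variable is a map $X$ from a probability space to $D([0,1]^m)$ such that $X(t)$ is a real random variable for each $t\in[0,1]^m$; then $\|X\|$ is a random variable. Zolotarev distance: let $B=D([0,1]^m)$ and write $s=k+\alpha$ with $k\ge0$ an integer and $0<\alpha\le1$. Then $$\zeta_s(X,Y):=\sup_{g}\bigl|\mathbb E\,g(X)-\mathbb E\,g(Y)\bigr|,$$ where the supremum is over all $\mathcal D$-measurable functions $g:B\to\mathbb R$ that are $k$ times continuously (Fréchet)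 differentiable on $B$ and satisfy $\|D^kg(x)-D^kg(y)\|\le\|x-y\|^\alpha$ for all $x,y\in B$ (with $D^0g=g$, and the norm of $D^kg$ being the norm of bounded $k$-linear forms on $B$). If $\mathbb E\|X\|^s,\mathbb E\|Y\|^s<\infty$ these expectations are finite. *)

theory Defs
  imports "HOL-Probability.Probability"
begin

section \<open>The space \<open>D([0,1]\<^sup>m)\<close>, with \<open>m\<close> the cardinality of the index type\<close>

definition unit_cube :: "(real ^ 'm) set" where
  "unit_cube = {t. \<forall>i. 0 \<le> t $ i \<and> t $ i \<le> 1}"

(* The set J_1 x ... x J_m at t; S is the set of the coordinates i with J_i = [0, t_i),
   the remaining coordinates have J_i = [t_i, 1]. *)
definition octant :: "real ^ 'm \<Rightarrow> 'm set \<Rightarrow> (real ^ 'm) set" where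
  "octant t S = {s. \<forall>i. if i \<in> S then 0 \<le> s $ i \<and> s $ i < t $ i else t $ i \<le> s $ i \<and> s $ i \<le> 1}"

(* The limit is taken along all points of the octant, not only along those different from t.
   For S = {}, where t belongs to the octant, the limit therefore has to be f t
   (for m = 1 this is right continuity); for nonempty S the octant does not contain t. *)
definition octant_limits :: "(real ^ 'm \<Rightarrow> real) \<Rightarrow> bool" where
  "octant_limits f \<longleftrightarrow>
     (\<forall>t\<in>unit_cube. \<forall>S. (\<forall>i\<in>S. 0 < t $ i) \<longrightarrow>
        (\<exists>l. (f \<longlongrightarrow> l) (inf (nhds t) (principal (octant t S)))))"

(* Functions on the cube are represented by their extension by 0 to all of real ^ 'm. *)
typedef ('m::finite) dspace =
  "{f :: real ^ 'm \<Rightarrow> real. octant_limits f \<and> (\<forall>t. t \<notin> unit_cube \<longrightarrow> f t = 0)}"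
  morphisms dfun Abs_dspace
  by (rule exI[of _ "\<lambda>_. 0"]) (auto simp: octant_limits_def)

setup_lifting type_definition_dspace

lemma dfun_outside: "t \<notin> unit_cube \<Longrightarrow> dfun f t = 0"
  using dfun[of f] by auto

lemma dspace_eqI: "(\<And>t. t \<in> unit_cube \<Longrightarrow> dfun f t = dfun g t) \<Longrightarrow> f = g"
  by (metis dfun_inject dfun_outside ext)

lemma unit_cube_cbox: "unit_cube = cbox (0 :: real ^ 'm) 1"
  by (auto simp: unit_cube_def mem_box_cart)

lemma unit_cube_nonempty: "unit_cube \<noteq> {}"
proof -
  have "0 \<in> unit_cube" by (simp add: unit_cube_def)
  then show ?thesis by blast
qed

lemma octant_limits_locally_bounded:
  fixes f :: "real ^ 'm::finite \<Rightarrow> real"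
  assumes f: "octant_limits f" and t: "t \<in> unit_cube"
  shows "\<exists>C. eventually (\<lambda>s. s \<in> unit_cube \<longrightarrow> \<bar>f s\<bar> \<le> C) (nhds t)"
proof -
  have "\<exists>l. (\<forall>i\<in>S. 0 < t $ i) \<longrightarrow> eventually (\<lambda>s. s \<in> octant t S \<longrightarrow> \<bar>f s\<bar> < \<bar>l\<bar> + 1) (nhds t)" for S
  proof (cases "\<forall>i\<in>S. 0 < t $ i")
    case True
    then obtain l where l: "(f \<longlongrightarrow> l) (inf (nhds t) (principal (octant t S)))"
      using f t unfolding octant_limits_def by blast
    have "eventually (\<lambda>s. \<bar>f s\<bar> < \<bar>l\<bar> + 1) (inf (nhds t) (principal (octant t S)))"
      using order_tendstoD(2)[OF tendsto_rabs[OF l], of "\<bar>l\<bar> + 1"] by simp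
    then show ?thesis by (auto simp: eventually_inf_principal)
  qed auto
  then obtain l where l: "\<And>S. (\<forall>i\<in>S. 0 < t $ i) \<Longrightarrow>
      eventually (\<lambda>s. s \<in> octant t S \<longrightarrow> \<bar>f s\<bar> < \<bar>l S\<bar> + 1) (nhds t)"
    by metis
  have "eventually (\<lambda>s. (\<forall>i\<in>S. 0 < t $ i) \<longrightarrow> s \<in> octant t S \<longrightarrow> \<bar>f s\<bar> < \<bar>l S\<bar> + 1) (nhds t)" for S
    by (cases "\<forall>i\<in>S. 0 < t $ i") (use l in auto)
  then have ev: "eventually (\<lambda>s. \<forall>S. (\<forall>i\<in>S. 0 < t $ i) \<longrightarrow> s \<in> octant t S \<longrightarrow> \<bar>f s\<bar> < \<bar>l S\<bar> + 1) (nhds t)"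
    by (intro eventually_all_finite)
  have "eventually (\<lambda>s. s \<in> unit_cube \<longrightarrow> \<bar>f s\<bar> \<le> (\<Sum>S\<in>UNIV. \<bar>l S\<bar> + 1)) (nhds t)"
    using ev
  proof eventually_elim
    case (elim s)
    show ?case
    proof
      assume s: "s \<in> unit_cube"
      define S where "S = {i. s $ i < t $ i}"
      have "\<forall>i\<in>S. 0 < t $ i"
        using s unfolding S_def unit_cube_def by (metis (mono_tags, lifting) le_less_trans mem_Collect_eq)
      moreover have "s \<in> octant t S"
        using s by (auto simp: octant_def S_def unit_cube_def)
      ultimately have "\<bar>f s\<bar> < \<bar>l S\<bar> + 1" using elim by blast
      also have "\<dots> \<le> (\<Sum>S\<in>UNIV. \<bar>l S\<bar> + 1)"
        by (rule member_le_sum) auto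
      finally show "\<bar>f s\<bar> \<le> (\<Sum>S\<in>UNIV. \<bar>l S\<bar> + 1)" by simp
    qed
  qed
  then show ?thesis by blast
qed

lemma octant_limits_bounded:
  fixes f :: "real ^ 'm::finite \<Rightarrow> real"
  assumes "octant_limits f"
  shows "\<exists>C. \<forall>t\<in>unit_cube. \<bar>f t\<bar> \<le> C"
proof (rule ccontr)
  assume "\<not> ?thesis"
  then have "\<forall>n::nat. \<exists>t\<in>unit_cube. real n < \<bar>f t\<bar>"
    by (meson not_le)
  then obtain x where x: "\<And>n. x n \<in> unit_cube" "\<And>n. real n < \<bar>f (x n)\<bar>" by metis
  have "compact (unit_cube :: (real ^ 'm) set)"
    by (simp add: unit_cube_cbox)
  then obtain t r where t: "t \<in> unit_cube" and r: "strict_mono r" and lim: "(x \<circ> r) \<longlonglongrightarrow> t"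
    using x(1) unfolding compact_def by metis
  obtain C where "eventually (\<lambda>s. s \<in> unit_cube \<longrightarrow> \<bar>f s\<bar> \<le> C) (nhds t)"
    using octant_limits_locally_bounded[OF assms t] by blast
  from eventually_compose_filterlim[OF this lim]
  have "eventually (\<lambda>n. \<bar>f (x (r n))\<bar> \<le> C) sequentially"
    using x(1) by simp
  moreover have "eventually (\<lambda>n. C < real n) sequentially"
    using filterlim_real_sequentially unfolding filterlim_at_top_dense by blast
  ultimately have "eventually (\<lambda>n::nat. False) sequentially"
  proof eventually_elim
    case (elim n)
    have "real n \<le> real (r n)" using seq_suble[OF r] by simp
    with elim x(2)[of "r n"] show False by linarith
  qed
  then show False by simp
qed

lemma octant_limits_add:
  assumes "octant_limits f" and "octant_limits g"
  shows "octant_limits (\<lambda>t. f t + g t)"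
  unfolding octant_limits_def
proof (intro ballI allI impI)
  fix t :: "real ^ 'a" and S :: "'a set"
  assume "t \<in> unit_cube" and "\<forall>i\<in>S. 0 < t $ i"
  then obtain l k where "(f \<longlongrightarrow> l) (inf (nhds t) (principal (octant t S)))"
      and "(g \<longlongrightarrow> k) (inf (nhds t) (principal (octant t S)))"
    using assms unfolding octant_limits_def by blast
  from tendsto_add[OF this]
  show "\<exists>l. ((\<lambda>t. f t + g t) \<longlongrightarrow> l) (inf (nhds t) (principal (octant t S)))" ..
qed

lemma octant_limits_cmult:
  assumes "octant_limits f"
  shows "octant_limits (\<lambda>t. c * f t)"
  unfolding octant_limits_def
proof (intro ballI allI impI)
  fix t :: "real ^ 'a" and S :: "'a set"
  assume "t \<in> unit_cube" and "\<forall>i\<in>S. 0 < t $ i"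
  then obtain l where "(f \<longlongrightarrow> l) (inf (nhds t) (principal (octant t S)))"
    using assms unfolding octant_limits_def by blast
  from tendsto_mult_left[OF this]
  show "\<exists>l. ((\<lambda>t. c * f t) \<longlongrightarrow> l) (inf (nhds t) (principal (octant t S)))" ..
qed

lemma octant_limits_uminus: "octant_limits f \<Longrightarrow> octant_limits (\<lambda>t. - f t)"
  using octant_limits_cmult[of f "- 1"] by simp

lemma octant_limits_diff:
  "octant_limits f \<Longrightarrow> octant_limits g \<Longrightarrow> octant_limits (\<lambda>t. f t - g t)"
  using octant_limits_add[OF _ octant_limits_uminus, of f g] by simp

instantiation dspace :: (finite) real_vector
begin

lift_definition zero_dspace :: "'a dspace" is "\<lambda>_. 0"
  by (auto simp: octant_limits_def)

lift_definition plus_dspace :: "'a dspace \<Rightarrow> 'a dspace \<Rightarrow> 'a dspace" is "\<lambda>f g t. f t + g t"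
  by (auto intro: octant_limits_add)

lift_definition scaleR_dspace :: "real \<Rightarrow> 'a dspace \<Rightarrow> 'a dspace" is "\<lambda>c f t. c * f t"
  by (auto intro: octant_limits_cmult)

lift_definition uminus_dspace :: "'a dspace \<Rightarrow> 'a dspace" is "\<lambda>f t. - f t"
  by (auto intro: octant_limits_uminus)

lift_definition minus_dspace :: "'a dspace \<Rightarrow> 'a dspace \<Rightarrow> 'a dspace" is "\<lambda>f g t. f t - g t"
  by (auto intro: octant_limits_diff)

instance
  by standard (transfer, simp add: algebra_simps fun_eq_iff)+

end

instantiation dspace :: (finite) real_normed_vector
begin

definition norm_dspace :: "'a dspace \<Rightarrow> real" where
  "norm_dspace f = (SUP t\<in>unit_cube. \<bar>dfun f t\<bar>)"

definition sgn_dspace :: "'a dspace \<Rightarrow> 'a dspace" where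
  "sgn_dspace f = f /\<^sub>R norm f"

definition dist_dspace :: "'a dspace \<Rightarrow> 'a dspace \<Rightarrow> real" where
  "dist_dspace f g = norm (f - g)"

definition uniformity_dspace :: "('a dspace \<times> 'a dspace) filter" where
  "uniformity_dspace = (INF e\<in>{0<..}. principal {(x, y). dist x y < e})"

definition open_dspace :: "'a dspace set \<Rightarrow> bool" where
  "open_dspace U = (\<forall>x\<in>U. \<forall>\<^sub>F (x', y) in uniformity. x' = x \<longrightarrow> y \<in> U)"

lemma bdd_above_dfun: "bdd_above ((\<lambda>t. \<bar>dfun f t\<bar>) ` unit_cube)"
  using octant_limits_bounded[of "dfun f"] dfun[of f] by (fastforce intro: bdd_aboveI2)

lemma abs_dfun_le_norm: "\<bar>dfun f t\<bar> \<le> norm f"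
proof -
  have *: "\<bar>dfun f t\<bar> \<le> norm f" if "t \<in> unit_cube" for t
    unfolding norm_dspace_def using that by (rule cSUP_upper[OF _ bdd_above_dfun])
  obtain u :: "real ^ 'a" where "u \<in> unit_cube" using unit_cube_nonempty by blast
  from *[OF this] have "0 \<le> norm f" by linarith
  with * show ?thesis by (cases "t \<in> unit_cube") (auto simp: dfun_outside)
qed

lemma norm_dspace_leI: "(\<And>t. t \<in> unit_cube \<Longrightarrow> \<bar>dfun f t\<bar> \<le> C) \<Longrightarrow> norm f \<le> C"
  unfolding norm_dspace_def by (rule cSUP_least[OF unit_cube_nonempty])

instance
proof
  fix f g :: "'a dspace" and c :: real
  have [simp]: "dfun (0 :: 'a dspace) t = 0" for t by (simp add: zero_dspace.rep_eq)
  show "dist f g = norm (f - g)" by (rule dist_dspace_def)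
  show "sgn f = f /\<^sub>R norm f" by (rule sgn_dspace_def)
  show "(uniformity :: ('a dspace \<times> 'a dspace) filter) =
      (INF e\<in>{0<..}. principal {(x, y). dist x y < e})"
    by (rule uniformity_dspace_def)
  show "open U = (\<forall>x\<in>U. \<forall>\<^sub>F (x', y) in uniformity. x' = x \<longrightarrow> y \<in> U)" for U :: "'a dspace set"
    by (rule open_dspace_def)
  show "norm f = 0 \<longleftrightarrow> f = 0"
  proof
    assume "norm f = 0"
    then have "dfun f t = 0" for t using abs_dfun_le_norm[of f t] by simp
    then show "f = 0" by (intro dspace_eqI) simp
  next
    assume "f = 0"
    then have "norm f \<le> 0" by (intro norm_dspace_leI) simp
    then show "norm f = 0" using abs_dfun_le_norm[of f 0] by linarith
  qed
  show "norm (f + g) \<le> norm f + norm g"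
  proof (rule norm_dspace_leI)
    fix t
    show "\<bar>dfun (f + g) t\<bar> \<le> norm f + norm g"
      using abs_dfun_le_norm[of f t] abs_dfun_le_norm[of g t]
      by (simp add: plus_dspace.rep_eq)
  qed
  have le: "norm (a *\<^sub>R h) \<le> \<bar>a\<bar> * norm h" for a and h :: "'a dspace"
  proof (rule norm_dspace_leI)
    fix t
    show "\<bar>dfun (a *\<^sub>R h) t\<bar> \<le> \<bar>a\<bar> * norm h"
      using abs_dfun_le_norm[of h t] by (simp add: scaleR_dspace.rep_eq abs_mult mult_left_mono)
  qed
  show "norm (c *\<^sub>R f) = \<bar>c\<bar> * norm f"
  proof (cases "c = 0")
    case True
    have "norm (0 :: 'a dspace) \<le> 0" by (intro norm_dspace_leI) simp
    then show ?thesis using True abs_dfun_le_norm[of "0 :: 'a dspace" 0] by simp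
  next
    case False
    then have "\<bar>c\<bar> * norm f \<le> norm (c *\<^sub>R f)"
      using le[of "inverse c" "c *\<^sub>R f"] by (simp add: field_simps)
    with le[of c f] show ?thesis by simp
  qed
qed

end

definition D_sigma :: "('m::finite) dspace measure" where
  "D_sigma = sigma UNIV {(\<lambda>f. dfun f t) -` A | t A. t \<in> unit_cube \<and> A \<in> sets borel}"

definition D_random_variable :: "'a measure \<Rightarrow> ('a \<Rightarrow> ('m::finite) dspace) \<Rightarrow> bool" where
  "D_random_variable M X \<longleftrightarrow> (\<forall>t\<in>unit_cube. (\<lambda>\<omega>. dfun (X \<omega>) t) \<in> borel_measurable M)"

section \<open>Bounded multilinear forms\<close>

(* A single F comprises a k-linear form for every k, namely the restriction of F to the lists
   of length k. The common bound C makes the supremum of the norms of these forms finite. *)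
definition bounded_multilinear :: "('a::real_normed_vector list \<Rightarrow> real) \<Rightarrow> bool" where
  "bounded_multilinear F \<longleftrightarrow>
     (\<forall>hs i. i < length hs \<longrightarrow> linear (\<lambda>h. F (hs[i := h]))) \<and>
     (\<exists>C. \<forall>hs. \<bar>F hs\<bar> \<le> C * prod_list (map norm hs))"

typedef (overloaded) ('a::real_normed_vector) mform =
  "{F :: 'a list \<Rightarrow> real. bounded_multilinear F}"
  morphisms mform_apply Abs_mform
  by (rule exI[of _ "\<lambda>_. 0"]) (auto simp: bounded_multilinear_def linear_iff intro: exI[of _ 0])

setup_lifting type_definition_mform

(* The bounded k-linear forms, as elements of the common type: those whose components of
   degree other than k vanish. *)
definition kforms :: "nat \<Rightarrow> ('a::real_normed_vector) mform set" where
  "kforms k = {F. \<forall>hs. length hs \<noteq> k \<longrightarrow> mform_apply F hs = 0}"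

lemma prod_list_norm_nonneg: "0 \<le> prod_list (map norm hs)"
  by (induction hs) auto

lemma prod_list_norm_le_1: "\<forall>h\<in>set (hs :: 'a::real_normed_vector list). norm h \<le> 1 \<Longrightarrow> prod_list (map norm hs) \<le> 1"
  by (induction hs) (auto intro!: mult_le_one prod_list_norm_nonneg)

lemma bounded_multilinear_lin:
  "bounded_multilinear F \<Longrightarrow> linear (\<lambda>h. F (ps @ h # hs))"
proof -
  assume "bounded_multilinear F"
  then have "linear (\<lambda>h. F ((ps @ undefined # hs)[length ps := h]))"
    unfolding bounded_multilinear_def by (metis length_append less_add_same_cancel1 length_Cons zero_less_Suc)
  then show ?thesis by simp
qed

lemma bounded_multilinear_scale:
  assumes "bounded_multilinear F"
  shows "F (ps @ map (\<lambda>h. a h *\<^sub>R u h) hs) = prod_list (map a hs) * F (ps @ map u hs)"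
proof (induction hs arbitrary: ps)
  case (Cons h hs)
  have "F (ps @ map (\<lambda>h. a h *\<^sub>R u h) (h # hs)) = a h * F (ps @ u h # map (\<lambda>h. a h *\<^sub>R u h) hs)"
    using linear_scale[OF bounded_multilinear_lin[OF assms]] by simp
  also have "F (ps @ u h # map (\<lambda>h. a h *\<^sub>R u h) hs) = prod_list (map a hs) * F (ps @ u h # map u hs)"
    using Cons[of "ps @ [u h]"] by simp
  finally show ?case by simp
qed simp

instantiation mform :: (real_normed_vector) real_vector
begin

lift_definition zero_mform :: "'a mform" is "\<lambda>_. 0"
  by (auto simp: bounded_multilinear_def linear_iff intro: exI[of _ 0])

lift_definition plus_mform :: "'a mform \<Rightarrow> 'a mform \<Rightarrow> 'a mform" is "\<lambda>F G hs. F hs + G hs"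
proof -
  fix F G :: "'a list \<Rightarrow> real"
  assume F: "bounded_multilinear F" and G: "bounded_multilinear G"
  then obtain C D where C: "\<And>hs. \<bar>F hs\<bar> \<le> C * prod_list (map norm hs)"
    and D: "\<And>hs. \<bar>G hs\<bar> \<le> D * prod_list (map norm hs)"
    unfolding bounded_multilinear_def by auto
  have "\<bar>F hs + G hs\<bar> \<le> (C + D) * prod_list (map norm hs)" for hs
    using abs_triangle_ineq[of "F hs" "G hs"] C[of hs] D[of hs] unfolding distrib_right by linarith
  moreover have "linear (\<lambda>h. F (hs[i := h]) + G (hs[i := h]))" if "i < length hs" for hs i
    using F G that unfolding bounded_multilinear_def by (intro linear_compose_add) simp_all
  ultimately show "bounded_multilinear (\<lambda>hs. F hs + G hs)"
    unfolding bounded_multilinear_def by blast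
qed

lift_definition scaleR_mform :: "real \<Rightarrow> 'a mform \<Rightarrow> 'a mform" is "\<lambda>c F hs. c * F hs"
proof -
  fix F :: "'a list \<Rightarrow> real" and c :: real
  assume F: "bounded_multilinear F"
  then obtain C where C: "\<And>hs. \<bar>F hs\<bar> \<le> C * prod_list (map norm hs)"
    unfolding bounded_multilinear_def by auto
  have "\<bar>c * F hs\<bar> \<le> (\<bar>c\<bar> * C) * prod_list (map norm hs)" for hs
    using mult_left_mono[OF C[of hs], of "\<bar>c\<bar>"] by (simp add: abs_mult mult.assoc)
  moreover have "linear (\<lambda>h. c * F (hs[i := h]))" if "i < length hs" for hs i
    using linear_compose_scale_right[of "\<lambda>h. F (hs[i := h])" c] F that
    unfolding bounded_multilinear_def by simp
  ultimately show "bounded_multilinear (\<lambda>hs. c * F hs)"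
    unfolding bounded_multilinear_def by blast
qed

definition uminus_mform :: "'a mform \<Rightarrow> 'a mform" where
  "uminus_mform F = (- 1) *\<^sub>R F"

definition minus_mform :: "'a mform \<Rightarrow> 'a mform \<Rightarrow> 'a mform" where
  "minus_mform F G = F + (- G)"

instance
  by standard (unfold minus_mform_def uminus_mform_def, (transfer, simp add: algebra_simps fun_eq_iff)+)

end

instantiation mform :: (real_normed_vector) real_normed_vector
begin

(* On kforms k this is the usual norm of bounded k-linear forms. *)
definition norm_mform :: "'a mform \<Rightarrow> real" where
  "norm_mform F = (SUP hs\<in>{hs. \<forall>h\<in>set hs. norm h \<le> 1}. \<bar>mform_apply F hs\<bar>)"

definition sgn_mform :: "'a mform \<Rightarrow> 'a mform" where
  "sgn_mform F = F /\<^sub>R norm F"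

definition dist_mform :: "'a mform \<Rightarrow> 'a mform \<Rightarrow> real" where
  "dist_mform F G = norm (F - G)"

definition uniformity_mform :: "('a mform \<times> 'a mform) filter" where
  "uniformity_mform = (INF e\<in>{0<..}. principal {(x, y). dist x y < e})"

definition open_mform :: "'a mform set \<Rightarrow> bool" where
  "open_mform U = (\<forall>x\<in>U. \<forall>\<^sub>F (x', y) in uniformity. x' = x \<longrightarrow> y \<in> U)"

lemma bdd_above_mform:
  "bdd_above ((\<lambda>hs. \<bar>mform_apply F hs\<bar>) ` {hs. \<forall>h\<in>set hs. norm h \<le> 1})"
proof -
  obtain C where C: "\<And>hs. \<bar>mform_apply F hs\<bar> \<le> C * prod_list (map norm hs)"
    using mform_apply[of F] unfolding bounded_multilinear_def by auto
  have "\<bar>mform_apply F hs\<bar> \<le> \<bar>C\<bar>" if "\<forall>h\<in>set hs. norm h \<le> 1" for hs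
  proof -
    have "C * prod_list (map norm hs) \<le> \<bar>C\<bar> * 1"
      using that prod_list_norm_nonneg[of hs] prod_list_norm_le_1[of hs]
      by (intro mult_mono) auto
    with C[of hs] show ?thesis by simp
  qed
  then show ?thesis by (intro bdd_aboveI2[where M = "\<bar>C\<bar>"]) auto
qed

lemma abs_mform_apply_le_norm: "\<bar>mform_apply (F :: 'a mform) hs\<bar> \<le> norm F * prod_list (map norm hs)"
proof -
  have hs: "map (\<lambda>h. norm h *\<^sub>R sgn h) hs = hs"
  proof (rule map_idI)
    fix h :: 'a assume "h \<in> set hs"
    show "norm h *\<^sub>R sgn h = h" by (cases "h = 0") (simp_all add: sgn_div_norm)
  qed
  have "\<bar>mform_apply F (map sgn hs)\<bar> \<le> norm F"
    unfolding norm_mform_def by (rule cSUP_upper[OF _ bdd_above_mform]) (auto simp: norm_sgn)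
  moreover have "mform_apply F hs = prod_list (map norm hs) * mform_apply F (map sgn hs)"
    using bounded_multilinear_scale[of "mform_apply F" "[]" norm sgn hs] mform_apply[of F] hs
    by simp
  ultimately show ?thesis
    using prod_list_norm_nonneg[of hs]
    by (simp add: abs_mult mult.commute[of "norm F"] mult_left_mono)
qed

lemma norm_mform_leI:
  "(\<And>hs. \<forall>h\<in>set hs. norm h \<le> 1 \<Longrightarrow> \<bar>mform_apply F hs\<bar> \<le> C) \<Longrightarrow> norm F \<le> C"
  unfolding norm_mform_def by (rule cSUP_least) (auto intro: exI[of _ "[]"])

lemma norm_mform_nonneg: "0 \<le> norm (F :: 'a mform)"
  using abs_mform_apply_le_norm[of F "[]"] by simp

instance
proof
  fix F G :: "'a mform" and c :: real
  have [simp]: "mform_apply (0 :: 'a mform) hs = 0" for hs by (simp add: zero_mform.rep_eq)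
  have app: "\<bar>mform_apply H hs\<bar> \<le> norm H" if "\<forall>h\<in>set hs. norm h \<le> 1" for hs and H :: "'a mform"
    unfolding norm_mform_def using that by (intro cSUP_upper bdd_above_mform) simp
  show "dist F G = norm (F - G)" by (rule dist_mform_def)
  show "sgn F = F /\<^sub>R norm F" by (rule sgn_mform_def)
  show "(uniformity :: ('a mform \<times> 'a mform) filter) =
      (INF e\<in>{0<..}. principal {(x, y). dist x y < e})"
    by (rule uniformity_mform_def)
  show "open U = (\<forall>x\<in>U. \<forall>\<^sub>F (x', y) in uniformity. x' = x \<longrightarrow> y \<in> U)" for U :: "'a mform set"
    by (rule open_mform_def)
  show "norm F = 0 \<longleftrightarrow> F = 0"
  proof
    assume "norm F = 0"
    then have "mform_apply F hs = 0" for hs using abs_mform_apply_le_norm[of F hs] by simp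
    then show "F = 0" by (intro mform_apply_inject[THEN iffD1] ext) simp
  next
    assume "F = 0"
    then have "norm F \<le> 0" by (intro norm_mform_leI) simp
    then show "norm F = 0" using norm_mform_nonneg[of F] by linarith
  qed
  show "norm (F + G) \<le> norm F + norm G"
  proof (rule norm_mform_leI)
    fix hs :: "'a list" assume "\<forall>h\<in>set hs. norm h \<le> 1"
    then show "\<bar>mform_apply (F + G) hs\<bar> \<le> norm F + norm G"
      using app[of hs F] app[of hs G] by (simp add: plus_mform.rep_eq)
  qed
  have le: "norm (a *\<^sub>R H) \<le> \<bar>a\<bar> * norm H" for a and H :: "'a mform"
  proof (rule norm_mform_leI)
    fix hs :: "'a list" assume "\<forall>h\<in>set hs. norm h \<le> 1"
    then show "\<bar>mform_apply (a *\<^sub>R H) hs\<bar> \<le> \<bar>a\<bar> * norm H"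
      using app[of hs H] by (simp add: scaleR_mform.rep_eq abs_mult mult_left_mono)
  qed
  show "norm (c *\<^sub>R F) = \<bar>c\<bar> * norm F"
  proof (cases "c = 0")
    case True
    have "norm (0 :: 'a mform) \<le> 0" by (intro norm_mform_leI) simp
    then show ?thesis using True norm_mform_nonneg[of "0 :: 'a mform"] by simp
  next
    case False
    then have "\<bar>c\<bar> * norm F \<le> norm (c *\<^sub>R F)"
      using le[of "inverse c" "c *\<^sub>R F"] by (simp add: field_simps)
    with le[of c F] show ?thesis by simp
  qed
qed

end

lift_definition mform_insert :: "'a::real_normed_vector \<Rightarrow> 'a mform \<Rightarrow> 'a mform"
  is "\<lambda>h F hs. F (h # hs)"
proof -
  fix h :: 'a and F :: "'a list \<Rightarrow> real"
  assume F: "bounded_multilinear F"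
  then obtain C where C: "\<And>hs. \<bar>F hs\<bar> \<le> C * prod_list (map norm hs)"
    unfolding bounded_multilinear_def by auto
  have "\<bar>F (h # hs)\<bar> \<le> (C * norm h) * prod_list (map norm hs)" for hs
    using C[of "h # hs"] by (simp add: mult.assoc)
  moreover have "linear (\<lambda>x. F (h # hs[i := x]))" if i: "i < length hs" for hs i
  proof -
    have "linear (\<lambda>x. F ((h # hs)[Suc i := x]))"
      using F i unfolding bounded_multilinear_def by (metis Suc_less_eq length_Cons)
    then show ?thesis by simp
  qed
  ultimately show "bounded_multilinear (\<lambda>hs. F (h # hs))"
    unfolding bounded_multilinear_def by blast
qed

section \<open>Zolotarev distance\<close>

(* g is k times continuously Frechet differentiable and D j x is the j-th derivative
   of g at x, for j \<le> k, where D (j + 1) x (h, h_1, ..., h_j) is the derivative of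
   y \<mapsto> D j y (h_1, ..., h_j) at x in direction h. *)
definition frechet_derivatives ::
  "nat \<Rightarrow> ('a::real_normed_vector \<Rightarrow> real) \<Rightarrow> (nat \<Rightarrow> 'a \<Rightarrow> 'a mform) \<Rightarrow> bool" where
  "frechet_derivatives k g D \<longleftrightarrow>
     (\<forall>j\<le>k. \<forall>x. D j x \<in> kforms j) \<and>
     (\<forall>x. mform_apply (D 0 x) [] = g x) \<and>
     (\<forall>j<k. \<forall>x. (D j has_derivative (\<lambda>h. mform_insert h (D (Suc j) x))) (at x)) \<and>
     continuous_on UNIV (D k)"

definition zolotarev_class :: "real \<Rightarrow> (('m::finite) dspace \<Rightarrow> real) set" where
  "zolotarev_class s =
     {g \<in> borel_measurable D_sigma.
        \<exists>k \<alpha> D. s = real k + \<alpha> \<and> 0 < \<alpha> \<and> \<alpha> \<le> 1 \<and> frechet_derivatives k g D \<and>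
          (\<forall>x y. norm (D k x - D k y) \<le> norm (x - y) powr \<alpha>)}"

definition zolotarev_dist ::
  "real \<Rightarrow> 'a measure \<Rightarrow> ('a \<Rightarrow> ('m::finite) dspace) \<Rightarrow> 'b measure \<Rightarrow> ('b \<Rightarrow> 'm dspace) \<Rightarrow> ennreal" where
  "zolotarev_dist s M X N Y =
     (SUP g\<in>zolotarev_class s. ennreal \<bar>(\<integral>\<omega>. g (X \<omega>) \<partial>M) - (\<integral>\<omega>. g (Y \<omega>) \<partial>N)\<bar>)"

end

theory Submission
  imports Defs
begin

text \<open>
  By Taylor's formula at \<open>0\<close> along rays, \<open>g x = (\<Sum>i\<le>k. P i x / i!) + O(\<parallel>x\<parallel>\<^sup>s)\<close> for \<open>g\<close> in the Zolotarev class,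
  where \<open>P i x = D\<^sup>i g(0)(x, \<dots>, x)\<close> is measurable as a limit of difference quotients of \<open>g\<close>. So (ii) implies (i)
  once the \<open>D\<close>-measurable polynomials \<open>P i\<close> have the same mean under \<open>X\<close> and \<open>Y\<close>. Replacing \<open>x\<close> by its step
  approximation on a finite grid turns \<open>P i\<close> into a linear combination of products of evaluations, to which (ii)
  applies; it remains to find grids for which the approximations of \<open>P i x\<close> converge for every \<open>x\<close>. Step functions
  in \<open>x\<close> may jump off the grid, so the grids have to exhaust all places where the form reacts to a jump. These are
  countably many: random signs show that the values of a bounded multilinear form on families of boxes that are
  disjoint in every slot are summable.

  Conversely, for a linear functional \<open>\<phi>\<close> and \<open>l < s\<close> every multiple \<open>c \<phi>\<^sup>l\<close> lies in the Zolotarev class, because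
  its \<open>k\<close>-th derivative is constant. So the \<open>l\<close>-th moments of \<open>\<phi>(X)\<close> and \<open>\<phi>(Y)\<close> agree, and (i) gives (ii) by polarization.
\<close>

section \<open>Multilinear forms and random signs\<close>

text \<open>The obstacle is non-separability: for distinct \<open>u\<close>, \<open>v\<close> in
  (0,1] the norm of \<open>halfline u - halfline v\<close> is 1, so approximations on countably many
  grid points cannot converge in norm for all functions. Only the values of a given form can
  converge, and the grids have to be tuned to that form: evaluation at \<open>t\<close> is itself a
  form, it reacts to a jump at \<open>t\<close>, and so \<open>t\<close> must become a grid point.
  For a linear form, suitable signs on disjoint pieces give a function of norm at most 1, which
  bounds the sum of the absolute values. For several slots such a sum also produces cross terms
  between different boxes; choosing the signs of the slots with a prescribed product controls these
  terms. The cube is reduced to one dimension by splitting each slot into its coordinates, since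
  indicators of boxes are tensor products of half-lines and their span is dense. Sampling at grid
  floors moves end points of half-lines to the right only, so it suffices to control jumps that are
  displaced to the right.\<close>

text \<open>Slots are indexed by a set and arguments are total functions, so that slots can be
  frozen or released without a change of type. The first clause makes the values off
  \<open>K\<close> irrelevant; a form with a frozen slot is then a form on a smaller set, which
  permits induction on the number of slots.\<close>

definition multilinear_form_on :: "'k set \<Rightarrow> (('k \<Rightarrow> 'e::real_normed_vector) \<Rightarrow> real) \<Rightarrow> bool" where
  "multilinear_form_on K \<Phi> \<longleftrightarrow>
     (\<forall>x y. (\<forall>k\<in>K. x k = y k) \<longrightarrow> \<Phi> x = \<Phi> y) \<and>
     (\<forall>k\<in>K. \<forall>x. linear (\<lambda>h. \<Phi> (x(k := h)))) \<and>
     (\<exists>C. \<forall>x. \<bar>\<Phi> x\<bar> \<le> C * (\<Prod>k\<in>K. norm (x k)))"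

lemma multilinear_form_on_cong:
  "multilinear_form_on K \<Phi> \<Longrightarrow> (\<And>k. k \<in> K \<Longrightarrow> x k = y k) \<Longrightarrow> \<Phi> x = \<Phi> y"
  unfolding multilinear_form_on_def by blast

lemma multilinear_form_on_linear:
  "multilinear_form_on K \<Phi> \<Longrightarrow> k \<in> K \<Longrightarrow> linear (\<lambda>h. \<Phi> (x(k := h)))"
  unfolding multilinear_form_on_def by blast

lemma multilinear_form_on_add:
  "multilinear_form_on K \<Phi> \<Longrightarrow> k \<in> K \<Longrightarrow> \<Phi> (x(k := a + b)) = \<Phi> (x(k := a)) + \<Phi> (x(k := b))"
  by (rule linear_add[OF multilinear_form_on_linear])

lemma multilinear_form_on_diff:
  "multilinear_form_on K \<Phi> \<Longrightarrow> k \<in> K \<Longrightarrow> \<Phi> (x(k := a - b)) = \<Phi> (x(k := a)) - \<Phi> (x(k := b))"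
  by (rule linear_diff[OF multilinear_form_on_linear])

lemma multilinear_form_on_scale:
  "multilinear_form_on K \<Phi> \<Longrightarrow> k \<in> K \<Longrightarrow> \<Phi> (x(k := c *\<^sub>R a)) = c * \<Phi> (x(k := a))"
  using linear_scale[OF multilinear_form_on_linear, of K \<Phi> k x c a] by simp

lemma multilinear_form_on_zero:
  "multilinear_form_on K \<Phi> \<Longrightarrow> k \<in> K \<Longrightarrow> x k = 0 \<Longrightarrow> \<Phi> x = 0"
  using multilinear_form_on_scale[of K \<Phi> k x 0 0] by (metis fun_upd_triv mult_zero_left scaleR_zero_left)

lemma multilinear_form_on_bound:
  assumes "multilinear_form_on K \<Phi>"
  obtains C where "\<And>x. (\<And>k. k \<in> K \<Longrightarrow> norm (x k) \<le> 1) \<Longrightarrow> \<bar>\<Phi> x\<bar> \<le> C"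
proof -
  obtain C where C: "\<And>x. \<bar>\<Phi> x\<bar> \<le> C * (\<Prod>k\<in>K. norm (x k))"
    using assms unfolding multilinear_form_on_def by blast
  have "\<bar>\<Phi> x\<bar> \<le> \<bar>C\<bar>" if "\<And>k. k \<in> K \<Longrightarrow> norm (x k) \<le> 1" for x
  proof -
    have "C * (\<Prod>k\<in>K. norm (x k)) \<le> \<bar>C\<bar> * 1"
      using that by (intro mult_mono prod_le_1 prod_nonneg) auto
    with C[of x] show ?thesis by simp
  qed
  with that show thesis by blast
qed

lemma multilinear_form_on_override:
  assumes \<Phi>: "multilinear_form_on K \<Phi>" and "finite K" and A: "A \<subseteq> K"
  shows "multilinear_form_on A (\<lambda>x. \<Phi> (override_on y x A))"
proof -
  obtain C where C: "\<And>x. \<bar>\<Phi> x\<bar> \<le> C * (\<Prod>k\<in>K. norm (x k))"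
    using \<Phi> unfolding multilinear_form_on_def by blast
  have "\<bar>\<Phi> (override_on y x A)\<bar> \<le> (C * (\<Prod>k\<in>K - A. norm (y k))) * (\<Prod>k\<in>A. norm (x k))" for x
  proof -
    have "(\<Prod>k\<in>K. norm (override_on y x A k)) =
        (\<Prod>k\<in>K - A. norm (override_on y x A k)) * (\<Prod>k\<in>A. norm (override_on y x A k))"
      using A \<open>finite K\<close> by (rule prod.subset_diff)
    then show ?thesis using C[of "override_on y x A"] by (simp add: mult.assoc)
  qed
  moreover have "linear (\<lambda>h. \<Phi> (override_on y (x(k := h)) A))" if "k \<in> A" for k x
  proof -
    have "override_on y (x(k := h)) A = (override_on y x A)(k := h)" for h
      using that by (auto simp: override_on_def)
    with multilinear_form_on_linear[OF \<Phi>, of k] that A show ?thesis by auto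
  qed
  moreover have "\<Phi> (override_on y x A) = \<Phi> (override_on y x' A)" if "\<forall>k\<in>A. x k = x' k" for x x'
    using that by (auto intro!: multilinear_form_on_cong[OF \<Phi>] simp: override_on_def)
  ultimately show ?thesis unfolding multilinear_form_on_def by blast
qed

lemma multilinear_form_on_fix:
  assumes \<Phi>: "multilinear_form_on K \<Phi>" and "finite K" and "k \<in> K"
  shows "multilinear_form_on (K - {k}) (\<lambda>x. \<Phi> (x(k := v)))"
proof -
  have "\<Phi> (x(k := v)) = \<Phi> (override_on (\<lambda>_. v) x (K - {k}))" for x
    by (rule multilinear_form_on_cong[OF \<Phi>]) (auto simp: override_on_def)
  then show ?thesis
    using multilinear_form_on_override[OF \<Phi> \<open>finite K\<close>, of "K - {k}" "\<lambda>_. v"] by auto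
qed

text \<open>Average over all signs \<open>\<eta>\<close> with product \<open>\<theta>\<close>: every mixed term of the expansion of
  \<open>\<Phi> (x + \<eta> z)\<close> averages out, which leaves \<open>\<Phi> x + \<theta> \<Phi> z\<close>.\<close>

lemma exists_signs_override:
  assumes "finite K" "K \<noteq> {}" "multilinear_form_on L \<Phi>" "K \<subseteq> L" "\<theta> = 1 \<or> \<theta> = - 1"
  shows "\<exists>\<eta>. (\<forall>k. \<eta> k = 1 \<or> \<eta> k = - 1) \<and>
     \<Phi> x + \<theta> * \<Phi> (override_on x z K) \<le> \<Phi> (override_on x (\<lambda>k. x k + \<eta> k *\<^sub>R z k) K)"
  using assms
proof (induction K arbitrary: x \<theta> rule: finite_ne_induct)
  case (singleton k)
  have "\<Phi> (override_on x (\<lambda>k. x k + \<theta> *\<^sub>R z k) {k}) = \<Phi> (x(k := x k + \<theta> *\<^sub>R z k))"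
    by (rule arg_cong[of _ _ \<Phi>]) (auto simp: override_on_def)
  also have "\<dots> = \<Phi> x + \<theta> * \<Phi> (x(k := z k))"
    using singleton by (simp add: multilinear_form_on_add multilinear_form_on_scale)
  also have "x(k := z k) = override_on x z {k}"
    by (auto simp: override_on_def)
  finally show ?case using singleton(3) by (intro exI[of _ "\<lambda>_. \<theta>"]) simp
next
  case (insert k K)
  \<comment> \<open>A greedy version of the averaging: \<open>\<sigma>\<close> makes the mixed
    contribution \<open>\<sigma> * m\<close> nonnegative. The induction hypothesis is taken with
    sign \<open>\<theta> * \<sigma>\<close>, so that the last term gets the factor
    \<open>\<theta> * \<sigma> * \<sigma>\<close>, which is \<open>\<theta>\<close>.\<close>
  define m where "m = \<Phi> (x(k := z k)) + \<theta> * \<Phi> (override_on x z K)"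
  define \<sigma> :: real where "\<sigma> = (if m \<ge> 0 then 1 else - 1)"
  have \<sigma>: "\<sigma> = 1 \<or> \<sigma> = - 1" "\<sigma> * \<sigma> = 1" "\<sigma> * m \<ge> 0"
    by (auto simp: \<sigma>_def)
  define x' where "x' = x(k := x k + \<sigma> *\<^sub>R z k)"
  obtain \<eta> where \<eta>: "\<forall>k. \<eta> k = 1 \<or> \<eta> k = - 1"
    and le: "\<Phi> x' + (\<theta> * \<sigma>) * \<Phi> (override_on x' z K) \<le> \<Phi> (override_on x' (\<lambda>k. x' k + \<eta> k *\<^sub>R z k) K)"
    using insert.IH[of "\<theta> * \<sigma>" x'] insert.prems \<sigma>(1) by auto
  have x': "\<Phi> x' = \<Phi> x + \<sigma> * \<Phi> (x(k := z k))"
    unfolding x'_def using insert.prems by (simp add: multilinear_form_on_add multilinear_form_on_scale)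
  have "override_on x' z K = (override_on x z K)(k := x k + \<sigma> *\<^sub>R z k)"
    using insert.hyps by (auto simp: override_on_def x'_def)
  then have "\<Phi> (override_on x' z K) = \<Phi> ((override_on x z K)(k := x k)) + \<sigma> * \<Phi> ((override_on x z K)(k := z k))"
    using insert.prems by (simp add: multilinear_form_on_add multilinear_form_on_scale)
  also have "(override_on x z K)(k := x k) = override_on x z K"
    using insert.hyps by (auto simp: override_on_def)
  also have "(override_on x z K)(k := z k) = override_on x z (insert k K)"
    by (auto simp: override_on_def)
  finally have ov: "\<Phi> (override_on x' z K) = \<Phi> (override_on x z K) + \<sigma> * \<Phi> (override_on x z (insert k K))" .
  have "override_on x' (\<lambda>k. x' k + \<eta> k *\<^sub>R z k) K =
      override_on x (\<lambda>l. x l + (\<eta>(k := \<sigma>)) l *\<^sub>R z l) (insert k K)"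
    using insert.hyps by (auto simp: override_on_def x'_def)
  moreover have "\<Phi> x + \<theta> * \<Phi> (override_on x z (insert k K)) \<le>
      \<Phi> x' + (\<theta> * \<sigma>) * \<Phi> (override_on x' z K)"
  proof -
    have "(\<theta> * \<sigma>) * \<Phi> (override_on x' z K) =
        \<sigma> * (\<theta> * \<Phi> (override_on x z K)) + \<theta> * (\<sigma> * \<sigma>) * \<Phi> (override_on x z (insert k K))"
      unfolding ov by (simp add: algebra_simps)
    then show ?thesis using \<sigma>(2,3) unfolding x' m_def by (simp add: algebra_simps)
  qed
  ultimately show ?case using \<eta> \<sigma>(1) le
    by (intro exI[of _ "\<eta>(k := \<sigma>)"]) auto
qed

text \<open>With \<open>\<theta>\<close> the sign of \<open>\<Phi> z\<close> the gain is the
  absolute value, so that repeated additions accumulate without cancellation.\<close>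

lemma exists_signs:
  assumes "finite K" "K \<noteq> {}" and \<Phi>: "multilinear_form_on K \<Phi>"
  obtains \<eta> where "\<And>k. \<bar>\<eta> k\<bar> = 1" "\<Phi> x + \<bar>\<Phi> z\<bar> \<le> \<Phi> (\<lambda>k. x k + \<eta> k *\<^sub>R z k)"
proof -
  define \<theta> :: real where "\<theta> = (if \<Phi> z \<ge> 0 then 1 else - 1)"
  have \<theta>: "\<theta> = 1 \<or> \<theta> = - 1" "\<theta> * \<Phi> z = \<bar>\<Phi> z\<bar>" by (auto simp: \<theta>_def)
  have ov: "\<Phi> (override_on x y K) = \<Phi> y" for y
    by (rule multilinear_form_on_cong[OF \<Phi>]) simp
  obtain \<eta> where "\<forall>k. \<eta> k = 1 \<or> \<eta> k = - 1" "\<Phi> x + \<bar>\<Phi> z\<bar> \<le> \<Phi> (\<lambda>k. x k + \<eta> k *\<^sub>R z k)"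
    using exists_signs_override[OF assms subset_refl \<theta>(1), where x = x and z = z] unfolding ov \<theta>(2) by blast
  then show thesis by (intro that[of \<eta>]) (metis abs_1 abs_minus)+
qed

text \<open>Slots are upgraded from \<open>B\<close> to \<open>B'\<close> one after another;
  \<open>L\<close> in the proof is the set of upgraded slots. The premise \<open>step\<close> leaves
  the other slots arbitrary, so a property proved by linearity or density in a single slot spreads
  to all of them.\<close>

lemma slotwise_extend:
  assumes "finite K"
    and step: "\<And>k x h. k \<in> K \<Longrightarrow> (\<And>b. b \<in> B \<Longrightarrow> P (x(k := b))) \<Longrightarrow> h \<in> B' \<Longrightarrow> P (x(k := h))"
    and base: "\<And>x. (\<And>k. k \<in> K \<Longrightarrow> x k \<in> B) \<Longrightarrow> P x"
    and x: "\<And>k. k \<in> K \<Longrightarrow> x k \<in> B'"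
  shows "P x"
proof -
  have "(\<forall>k\<in>K - L. x k \<in> B) \<longrightarrow> (\<forall>k\<in>L. x k \<in> B') \<longrightarrow> P x" if "finite L" "L \<subseteq> K" for L x
    using that
  proof (induction L arbitrary: x rule: finite_induct)
    case empty
    then show ?case using base by auto
  next
    case (insert k L)
    show ?case
    proof (intro impI)
      assume B: "\<forall>k\<in>K - insert k L. x k \<in> B" and B': "\<forall>k\<in>insert k L. x k \<in> B'"
      have "P (x(k := b))" if "b \<in> B" for b
        using insert B B' that by auto
      then show "P x" using step[of k x "x k"] insert.prems B' by simp
    qed
  qed
  from this[OF \<open>finite K\<close> subset_refl, of x] x show ?thesis by simp
qed

section \<open>Forms on step functions of one variable\<close>

lift_definition halfline :: "real \<Rightarrow> 1 dspace"
  is "\<lambda>u t. if t \<in> unit_cube \<and> t $ 1 < u then 1 else 0"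
proof (intro conjI)
  fix u :: real
  show "octant_limits (\<lambda>t :: real ^ 1. if t \<in> unit_cube \<and> t $ 1 < u then 1 else 0)"
    unfolding octant_limits_def
  proof (intro ballI allI impI)
    fix t :: "real ^ 1" and S :: "1 set"
    assume t: "t \<in> unit_cube" and S: "\<forall>i\<in>S. 0 < t $ i"
    have oc: "octant t S \<subseteq> unit_cube"
      using t by (auto simp: octant_def unit_cube_def split: if_splits)
    \<comment> \<open>At a jump \<open>t $ 1 = u\<close> the limit is 1 from the left
      (\<open>1 \<in> S\<close>) and 0 from the right.\<close>
    define l :: real where "l = (if t $ 1 < u \<or> (1 \<in> S \<and> t $ 1 = u) then 1 else 0)"
    have lt: "eventually (\<lambda>s :: real ^ 1. s $ 1 < u) (nhds t)" if "t $ 1 < u"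
      using that by (intro order_tendstoD[OF tendsto_vec_nth[OF filterlim_ident]])
    have gt: "eventually (\<lambda>s :: real ^ 1. u < s $ 1) (nhds t)" if "u < t $ 1"
      using that by (intro order_tendstoD[OF tendsto_vec_nth[OF filterlim_ident]])
    have "eventually (\<lambda>s. s \<in> octant t S \<longrightarrow> (if s \<in> unit_cube \<and> s $ 1 < u then 1 else 0) = l) (nhds t)"
    proof (cases "t $ 1" u rule: linorder_cases)
      case less
      from lt[OF less] show ?thesis
        by (rule eventually_mono) (use oc less in \<open>auto simp: l_def\<close>)
    next
      case equal
      then show ?thesis using oc
        by (intro always_eventually) (auto simp: l_def octant_def split: if_splits)
    next
      case greater
      from gt[OF greater] show ?thesis
        by (rule eventually_mono) (use oc greater in \<open>auto simp: l_def\<close>)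
    qed
    then show "\<exists>l::real. ((\<lambda>t. if t \<in> unit_cube \<and> t $ 1 < u then 1 else 0) \<longlongrightarrow> l) (inf (nhds t) (principal (octant t S)))"
      by (intro exI[of _ l] tendsto_eventually) (simp add: eventually_inf_principal)
  qed
qed auto

definition supported_on :: "1 dspace \<Rightarrow> real set \<Rightarrow> bool" where
  "supported_on x I \<longleftrightarrow> (\<forall>t. dfun x t \<noteq> 0 \<longrightarrow> t $ 1 \<in> I)"

lemma supported_on_mono: "supported_on x I \<Longrightarrow> I \<subseteq> J \<Longrightarrow> supported_on x J"
  unfolding supported_on_def by blast

lemma dfun_simps [simp]:
  "dfun 0 t = 0" "dfun (f + g) t = dfun f t + dfun g t" "dfun (f - g) t = dfun f t - dfun g t"
  "dfun (- f) t = - dfun f t" "dfun (c *\<^sub>R f) t = c * dfun f t"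
  by (simp_all add: zero_dspace.rep_eq plus_dspace.rep_eq minus_dspace.rep_eq uminus_dspace.rep_eq scaleR_dspace.rep_eq)

lemma dfun_sum: "dfun (\<Sum>i\<in>I. f i) t = (\<Sum>i\<in>I. dfun (f i) t)"
  by (induction I rule: infinite_finite_induct) auto

lemma dfun_interval:
  assumes "a \<le> b"
  shows "dfun (halfline b - halfline a) t = (if t \<in> unit_cube \<and> a \<le> t $ 1 \<and> t $ 1 < b then 1 else 0)"
  using assms by (auto simp: halfline.rep_eq)

lemma supported_on_interval: "a \<le> b \<Longrightarrow> supported_on (halfline b - halfline a) {a..<b}"
  unfolding supported_on_def by (auto simp: dfun_interval simp del: dfun_simps)

lemma norm_interval_le_1: "a \<le> b \<Longrightarrow> norm (halfline b - halfline a) \<le> 1"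
  by (rule norm_dspace_leI) (simp add: dfun_interval del: dfun_simps)

text \<open>In the supremum norm, pieces with disjoint supports contribute a maximum and not a sum.
  Arbitrarily many gains thus fit into the unit ball, against the boundedness of the form.\<close>

lemma disjoint_support_add:
  assumes "norm x \<le> 1" "norm z \<le> 1" "supported_on x I" "supported_on z J" "I \<inter> J = {}" "\<bar>c\<bar> = 1"
  shows "norm (x + c *\<^sub>R z) \<le> 1" "supported_on (x + c *\<^sub>R z) (I \<union> J)"
proof -
  show "supported_on (x + c *\<^sub>R z) (I \<union> J)"
    using assms(3,4) unfolding supported_on_def
    by (metis Un_iff add.right_neutral dfun_simps(2,5) mult_zero_right)
  show "norm (x + c *\<^sub>R z) \<le> 1"
  proof (rule norm_dspace_leI)
    fix t :: "real ^ 1"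
    have "dfun x t = 0 \<or> dfun z t = 0" using assms(3-5) unfolding supported_on_def by blast
    then show "\<bar>dfun (x + c *\<^sub>R z) t\<bar> \<le> 1"
      using abs_dfun_le_norm[of x t] abs_dfun_le_norm[of z t] assms(1,2,6) by (auto simp: abs_mult)
  qed
qed

abbreviation steps :: "1 dspace set" where "steps \<equiv> span (range halfline)"

lemma halfline_in_steps: "halfline u \<in> steps" by (simp add: span_base)

text \<open>Slot \<open>p\<close> does not react, in the limit, to moving a jump of a step function from \<open>t\<close> slightly to the
  right.\<close>

definition right_null :: "'k set \<Rightarrow> (('k \<Rightarrow> 1 dspace) \<Rightarrow> real) \<Rightarrow> 'k \<Rightarrow> real \<Rightarrow> bool" where
  "right_null K \<Phi> p t \<longleftrightarrow> (\<forall>x. (\<forall>k\<in>K. x k \<in> steps) \<longrightarrow>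
     ((\<lambda>s. \<Phi> (x(p := halfline s - halfline t))) \<longlongrightarrow> 0) (at_right t))"

text \<open>Slot \<open>p\<close> is overwritten by the jump; in every other slot a step function is
  a finite combination of half-lines, and multilinearity turns the value into a finite combination
  of null limits.\<close>

lemma right_null_if_halflines:
  assumes K: "finite K" and \<Phi>: "multilinear_form_on K \<Phi>"
    and lim: "\<And>w. ((\<lambda>s. \<Phi> ((\<lambda>k. halfline (w k))(p := halfline s - halfline t))) \<longlongrightarrow> 0) (at_right t)"
  shows "right_null K \<Phi> p t"
  unfolding right_null_def
proof (intro allI impI)
  fix x :: "'a \<Rightarrow> 1 dspace"
  assume x: "\<forall>k\<in>K. x k \<in> steps"
  show "((\<lambda>s. \<Phi> (x(p := halfline s - halfline t))) \<longlongrightarrow> 0) (at_right t)"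
  proof (rule slotwise_extend[where P = "\<lambda>x. ((\<lambda>s. \<Phi> (x(p := halfline s - halfline t))) \<longlongrightarrow> 0) (at_right t)"
        and K = K and B = "range halfline" and B' = steps])
    fix k x h
    assume k: "k \<in> K" and h: "h \<in> steps"
      and B: "\<And>b. b \<in> range halfline \<Longrightarrow> ((\<lambda>s. \<Phi> (x(k := b, p := halfline s - halfline t))) \<longlongrightarrow> 0) (at_right t)"
    show "((\<lambda>s. \<Phi> (x(k := h, p := halfline s - halfline t))) \<longlongrightarrow> 0) (at_right t)"
    proof (cases "k = p")
      case True
      then show ?thesis using B[of "halfline 0"] by simp
    next
      case False
      have eq: "\<Phi> (x(k := c *\<^sub>R a + b, p := i)) = c * \<Phi> (x(k := a, p := i)) + \<Phi> (x(k := b, p := i))" for a b c i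
        unfolding fun_upd_twist[OF False] using k \<Phi>
        by (simp only: multilinear_form_on_add multilinear_form_on_scale)
      have zero: "\<Phi> (x(k := 0, p := i)) = 0" for i
        using False by (intro multilinear_form_on_zero[OF \<Phi> k]) simp
      show ?thesis using h
      proof (induction h rule: span_induct_alt)
        case base
        show ?case by (simp only: zero tendsto_const)
      next
        case (step c a b)
        from tendsto_add[OF tendsto_mult_left[OF B[OF step(1)], of c] step(2)]
        show ?case by (simp only: eq mult_zero_right add_0_right)
      qed
    qed
  next
    fix y :: "'a \<Rightarrow> 1 dspace"
    assume "\<And>k. k \<in> K \<Longrightarrow> y k \<in> range halfline"
    then obtain w where "\<And>k. k \<in> K \<Longrightarrow> y k = halfline (w k)"
      unfolding image_iff by metis
    then have "\<Phi> (y(p := h)) = \<Phi> ((\<lambda>k. halfline (w k))(p := h))" for h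
      by (intro multilinear_form_on_cong[OF \<Phi>]) auto
    with lim[of w] show "((\<lambda>s. \<Phi> (y(p := halfline s - halfline t))) \<longlongrightarrow> 0) (at_right t)" by simp
  qed (use K x in auto)
qed

text \<open>Half-lines are not localized, so in each slot \<open>k\<close> other than
  \<open>p\<close> the half-line up to \<open>w k\<close> is cut down to [q k, w k) with a rational
  \<open>q k\<close> just below \<open>w k\<close>. Each cut subtracts the value of the form with
  that slot fixed at a rational half-line, and by \<open>rat\<close> this tends to 0 as the jump
  shrinks; half of \<open>\<delta>\<close> pays for all cuts. Rational end points keep the set of
  points \<open>t\<close> to be excluded countable.\<close>

lemma box_near_jump:
  assumes K: "finite K" "p \<in> K" and \<Phi>: "multilinear_form_on K \<Phi>"
    and w: "\<exists>\<^sub>F s in at_right t. \<delta> \<le> \<bar>\<Phi> ((\<lambda>k. halfline (w k))(p := halfline s - halfline t))\<bar>"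
    and \<delta>: "\<delta> > 0" and r: "r > 0"
    and rat: "\<And>k c. k \<in> K - {p} \<Longrightarrow> c \<in> \<rat> \<Longrightarrow> right_null (K - {k}) (\<lambda>x. \<Phi> (x(k := halfline c))) p t"
  obtains z where "\<And>k. k \<in> K \<Longrightarrow> norm (z k) \<le> 1"
    "\<And>k. k \<in> K \<Longrightarrow> supported_on (z k) (ball (if k = p then t else w k) r)"
    "\<delta> / 2 \<le> \<bar>\<Phi> z\<bar>"
proof -
  have "\<exists>q. q \<in> \<rat> \<and> w k - r < q \<and> q < w k" for k
    using Rats_dense_in_real[of "w k - r" "w k"] r by auto
  then obtain q where q: "\<And>k. q k \<in> \<rat>" "\<And>k. w k - r < q k" "\<And>k. q k < w k"
    by metis
  \<comment> \<open>\<open>L\<close> is the set of slots that are already cut.\<close>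
  define v where "v = (\<lambda>L k. if k \<in> L then halfline (w k) - halfline (q k) else halfline (w k))"
  have v_steps: "v L k \<in> steps" for L k
    by (auto simp: v_def intro: span_diff halfline_in_steps)
  have lim: "((\<lambda>s. \<Phi> ((v {})(p := halfline s - halfline t)) - \<Phi> ((v L)(p := halfline s - halfline t))) \<longlongrightarrow> 0) (at_right t)"
    if "finite L" "L \<subseteq> K - {p}" for L
    using that
  proof (induction L rule: finite_induct)
    case (insert k L)
    then have k: "k \<in> K" "k \<noteq> p" "k \<in> K - {p}" by auto
    have eq: "\<Phi> ((v (insert k L))(p := h)) = \<Phi> ((v L)(p := h)) - \<Phi> ((v L)(p := h, k := halfline (q k)))" for h
    proof -
      have "(v (insert k L))(p := h) = (v L)(p := h, k := halfline (w k) - halfline (q k))"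
        using k by (auto simp: v_def)
      moreover have "(v L)(p := h, k := halfline (w k)) = (v L)(p := h)"
        using insert k by (auto simp: v_def)
      ultimately show ?thesis using multilinear_form_on_diff[OF \<Phi> k(1)] by metis
    qed
    have "((\<lambda>s. \<Phi> ((v L)(p := halfline s - halfline t, k := halfline (q k)))) \<longlongrightarrow> 0) (at_right t)"
      using rat[OF k(3) q(1)[of k]] v_steps unfolding right_null_def by blast
    from tendsto_add[OF insert.IH this] insert.prems show ?case
      unfolding eq by (simp add: algebra_simps del: fun_upd_apply)
  qed simp
  have "\<exists>\<^sub>F s in at_right t. \<delta> / 2 \<le> \<bar>\<Phi> ((v (K - {p}))(p := halfline s - halfline t))\<bar> \<and> t < s \<and> s < t + r"
  proof -
    have "eventually (\<lambda>s. \<bar>\<Phi> ((v {})(p := halfline s - halfline t)) -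
         \<Phi> ((v (K - {p}))(p := halfline s - halfline t))\<bar> < \<delta> / 2) (at_right t)"
      using order_tendstoD(2)[OF tendsto_rabs[OF lim[of "K - {p}"]], of "\<delta> / 2"] K \<delta> by simp
    moreover have "eventually (\<lambda>s. t < s \<and> s < t + r) (at_right t)"
      using r unfolding eventually_at_right_field by (intro exI[of _ "t + r"]) auto
    ultimately have "eventually (\<lambda>s. \<delta> \<le> \<bar>\<Phi> ((v {})(p := halfline s - halfline t))\<bar> \<longrightarrow>
       \<delta> / 2 \<le> \<bar>\<Phi> ((v (K - {p}))(p := halfline s - halfline t))\<bar> \<and> t < s \<and> s < t + r) (at_right t)"
    proof eventually_elim
      case (elim s)
      then show ?case by (intro impI conjI) linarith+
    qed
    moreover have "\<exists>\<^sub>F s in at_right t. \<delta> \<le> \<bar>\<Phi> ((v {})(p := halfline s - halfline t))\<bar>"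
      using w by (simp add: v_def)
    ultimately show ?thesis by (rule frequently_rev_mp[rotated])
  qed
  then obtain s where s: "\<delta> / 2 \<le> \<bar>\<Phi> ((v (K - {p}))(p := halfline s - halfline t))\<bar>" "t < s" "s < t + r"
    by (auto dest: frequently_ex)
  show thesis
  proof (rule that[of "(v (K - {p}))(p := halfline s - halfline t)"])
    fix k assume k: "k \<in> K"
    show "norm (((v (K - {p}))(p := halfline s - halfline t)) k) \<le> 1"
      using k s q(3)[of k] by (auto simp: v_def intro: norm_interval_le_1)
    show "supported_on (((v (K - {p}))(p := halfline s - halfline t)) k) (ball (if k = p then t else w k) r)"
    proof (cases "k = p")
      case True
      have "{t..<s} \<subseteq> ball t r" using s by (auto simp: dist_real_def)
      then show ?thesis using supported_on_mono[OF supported_on_interval[of t s]] s True by simp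
    next
      case False
      have "{q k..<w k} \<subseteq> ball (w k) r" using q(2)[of k] by (auto simp: dist_real_def)
      then show ?thesis using supported_on_mono[OF supported_on_interval[of "q k" "w k"]] q(3)[of k] False k
        by (simp add: v_def)
    qed
  qed (use s in simp)
qed

text \<open>The boxes are glued one by one with signs from \<open>exists_signs\<close>: each adds
  its absolute value to the form, and disjointness in every slot keeps all norms at most 1.\<close>

lemma sum_over_disjoint_boxes:
  assumes K: "finite K" "K \<noteq> {}" and \<Phi>: "multilinear_form_on K \<Phi>" and "finite S"
    and z: "\<And>t k. t \<in> S \<Longrightarrow> k \<in> K \<Longrightarrow> norm (z t k) \<le> 1 \<and> supported_on (z t k) (I t k)"
    and disj: "\<And>t t' k. t \<in> S \<Longrightarrow> t' \<in> S \<Longrightarrow> t \<noteq> t' \<Longrightarrow> k \<in> K \<Longrightarrow> I t k \<inter> I t' k = {}"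
  obtains x where "\<And>k. k \<in> K \<Longrightarrow> norm (x k) \<le> 1" "(\<Sum>t\<in>S. \<bar>\<Phi> (z t)\<bar>) \<le> \<Phi> x"
proof -
  have "\<exists>x. (\<forall>k\<in>K. norm (x k) \<le> 1 \<and> supported_on (x k) (\<Union>t\<in>S'. I t k)) \<and> (\<Sum>t\<in>S'. \<bar>\<Phi> (z t)\<bar>) \<le> \<Phi> x"
    if "finite S'" "S' \<subseteq> S" for S'
    using that
  proof (induction S' rule: finite_induct)
    case empty
    have "\<Phi> (\<lambda>_. 0) = 0" using K multilinear_form_on_zero[OF \<Phi>] by (metis ex_in_conv)
    then show ?case by (intro exI[of _ "\<lambda>_. 0"]) (simp add: supported_on_def)
  next
    case (insert t S')
    then obtain x where x: "\<forall>k\<in>K. norm (x k) \<le> 1 \<and> supported_on (x k) (\<Union>t\<in>S'. I t k)"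
      "(\<Sum>t\<in>S'. \<bar>\<Phi> (z t)\<bar>) \<le> \<Phi> x" by auto
    obtain \<eta> where \<eta>: "\<And>k. \<bar>\<eta> k\<bar> = 1" "\<Phi> x + \<bar>\<Phi> (z t)\<bar> \<le> \<Phi> (\<lambda>k. x k + \<eta> k *\<^sub>R z t k)"
      using exists_signs[OF K \<Phi>] by blast
    have "norm (x k + \<eta> k *\<^sub>R z t k) \<le> 1 \<and> supported_on (x k + \<eta> k *\<^sub>R z t k) (\<Union>t\<in>insert t S'. I t k)"
      if k: "k \<in> K" for k
    proof -
      have "(\<Union>t\<in>S'. I t k) \<inter> I t k = {}" using disj insert k by (fastforce)
      then show ?thesis
        using disjoint_support_add[of "x k" "z t k" "\<Union>t\<in>S'. I t k" "I t k" "\<eta> k"] x(1) z[of t k] insert k \<eta>(1)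
        by (auto simp: Un_commute)
    qed
    with \<eta>(2) x(2) insert show ?case by (intro exI[of _ "\<lambda>k. x k + \<eta> k *\<^sub>R z t k"]) auto
  qed
  from this[OF \<open>finite S\<close> subset_refl] that show thesis by blast
qed

text \<open>Greedy choice: the points that clash in some slot with the finitely many chosen ones lie
  in finitely many countable fibres, and an uncountable set is not exhausted by these.\<close>

lemma injective_finite_selection:
  assumes "uncountable T" "finite K" and fib: "\<And>k c. k \<in> K \<Longrightarrow> countable {t \<in> T. W t k = c}"
  shows "\<exists>S\<subseteq>T. finite S \<and> card S = n \<and> (\<forall>k\<in>K. inj_on (\<lambda>t. W t k) S)"
proof (induction n)
  case 0
  show ?case by (intro exI[of _ "{}"]) simp
next
  case (Suc n)
  then obtain S where S: "S \<subseteq> T" "finite S" "card S = n" "\<forall>k\<in>K. inj_on (\<lambda>t. W t k) S" by blast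
  let ?U = "S \<union> (\<Union>k\<in>K. \<Union>s\<in>S. {t \<in> T. W t k = W s k})"
  have "countable ?U"
    using S assms by (intro countable_Un countable_UN fib) (auto intro: countable_finite)
  then have "\<not> T \<subseteq> ?U" using assms(1) countable_subset by blast
  then obtain t where t: "t \<in> T" "t \<notin> S" "\<And>k s. k \<in> K \<Longrightarrow> s \<in> S \<Longrightarrow> W t k \<noteq> W s k"
    by blast
  have "\<forall>k\<in>K. inj_on (\<lambda>t. W t k) (insert t S)"
  proof
    fix k assume "k \<in> K"
    with t(3) have "W t k \<notin> (\<lambda>t. W t k) ` S" by blast
    with S(4) \<open>k \<in> K\<close> show "inj_on (\<lambda>t. W t k) (insert t S)" by (auto intro: inj_on_insert[THEN iffD2])
  qed
  with S t show ?case by (intro exI[of _ "insert t S"]) auto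
qed

lemma finite_separation:
  fixes W :: "'a \<Rightarrow> 'k \<Rightarrow> real"
  assumes "finite K" "finite S" and "\<forall>k\<in>K. inj_on (\<lambda>t. W t k) S"
  obtains r where "r > 0" "\<And>k t t'. k \<in> K \<Longrightarrow> t \<in> S \<Longrightarrow> t' \<in> S \<Longrightarrow> t \<noteq> t' \<Longrightarrow> ball (W t k) r \<inter> ball (W t' k) r = {}"
proof -
  \<comment> \<open>The element 1 keeps \<open>D\<close> nonempty when there are no two points to
    compare.\<close>
  define D where "D = insert 1 {\<bar>W t k - W t' k\<bar> | k t t'. k \<in> K \<and> t \<in> S \<and> t' \<in> S \<and> t \<noteq> t'}"
  have "D \<subseteq> insert 1 ((\<lambda>(k, t, t'). \<bar>W t k - W t' k\<bar>) ` (K \<times> S \<times> S))"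
    unfolding D_def by force
  then have fin: "finite D" using assms finite_subset by blast
  have pos: "0 < d" if "d \<in> D" for d
    using that assms(3) unfolding D_def inj_on_def by auto
  have "Min D \<in> D" using fin by (intro Min_in) (auto simp: D_def)
  show thesis
  proof (rule that[of "Min D / 2"])
    show "0 < Min D / 2" using pos[OF \<open>Min D \<in> D\<close>] by simp
    fix k t t' assume "k \<in> K" "t \<in> S" "t' \<in> S" "t \<noteq> t'"
    then have "\<bar>W t k - W t' k\<bar> \<in> D" unfolding D_def by blast
    with fin have "Min D \<le> dist (W t k) (W t' k)" by (simp add: dist_real_def)
    then show "ball (W t k) (Min D / 2) \<inter> ball (W t' k) (Min D / 2) = {}"
      by (intro disjoint_ballI) simp
  qed
qed

text \<open>Otherwise uncountably many \<open>t\<close> share a lower bound \<open>\<delta>\<close>, each with half-lines \<open>w t k\<close> in the other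
  slots. By induction, the form with one slot fixed at a given half-line is right null for all but
  countably many \<open>t\<close>; hence the \<open>w t k\<close> can be taken distinct in every slot, and they are localized by
  subtracting half-lines with rational end points. This gives arbitrarily many disjoint boxes on
  which the form is at least \<open>\<delta> / 2\<close>, contradicting its boundedness.\<close>

lemma countable_not_right_null:
  assumes "finite K" "multilinear_form_on K \<Phi>" "p \<in> K"
  shows "countable {t. \<not> right_null K \<Phi> p t}"
  using assms
proof (induction "card K" arbitrary: K \<Phi> rule: less_induct)
  case (less K \<Phi>)
  note K = less.prems(1,3) and \<Phi> = less.prems(2)
  define jump where "jump = (\<lambda>w t s. \<Phi> ((\<lambda>k. halfline (w k))(p := halfline s - halfline t)))"
  define B where "B = (\<lambda>k c. {t. \<not> right_null (K - {k}) (\<lambda>x. \<Phi> (x(k := halfline c))) p t})"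
  have B: "countable (B k c)" if "k \<in> K - {p}" for k c
    unfolding B_def
  proof (rule less.hyps)
    show "card (K - {k}) < card K" using that K(1) by (intro psubset_card_mono) auto
  qed (use that K multilinear_form_on_fix[OF \<Phi>] in auto)
  define Z where "Z = (\<Union>k\<in>K - {p}. \<Union>c\<in>\<rat>. B k c)"
  have Z: "countable Z"
    unfolding Z_def using K by (intro countable_UN B countable_rat) (auto intro: countable_finite)
  show ?case
  proof (rule ccontr)
    assume "\<not> ?case"
    then have unc: "uncountable ({t. \<not> right_null K \<Phi> p t} - Z)"
      using Z by (simp add: uncountable_minus_countable)
    have "\<exists>w n. \<exists>\<^sub>F s in at_right t. 1 / real (Suc n) \<le> \<bar>jump w t s\<bar>" if "\<not> right_null K \<Phi> p t" for t
    proof -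
      have "\<exists>w. \<not> (jump w t \<longlongrightarrow> 0) (at_right t)"
      proof (rule ccontr)
        assume "\<not> ?thesis"
        then have "(jump w t \<longlongrightarrow> 0) (at_right t)" for w by blast
        then have "right_null K \<Phi> p t"
          unfolding jump_def by (rule right_null_if_halflines[OF K(1) \<Phi>])
        with that show False ..
      qed
      then obtain w where "\<not> (jump w t \<longlongrightarrow> 0) (at_right t)" ..
      then obtain e where e: "e > 0" "\<exists>\<^sub>F s in at_right t. e \<le> \<bar>jump w t s\<bar>"
        unfolding tendsto_iff by (auto simp: dist_real_def frequently_def not_le)
      obtain n where "1 / real (Suc n) < e" using reals_Archimedean[OF e(1)] by (auto simp: inverse_eq_divide)
      with e(2) have "\<exists>\<^sub>F s in at_right t. 1 / real (Suc n) \<le> \<bar>jump w t s\<bar>"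
        by (elim frequently_elim1) linarith
      then show ?thesis by blast
    qed
    then obtain w n where w: "\<And>t. \<not> right_null K \<Phi> p t \<Longrightarrow> \<exists>\<^sub>F s in at_right t. 1 / real (Suc (n t)) \<le> \<bar>jump (w t) t s\<bar>"
      by metis
    define T where "T = (\<lambda>m. {t. \<not> right_null K \<Phi> p t \<and> t \<notin> Z \<and> n t = m})"
    have "{t. \<not> right_null K \<Phi> p t} - Z = (\<Union>m. T m)" by (auto simp: T_def)
    with unc obtain m where T: "uncountable (T m)" by (metis countable_UN countableI_type)
    define \<delta> where "\<delta> = 1 / real (Suc m)"
    have \<delta>: "\<delta> > 0" by (simp add: \<delta>_def)
    have fr: "\<exists>\<^sub>F s in at_right t. \<delta> \<le> \<bar>jump (w t) t s\<bar>" if "t \<in> T m" for t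
      using w[of t] that unfolding T_def \<delta>_def by auto
    define W where "W = (\<lambda>t k. if k = p then t else w t k)"
    have fib: "countable {t \<in> T m. W t k = c}" if k: "k \<in> K" for k c
    proof (cases "k = p")
      case True
      have "{t \<in> T m. W t k = c} \<subseteq> {c}" using True by (auto simp: W_def)
      then show ?thesis by (meson countable_finite countable_subset finite.emptyI finite.insertI)
    next
      case False
      \<comment> \<open>If \<open>w t k = c\<close>, then fixing slot \<open>k\<close> at
        \<open>halfline c\<close> changes nothing in the family of half-lines at \<open>t\<close>.
        Right nullity of the fixed form would thus make the jump tend to 0, against the lower bound
        \<open>\<delta>\<close>. So the fibre lies in a countable set.\<close>
      have "t \<in> B k c" if t: "t \<in> T m" "w t k = c" for t
      proof (rule ccontr)
        assume "t \<notin> B k c"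
        then have "right_null (K - {k}) (\<lambda>x. \<Phi> (x(k := halfline c))) p t" by (simp add: B_def)
        from this[unfolded right_null_def, rule_format, of "\<lambda>k. halfline (w t k)"]
        have "((\<lambda>s. \<Phi> ((\<lambda>k. halfline (w t k))(p := halfline s - halfline t, k := halfline c))) \<longlongrightarrow> 0) (at_right t)"
          by (blast intro: halfline_in_steps)
        moreover have "(\<lambda>k. halfline (w t k))(p := h, k := halfline c) = (\<lambda>k. halfline (w t k))(p := h)" for h
          using False t by auto
        ultimately have "(jump (w t) t \<longlongrightarrow> 0) (at_right t)" unfolding jump_def by simp
        from order_tendstoD(2)[OF tendsto_rabs[OF this], of \<delta>] fr[OF t(1)] \<delta>
        show False by (auto simp: frequently_def not_le)
      qed
      then have "{t \<in> T m. W t k = c} \<subseteq> B k c" using False by (auto simp: W_def)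
      with B[of k c] k False show ?thesis using countable_subset by blast
    qed
    obtain C where C: "\<And>x. (\<And>k. k \<in> K \<Longrightarrow> norm (x k) \<le> 1) \<Longrightarrow> \<bar>\<Phi> x\<bar> \<le> C"
      using multilinear_form_on_bound[OF \<Phi>] by blast
    \<comment> \<open>\<open>N\<close> boxes worth \<open>\<delta> / 2\<close> each exceed the bound
      \<open>C\<close> on the unit ball.\<close>
    obtain N where N: "C < real N * (\<delta> / 2)"
      using ex_less_of_nat_mult[of "\<delta> / 2" C] \<delta> by auto
    obtain S where S: "S \<subseteq> T m" "finite S" "card S = N" "\<forall>k\<in>K. inj_on (\<lambda>t. W t k) S"
      using injective_finite_selection[where W = W and n = N, OF T K(1) fib] by blast
    obtain r where r: "r > 0"
      "\<And>k t t'. k \<in> K \<Longrightarrow> t \<in> S \<Longrightarrow> t' \<in> S \<Longrightarrow> t \<noteq> t' \<Longrightarrow> ball (W t k) r \<inter> ball (W t' k) r = {}"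
      by (rule finite_separation[OF K(1) S(2,4)]) blast
    have "\<exists>z. (\<forall>k\<in>K. norm (z k) \<le> 1 \<and> supported_on (z k) (ball (W t k) r)) \<and> \<delta> / 2 \<le> \<bar>\<Phi> z\<bar>"
      if t: "t \<in> S" for t
    proof -
      have tT: "t \<in> T m" using t S(1) by auto
      have "right_null (K - {k}) (\<lambda>x. \<Phi> (x(k := halfline c))) p t" if "k \<in> K - {p}" "c \<in> \<rat>" for k c
        using tT that unfolding T_def Z_def B_def by blast
      from box_near_jump[OF K \<Phi> fr[OF tT, unfolded jump_def] \<delta> r(1) this]
      obtain z where "\<And>k. k \<in> K \<Longrightarrow> norm (z k) \<le> 1"
        "\<And>k. k \<in> K \<Longrightarrow> supported_on (z k) (ball (W t k) r)" "\<delta> / 2 \<le> \<bar>\<Phi> z\<bar>"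
        unfolding W_def by blast
      then show ?thesis by blast
    qed
    then obtain z where z: "\<And>t. t \<in> S \<Longrightarrow> (\<forall>k\<in>K. norm (z t k) \<le> 1 \<and> supported_on (z t k) (ball (W t k) r)) \<and> \<delta> / 2 \<le> \<bar>\<Phi> (z t)\<bar>"
      by metis
    have "K \<noteq> {}" using K by auto
    then obtain x where x: "\<And>k. k \<in> K \<Longrightarrow> norm (x k) \<le> 1" "(\<Sum>t\<in>S. \<bar>\<Phi> (z t)\<bar>) \<le> \<Phi> x"
      by (rule sum_over_disjoint_boxes[OF K(1) _ \<Phi> S(2), where z = z and I = "\<lambda>t k. ball (W t k) r"])
        (use z r(2) in blast)+
    have "real N * (\<delta> / 2) \<le> (\<Sum>t\<in>S. \<bar>\<Phi> (z t)\<bar>)"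
      using sum_mono[of S "\<lambda>_. \<delta> / 2" "\<lambda>t. \<bar>\<Phi> (z t)\<bar>"] z S(3) by simp
    moreover have "\<bar>\<Phi> x\<bar> \<le> C" using x(1) by (rule C)
    ultimately show False using x(2) N by linarith
  qed
qed

section \<open>Displacing the jumps in several slots at once\<close>

lemma right_null_override:
  assumes \<Phi>: "multilinear_form_on K \<Phi>" and rn: "right_null K \<Phi> p t" and "p \<in> A"
    and y: "\<And>k. k \<in> K \<Longrightarrow> y k \<in> steps"
  shows "right_null A (\<lambda>x. \<Phi> (override_on y x A)) p t"
  unfolding right_null_def
proof (intro allI impI)
  fix x :: "'a \<Rightarrow> 1 dspace" assume "\<forall>k\<in>A. x k \<in> steps"
  then have "((\<lambda>s. \<Phi> ((override_on y x A)(p := halfline s - halfline t))) \<longlongrightarrow> 0) (at_right t)"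
    using rn y unfolding right_null_def by (simp add: override_on_def)
  moreover have "(override_on y x A)(p := h) = override_on y (x(p := h)) A" for h
    using \<open>p \<in> A\<close> by (auto simp: override_on_def)
  ultimately show "((\<lambda>s. \<Phi> (override_on y (x(p := halfline s - halfline t)) A)) \<longlongrightarrow> 0) (at_right t)"
    by simp
qed

text \<open>By right nullity, moving the left end point of one slot from \<open>u k\<close> slightly
  to the right changes the form by arbitrarily little, so the strict inequality survives slot by
  slot. The gap between \<open>u k\<close> and \<open>b k\<close> is left free for further
  boxes.\<close>

lemma shrink_boxes:
  assumes A: "finite A" and \<Phi>: "multilinear_form_on A \<Phi>"
    and rn: "\<And>k. k \<in> A \<Longrightarrow> right_null A \<Phi> k (u k)"
    and s: "\<And>k. k \<in> A \<Longrightarrow> u k < s k" and big: "\<delta> < \<bar>\<Phi> (\<lambda>k. halfline (s k) - halfline (u k))\<bar>"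
  obtains b where "\<And>k. k \<in> A \<Longrightarrow> u k < b k \<and> b k < s k" "\<delta> < \<bar>\<Phi> (\<lambda>k. halfline (s k) - halfline (b k))\<bar>"
proof -
  have "\<exists>b. (\<forall>k\<in>L. u k < b k \<and> b k < s k) \<and>
     \<delta> < \<bar>\<Phi> (\<lambda>k. if k \<in> L then halfline (s k) - halfline (b k) else halfline (s k) - halfline (u k))\<bar>"
    if "finite L" "L \<subseteq> A" for L
    using that
  proof (induction L rule: finite_induct)
    case empty
    then show ?case using big by simp
  next
    case (insert k L)
    then obtain b where b: "\<forall>k\<in>L. u k < b k \<and> b k < s k"
      and \<delta>: "\<delta> < \<bar>\<Phi> (\<lambda>k. if k \<in> L then halfline (s k) - halfline (b k) else halfline (s k) - halfline (u k))\<bar>"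
      by auto
    define x where "x = (\<lambda>k. if k \<in> L then halfline (s k) - halfline (b k) else halfline (s k) - halfline (u k))"
    have k: "k \<in> A" using insert by auto
    have "x l \<in> steps" for l unfolding x_def by (auto intro: span_diff halfline_in_steps)
    then have lim: "((\<lambda>c. \<Phi> (x(k := halfline c - halfline (u k)))) \<longlongrightarrow> 0) (at_right (u k))"
      using rn[OF k] unfolding right_null_def by blast
    have eq: "\<Phi> (x(k := halfline (s k) - halfline c)) = \<Phi> x - \<Phi> (x(k := halfline c - halfline (u k)))" for c
    proof -
      have "\<Phi> (x(k := (halfline (s k) - halfline (u k)) - (halfline c - halfline (u k)))) =
          \<Phi> (x(k := halfline (s k) - halfline (u k))) - \<Phi> (x(k := halfline c - halfline (u k)))"
        by (rule multilinear_form_on_diff[OF \<Phi> k])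
      moreover have "x(k := halfline (s k) - halfline (u k)) = x"
        using insert by (auto simp: x_def)
      ultimately show ?thesis by simp
    qed
    have "((\<lambda>c. \<bar>\<Phi> (x(k := halfline (s k) - halfline c))\<bar>) \<longlongrightarrow> \<bar>\<Phi> x\<bar>) (at_right (u k))"
      unfolding eq using tendsto_rabs[OF tendsto_diff[OF tendsto_const[of "\<Phi> x"] lim]] by simp
    from order_tendstoD(1)[OF this \<delta>[folded x_def]]
    have "eventually (\<lambda>c. \<delta> < \<bar>\<Phi> (x(k := halfline (s k) - halfline c))\<bar>) (at_right (u k))" .
    moreover have "eventually (\<lambda>c. u k < c \<and> c < s k) (at_right (u k))"
      using s[OF k] unfolding eventually_at_right_field by blast
    ultimately have "eventually (\<lambda>c. \<delta> < \<bar>\<Phi> (x(k := halfline (s k) - halfline c))\<bar> \<and> u k < c \<and> c < s k) (at_right (u k))"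
      by eventually_elim simp
    then obtain c where c: "\<delta> < \<bar>\<Phi> (x(k := halfline (s k) - halfline c))\<bar>" "u k < c" "c < s k"
      using eventually_happens'[OF trivial_limit_at_right_real] by blast
    have upd: "x(k := halfline (s k) - halfline c) =
       (\<lambda>l. if l \<in> insert k L then halfline (s l) - halfline ((b(k := c)) l) else halfline (s l) - halfline (u l))"
      using insert by (auto simp: x_def)
    have "\<forall>l\<in>insert k L. u l < (b(k := c)) l \<and> (b(k := c)) l < s l"
      using b c(2,3) by simp
    with c(1)[unfolded upd] show ?case by blast
  qed
  from this[OF A subset_refl] obtain b where b: "\<forall>k\<in>A. u k < b k \<and> b k < s k"
    "\<delta> < \<bar>\<Phi> (\<lambda>k. if k \<in> A then halfline (s k) - halfline (b k) else halfline (s k) - halfline (u k))\<bar>" by blast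
  have "\<Phi> (\<lambda>k. if k \<in> A then halfline (s k) - halfline (b k) else halfline (s k) - halfline (u k)) =
      \<Phi> (\<lambda>k. halfline (s k) - halfline (b k))"
    by (rule multilinear_form_on_cong[OF \<Phi>]) simp
  from b(2)[unfolded this] b(1) show thesis by (intro that[of b]) blast+
qed

text \<open>Right nullity concerns one slot at a time. A failure of simultaneous convergence is again
  turned into many disjoint boxes, cut off from \<open>u\<close> slot by slot.\<close>

lemma right_null_simultaneous:
  assumes A: "finite A" "A \<noteq> {}" and \<Phi>: "multilinear_form_on A \<Phi>"
    and rn: "\<And>k. k \<in> A \<Longrightarrow> right_null A \<Phi> k (u k)" and \<epsilon>: "\<epsilon> > 0"
  shows "\<exists>\<rho>>0. \<forall>s. (\<forall>k\<in>A. u k < s k \<and> s k < u k + \<rho>) \<longrightarrow> \<bar>\<Phi> (\<lambda>k. halfline (s k) - halfline (u k))\<bar> < \<epsilon>"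
proof (rule ccontr)
  assume no: "\<not> ?thesis"
  have ex: "\<exists>s. (\<forall>k\<in>A. u k < s k \<and> s k < u k + \<rho>) \<and> \<epsilon> \<le> \<bar>\<Phi> (\<lambda>k. halfline (s k) - halfline (u k))\<bar>"
    if "\<rho> > 0" for \<rho>
    using no that unfolding not_less[symmetric] by blast
  \<comment> \<open>Boxes accumulate towards \<open>u\<close>: a new box is cut off first, and then
    the induction hypothesis is applied inside the gap that it leaves. This is why
    \<open>\<rho>\<close> is arbitrary in the induction.\<close>
  have "\<exists>x. (\<forall>k\<in>A. norm (x k) \<le> 1 \<and> supported_on (x k) {u k<..<u k + \<rho>}) \<and> real n * (\<epsilon> / 2) \<le> \<Phi> x"
    if "\<rho> > 0" for n \<rho>
    using that
  proof (induction n arbitrary: \<rho>)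
    case 0
    have "\<Phi> (\<lambda>_. 0) = 0" using A multilinear_form_on_zero[OF \<Phi>] by (metis ex_in_conv)
    then show ?case by (intro exI[of _ "\<lambda>_. 0"]) (simp add: supported_on_def)
  next
    case (Suc n)
    obtain s where s: "\<forall>k\<in>A. u k < s k \<and> s k < u k + \<rho>"
      "\<epsilon> \<le> \<bar>\<Phi> (\<lambda>k. halfline (s k) - halfline (u k))\<bar>"
      using ex[OF Suc.prems] by blast
    from s(2) \<epsilon> have "\<epsilon> / 2 < \<bar>\<Phi> (\<lambda>k. halfline (s k) - halfline (u k))\<bar>" by linarith
    from shrink_boxes[OF A(1) \<Phi> rn _ this] s(1)
    obtain b where b: "\<And>k. k \<in> A \<Longrightarrow> u k < b k \<and> b k < s k"
      "\<epsilon> / 2 < \<bar>\<Phi> (\<lambda>k. halfline (s k) - halfline (b k))\<bar>"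
      by blast
    \<comment> \<open>The smallest gap, so that everything supported in
      \<open>{u k<..<u k + \<rho>'}\<close> stays to the left of the new box in every slot.\<close>
    define \<rho>' where "\<rho>' = Min ((\<lambda>k. b k - u k) ` A)"
    have \<rho>': "\<rho>' > 0" "\<And>k. k \<in> A \<Longrightarrow> \<rho>' \<le> b k - u k"
      using A b(1) by (auto simp: \<rho>'_def)
    obtain x where x: "\<forall>k\<in>A. norm (x k) \<le> 1 \<and> supported_on (x k) {u k<..<u k + \<rho>'}"
      "real n * (\<epsilon> / 2) \<le> \<Phi> x"
      using Suc.IH[OF \<rho>'(1)] by blast
    obtain \<eta> where \<eta>: "\<And>k. \<bar>\<eta> k\<bar> = 1"
      "\<Phi> x + \<bar>\<Phi> (\<lambda>k. halfline (s k) - halfline (b k))\<bar> \<le> \<Phi> (\<lambda>k. x k + \<eta> k *\<^sub>R (halfline (s k) - halfline (b k)))"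
      using exists_signs[OF A \<Phi>] by blast
    have "norm (x k + \<eta> k *\<^sub>R (halfline (s k) - halfline (b k))) \<le> 1 \<and>
        supported_on (x k + \<eta> k *\<^sub>R (halfline (s k) - halfline (b k))) {u k<..<u k + \<rho>}" if k: "k \<in> A" for k
    proof -
      have le: "b k \<le> s k" using b(1)[OF k] by simp
      have disj: "{u k<..<u k + \<rho>'} \<inter> {b k..<s k} = {}" using \<rho>'(2)[OF k] by auto
      have sub: "{u k<..<u k + \<rho>'} \<union> {b k..<s k} \<subseteq> {u k<..<u k + \<rho>}"
        using b(1)[OF k] s(1) k \<rho>'(2)[OF k] by (fastforce)
      show ?thesis
        using disjoint_support_add[of "x k" "halfline (s k) - halfline (b k)", OF _ norm_interval_le_1[OF le] _ supported_on_interval[OF le] disj \<eta>(1)[of k]]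
          x(1) k supported_on_mono[OF _ sub] by blast
    qed
    moreover have "real (Suc n) * (\<epsilon> / 2) \<le> \<Phi> (\<lambda>k. x k + \<eta> k *\<^sub>R (halfline (s k) - halfline (b k)))"
      using \<eta>(2) x(2) b(2) by (simp add: algebra_simps)
    ultimately show ?case
      by - (rule exI[of _ "\<lambda>k. x k + \<eta> k *\<^sub>R (halfline (s k) - halfline (b k))"], rule conjI, rule ballI)
  qed
  note boxes = this[OF zero_less_one]
  obtain C where C: "\<And>x. (\<And>k. k \<in> A \<Longrightarrow> norm (x k) \<le> 1) \<Longrightarrow> \<bar>\<Phi> x\<bar> \<le> C"
    using multilinear_form_on_bound[OF \<Phi>] by blast
  obtain N where N: "C < real N * (\<epsilon> / 2)"
    using ex_less_of_nat_mult[of "\<epsilon> / 2" C] \<epsilon> by auto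
  obtain x where x: "\<forall>k\<in>A. norm (x k) \<le> 1" "real N * (\<epsilon> / 2) \<le> \<Phi> x"
    using boxes[of N] by blast
  with C[of x] N show False by fastforce
qed

text \<open>Each \<open>halfline (v n k)\<close> is the limit half-line plus an increment
  \<open>\<Delta> n k\<close>. In the expansion every term with an increment tends to 0: an
  increment at a point of \<open>Q\<close> vanishes eventually, and if all increments sit off
  \<open>Q\<close>, then \<open>right_null_simultaneous\<close> applies to the form in just these
  slots.\<close>

lemma tendsto_halflines_from_right:
  assumes K: "finite K" and \<Phi>: "multilinear_form_on K \<Phi>"
    and rn: "\<And>k. k \<in> K \<Longrightarrow> u k \<notin> Q \<Longrightarrow> right_null K \<Phi> k (u k)"
    and v_in: "\<And>k. k \<in> K \<Longrightarrow> u k \<in> Q \<Longrightarrow> eventually (\<lambda>n. v n k = u k) F"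
    and v_notin: "\<And>k. k \<in> K \<Longrightarrow> u k \<notin> Q \<Longrightarrow> ((\<lambda>n. v n k) \<longlongrightarrow> u k) F"
    and v_gt: "\<And>k. k \<in> K \<Longrightarrow> u k \<notin> Q \<Longrightarrow> eventually (\<lambda>n. u k < v n k) F"
  shows "((\<lambda>n. \<Phi> (\<lambda>k. halfline (v n k))) \<longlongrightarrow> \<Phi> (\<lambda>k. halfline (u k))) F"
proof -
  define \<Delta> where "\<Delta> = (\<lambda>n k. halfline (v n k) - halfline (u k))"
  define e where "e = (\<lambda>k. halfline (u k))"
  have e_steps: "e k \<in> steps" for k by (simp add: e_def halfline_in_steps)
  have null: "((\<lambda>n. \<Phi> (override_on e (\<Delta> n) A)) \<longlongrightarrow> 0) F" if A: "A \<subseteq> K" "A \<noteq> {}" for A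
  proof (cases "\<exists>k\<in>A. u k \<in> Q")
    case True
    then obtain k where k: "k \<in> A" "u k \<in> Q" by blast
    with A v_in have "eventually (\<lambda>n. v n k = u k) F" by blast
    then have "eventually (\<lambda>n. \<Phi> (override_on e (\<Delta> n) A) = 0) F"
      by (rule eventually_mono) (use k A in \<open>auto intro!: multilinear_form_on_zero[OF \<Phi>, of k] simp: \<Delta>_def override_on_def\<close>)
    then show ?thesis by (rule tendsto_eventually)
  next
    case False
    have fA: "finite A" using A K finite_subset by blast
    have mA: "multilinear_form_on A (\<lambda>x. \<Phi> (override_on e x A))"
      by (rule multilinear_form_on_override[OF \<Phi> K A(1)])
    have rnA: "right_null A (\<lambda>x. \<Phi> (override_on e x A)) k (u k)" if "k \<in> A" for k
      using that False A rn e_steps by (intro right_null_override[OF \<Phi>]) auto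
    show ?thesis unfolding tendsto_iff
    proof (intro allI impI)
      fix \<epsilon> :: real assume "\<epsilon> > 0"
      from right_null_simultaneous[OF fA A(2) mA rnA this] obtain \<rho> where \<rho>: "\<rho> > 0"
        "\<And>s. (\<forall>k\<in>A. u k < s k \<and> s k < u k + \<rho>) \<Longrightarrow> \<bar>\<Phi> (override_on e (\<lambda>k. halfline (s k) - halfline (u k)) A)\<bar> < \<epsilon>"
        by blast
      have "eventually (\<lambda>n. \<forall>k\<in>A. u k < v n k \<and> v n k < u k + \<rho>) F"
      proof (intro eventually_ball_finite ballI fA eventually_conj)
        fix k assume "k \<in> A"
        then show "eventually (\<lambda>n. u k < v n k) F" using v_gt A False by blast
        show "eventually (\<lambda>n. v n k < u k + \<rho>) F"
          using \<open>k \<in> A\<close> A False \<rho>(1) by (intro order_tendstoD(2)[OF v_notin]) auto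
      qed
      then show "eventually (\<lambda>n. dist (\<Phi> (override_on e (\<Delta> n) A)) 0 < \<epsilon>) F"
        by (rule eventually_mono) (use \<rho>(2) in \<open>simp add: \<Delta>_def\<close>)
    qed
  qed
  \<comment> \<open>The slots in \<open>L\<close> are not yet expanded, those in \<open>A\<close>
    carry an increment, the remaining ones carry the limit half-line. Expanding one more slot splits
    the term into those for \<open>A\<close> and \<open>insert k A\<close>; only
    \<open>A = {}\<close> leaves a nonzero limit.\<close>
  have "((\<lambda>n. \<Phi> (\<lambda>k. if k \<in> L then halfline (v n k) else if k \<in> A then \<Delta> n k else e k)) \<longlongrightarrow> (if A = {} then \<Phi> e else 0)) F"
    if "finite L" "L \<subseteq> K" "A \<subseteq> K - L" for L A
    using that
  proof (induction L arbitrary: A rule: finite_induct)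
    case empty
    have eq: "(\<lambda>k. if k \<in> {} then halfline (v n k) else if k \<in> A then \<Delta> n k else e k) = override_on e (\<Delta> n) A" for n
      by (auto simp: override_on_def)
    show ?case
    proof (cases "A = {}")
      case False
      with null[of A] empty show ?thesis unfolding eq by simp
    qed simp
  next
    case (insert k L)
    let ?x = "\<lambda>L A n l. if l \<in> L then halfline (v n l) else if l \<in> A then \<Delta> n l else e l"
    have k: "k \<in> K" "k \<notin> A" using insert by auto
    have eq: "\<Phi> (?x (insert k L) A n) = \<Phi> (?x L A n) + \<Phi> (?x L (insert k A) n)" for n
    proof -
      have "\<Phi> ((?x L A n)(k := e k + \<Delta> n k)) = \<Phi> ((?x L A n)(k := e k)) + \<Phi> ((?x L A n)(k := \<Delta> n k))"
        by (rule multilinear_form_on_add[OF \<Phi> k(1)])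
      moreover have "(?x L A n)(k := e k + \<Delta> n k) = ?x (insert k L) A n"
        by (auto simp: e_def \<Delta>_def)
      moreover have "(?x L A n)(k := e k) = ?x L A n" using insert k by auto
      moreover have "(?x L A n)(k := \<Delta> n k) = ?x L (insert k A) n" using insert k by auto
      ultimately show ?thesis by simp
    qed
    have lim1: "((\<lambda>n. \<Phi> (?x L A n)) \<longlongrightarrow> (if A = {} then \<Phi> e else 0)) F"
      using insert.prems by (intro insert.IH) auto
    have lim2: "((\<lambda>n. \<Phi> (?x L (insert k A) n)) \<longlongrightarrow> (if insert k A = {} then \<Phi> e else 0)) F"
      using insert.prems insert.hyps by (intro insert.IH) auto
    have "(if A = {} then \<Phi> e else 0) + (if insert k A = {} then \<Phi> e else 0) = (if A = {} then \<Phi> e else 0)"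
      by simp
    from tendsto_add[OF lim1 lim2, unfolded this] show ?case unfolding eq .
  qed
  from this[OF K subset_refl, of "{}"]
  have "((\<lambda>n. \<Phi> (\<lambda>k. if k \<in> K then halfline (v n k) else if k \<in> {} then \<Delta> n k else e k)) \<longlongrightarrow> \<Phi> e) F" by simp
  moreover have "\<Phi> (\<lambda>k. if k \<in> K then halfline (v n k) else if k \<in> {} then \<Delta> n k else e k) = \<Phi> (\<lambda>k. halfline (v n k))" for n
    by (rule multilinear_form_on_cong[OF \<Phi>]) simp
  ultimately show ?thesis unfolding e_def by simp
qed

section \<open>Tensor products and grid approximations\<close>

lemma octant_limits_tensor:
  fixes f :: "'m::finite \<Rightarrow> 1 dspace"
  shows "octant_limits (\<lambda>t :: real ^ 'm. \<Prod>i\<in>UNIV. dfun (f i) (vec (t $ i)))"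
  unfolding octant_limits_def
proof (intro ballI allI impI)
  fix t :: "real ^ 'm" and S :: "'m set"
  assume t: "t \<in> unit_cube" and S: "\<forall>i\<in>S. 0 < t $ i"
  \<comment> \<open>The side of \<open>t $ i\<close> from which coordinate \<open>i\<close> is
    approached, recoded as an index set in dimension one: \<open>UNIV\<close> for the left, empty
    for the right.\<close>
  define S' where "S' = (\<lambda>i. if i \<in> S then UNIV else {} :: 1 set)"
  have "\<exists>l. (dfun (f i) \<longlongrightarrow> l) (inf (nhds (vec (t $ i))) (principal (octant (vec (t $ i)) (S' i))))" for i
  proof -
    have "octant_limits (dfun (f i))" using dfun[of "f i"] by simp
    moreover have "vec (t $ i) \<in> (unit_cube :: (real ^ 1) set)" using t by (simp add: unit_cube_def)
    moreover have "\<forall>k\<in>S' i. 0 < vec (t $ i) $ k" using S by (simp add: S'_def)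
    ultimately show ?thesis unfolding octant_limits_def by blast
  qed
  then obtain l where l: "\<And>i. (dfun (f i) \<longlongrightarrow> l i) (inf (nhds (vec (t $ i))) (principal (octant (vec (t $ i)) (S' i))))"
    by metis
  have "filterlim (\<lambda>s. vec (s $ i)) (inf (nhds (vec (t $ i))) (principal (octant (vec (t $ i)) (S' i))))
      (inf (nhds t) (principal (octant t S)))" for i
    unfolding filterlim_inf
  proof
    have "((\<lambda>s. vec (s $ i) :: real ^ 1) \<longlongrightarrow> vec (t $ i)) (nhds t)"
      unfolding vec_def by (intro tendsto_vec_lambda tendsto_vec_nth filterlim_ident)
    then show "((\<lambda>s. vec (s $ i) :: real ^ 1) \<longlongrightarrow> vec (t $ i)) (inf (nhds t) (principal (octant t S)))"
      by (rule tendsto_mono[rotated]) simp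
    show "filterlim (\<lambda>s. vec (s $ i)) (principal (octant (vec (t $ i)) (S' i))) (inf (nhds t) (principal (octant t S)))"
      unfolding filterlim_principal eventually_inf_principal
      by (intro always_eventually allI impI) (auto simp: octant_def S'_def split: if_splits)
  qed
  then have "((\<lambda>s. dfun (f i) (vec (s $ i))) \<longlongrightarrow> l i) (inf (nhds t) (principal (octant t S)))" for i
    by (rule filterlim_compose[OF l])
  then have "((\<lambda>s. \<Prod>i\<in>UNIV. dfun (f i) (vec (s $ i))) \<longlongrightarrow> (\<Prod>i\<in>UNIV. l i)) (inf (nhds t) (principal (octant t S)))"
    by (rule tendsto_prod)
  then show "\<exists>l. ((\<lambda>t. \<Prod>i\<in>UNIV. dfun (f i) (vec (t $ i))) \<longlongrightarrow> l) (inf (nhds t) (principal (octant t S)))"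
    by blast
qed

definition tensor :: "('m::finite \<Rightarrow> 1 dspace) \<Rightarrow> 'm dspace" where
  "tensor f = Abs_dspace (\<lambda>t. \<Prod>i\<in>UNIV. dfun (f i) (vec (t $ i)))"

lemma dfun_tensor: "dfun (tensor f) t = (\<Prod>i\<in>UNIV. dfun (f i) (vec (t $ i)))"
proof -
  have "(\<Prod>i\<in>UNIV. dfun (f i) (vec (t $ i))) = 0" if "t \<notin> unit_cube" for t
  proof -
    obtain i where "\<not> (0 \<le> t $ i \<and> t $ i \<le> 1)" using \<open>t \<notin> unit_cube\<close> by (auto simp: unit_cube_def)
    then have "dfun (f i) (vec (t $ i)) = 0" by (intro dfun_outside) (simp add: unit_cube_def)
    then show ?thesis by (intro prod_zero) auto
  qed
  then show ?thesis unfolding tensor_def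
    by (subst Abs_dspace_inverse) (auto intro: octant_limits_tensor)
qed

lemma dfun_tensor_upd:
  "dfun (tensor (f(i := h))) t = dfun h (vec (t $ i)) * (\<Prod>j\<in>UNIV - {i}. dfun (f j) (vec (t $ j)))"
  unfolding dfun_tensor by (subst prod.remove[of UNIV i]) auto

lemma linear_tensor: "linear (\<lambda>h. tensor (f(i := h)))"
  by (rule linearI; rule dspace_eqI) (simp_all add: dfun_tensor_upd algebra_simps del: fun_upd_apply)

lemma norm_tensor_le: "norm (tensor f) \<le> (\<Prod>i\<in>UNIV. norm (f i))"
  by (rule norm_dspace_leI) (auto simp: dfun_tensor abs_prod intro!: prod_mono abs_dfun_le_norm)

lemma prod_list_map_upt: "prod_list (map f [0..<j]) = (\<Prod>p<j. f p)"
  by (simp add: prod.distinct_set_conv_list[symmetric] atLeast0LessThan)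

lemma bounded_multilinear_bound:
  assumes "bounded_multilinear F"
  obtains C where "C \<ge> 0" "\<And>hs. \<bar>F hs\<bar> \<le> C * prod_list (map norm hs)"
proof -
  obtain C where C: "\<And>hs. \<bar>F hs\<bar> \<le> C * prod_list (map norm hs)"
    using assms unfolding bounded_multilinear_def by blast
  have "\<bar>F hs\<bar> \<le> \<bar>C\<bar> * prod_list (map norm hs)" for hs
    using C[of hs] mult_right_mono[OF abs_ge_self[of C] prod_list_norm_nonneg[of hs]] by linarith
  then show thesis by (intro that[of "\<bar>C\<bar>"]) simp_all
qed

lemma multilinear_form_on_list:
  assumes F: "bounded_multilinear F"
  shows "multilinear_form_on {..<j} (\<lambda>x. F (map x [0..<j]))"
proof -
  obtain C where C: "\<And>hs. \<bar>F hs\<bar> \<le> C * prod_list (map norm hs)"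
    using bounded_multilinear_bound[OF F] by metis
  have "\<bar>F (map x [0..<j])\<bar> \<le> C * (\<Prod>k<j. norm (x k))" for x
    using C[of "map x [0..<j]"] by (simp add: prod_list_map_upt comp_def)
  moreover have "linear (\<lambda>h. F (map (x(k := h)) [0..<j]))" if "k < j" for k x
  proof -
    have "map (x(k := h)) [0..<j] = (map x [0..<j])[k := h]" for h
      by (rule nth_equalityI) (auto simp: nth_list_update)
    then show ?thesis using F that unfolding bounded_multilinear_def by simp
  qed
  moreover have "F (map x [0..<j]) = F (map y [0..<j])" if "\<forall>k\<in>{..<j}. x k = y k" for x y
    using that by (intro arg_cong[of _ _ F]) auto
  ultimately show ?thesis unfolding multilinear_form_on_def by blast
qed

text \<open>A \<open>j\<close>-linear form on \<open>D([0,1]\<^sup>m)\<close> becomes a \<open>j m\<close>-linear form on \<open>D([0,1])\<close>, with slots \<open>(p, i)\<close>.\<close>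

lemma multilinear_form_on_tensor:
  fixes F :: "('m::finite) dspace list \<Rightarrow> real"
  assumes F: "bounded_multilinear F"
  shows "multilinear_form_on ({..<j} \<times> UNIV) (\<lambda>x. F (map (\<lambda>p. tensor (\<lambda>i. x (p, i))) [0..<j]))"
proof -
  obtain C where C: "C \<ge> 0" "\<And>hs. \<bar>F hs\<bar> \<le> C * prod_list (map norm hs)"
    using bounded_multilinear_bound[OF F] by metis
  have "\<bar>F (map (\<lambda>p. tensor (\<lambda>i. x (p, i))) [0..<j])\<bar> \<le> C * (\<Prod>k\<in>{..<j} \<times> UNIV. norm (x k))" for x
  proof -
    have "(\<Prod>p<j. norm (tensor (\<lambda>i. x (p, i)))) \<le> (\<Prod>p<j. \<Prod>i\<in>UNIV. norm (x (p, i)))"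
      by (intro prod_mono conjI norm_tensor_le norm_ge_zero)
    also have "\<dots> = (\<Prod>k\<in>{..<j} \<times> UNIV. norm (x k))"
      by (simp add: prod.cartesian_product)
    finally show ?thesis
      using C(2)[of "map (\<lambda>p. tensor (\<lambda>i. x (p, i))) [0..<j]"] C(1)
      by (simp add: prod_list_map_upt comp_def) (meson mult_left_mono order_trans)
  qed
  moreover have "linear (\<lambda>h. F (map (\<lambda>p. tensor (\<lambda>i. (x((q, l) := h)) (p, i))) [0..<j]))" if "q < j" for q l x
  proof -
    have eq: "map (\<lambda>p. tensor (\<lambda>i. (x((q, l) := h)) (p, i))) [0..<j] =
        (map (\<lambda>p. tensor (\<lambda>i. x (p, i))) [0..<j])[q := tensor ((\<lambda>i. x (q, i))(l := h))]" for h
    proof -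
      have "(\<lambda>i. (x((q, l) := h)) (p, i)) = (if p = q then (\<lambda>i. x (q, i))(l := h) else (\<lambda>i. x (p, i)))" for p
        by auto
      then show ?thesis
        by (intro nth_equalityI) (auto simp: nth_list_update simp del: fun_upd_apply)
    qed
    have "linear (\<lambda>h. F ((map (\<lambda>p. tensor (\<lambda>i. x (p, i))) [0..<j])[q := h]))"
      using F that unfolding bounded_multilinear_def by simp
    from linear_compose[OF linear_tensor this] show ?thesis unfolding eq comp_def .
  qed
  moreover have "F (map (\<lambda>p. tensor (\<lambda>i. x (p, i))) [0..<j]) = F (map (\<lambda>p. tensor (\<lambda>i. y (p, i))) [0..<j])"
    if "\<forall>k\<in>{..<j} \<times> UNIV. x k = y k" for x y
    using that by (intro arg_cong[of _ _ F]) auto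
  ultimately show ?thesis unfolding multilinear_form_on_def by (auto simp del: fun_upd_apply)
qed

section \<open>Finite grids and sampling of functions\<close>

definition grid_floor :: "real set \<Rightarrow> real \<Rightarrow> real" where
  "grid_floor R t = Max {q \<in> R. q \<le> t}"

definition grid_ceiling :: "real set \<Rightarrow> real \<Rightarrow> real" where
  "grid_ceiling R u = Min {q \<in> R. u \<le> q}"

definition grid_next :: "real set \<Rightarrow> real \<Rightarrow> real" where
  "grid_next R v = Min {q \<in> R. v < q}"

text \<open>The points \<open>0\<close> and \<open>2\<close> ensure that floors, ceilings and successors of points of \<open>[0,1]\<close> exist;
  \<open>halfline u\<close> is constant for \<open>u > 1\<close>.\<close>

definition grid :: "real set \<Rightarrow> bool" where
  "grid R \<longleftrightarrow> finite R \<and> 0 \<in> R \<and> 2 \<in> R"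

lemma grid_floor:
  assumes "grid R" "0 \<le> t"
  shows "grid_floor R t \<in> R" "grid_floor R t \<le> t" "\<And>q. q \<in> R \<Longrightarrow> q \<le> t \<Longrightarrow> q \<le> grid_floor R t"
proof -
  have fin: "finite {q \<in> R. q \<le> t}" and "0 \<in> {q \<in> R. q \<le> t}" using assms by (auto simp: grid_def)
  then have "grid_floor R t \<in> {q \<in> R. q \<le> t}" unfolding grid_floor_def by (intro Max_in) auto
  then show "grid_floor R t \<in> R" "grid_floor R t \<le> t" by auto
  show "q \<le> grid_floor R t" if "q \<in> R" "q \<le> t" for q
    unfolding grid_floor_def using that fin by (intro Max_ge) auto
qed

lemma grid_floor_nonneg: "grid R \<Longrightarrow> 0 \<le> t \<Longrightarrow> 0 \<le> grid_floor R t"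
  by (rule grid_floor(3)) (auto simp: grid_def)

lemma grid_ceiling:
  assumes "grid R" "u \<le> 2"
  shows "grid_ceiling R u \<in> R" "u \<le> grid_ceiling R u" "\<And>q. q \<in> R \<Longrightarrow> u \<le> q \<Longrightarrow> grid_ceiling R u \<le> q"
proof -
  have fin: "finite {q \<in> R. u \<le> q}" and "2 \<in> {q \<in> R. u \<le> q}" using assms by (auto simp: grid_def)
  then have "grid_ceiling R u \<in> {q \<in> R. u \<le> q}" unfolding grid_ceiling_def by (intro Min_in) auto
  then show "grid_ceiling R u \<in> R" "u \<le> grid_ceiling R u" by auto
  show "grid_ceiling R u \<le> q" if "q \<in> R" "u \<le> q" for q
    unfolding grid_ceiling_def using that fin by (intro Min_le) auto
qed

lemma grid_next:
  assumes "grid R" "v < 2"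
  shows "grid_next R v \<in> R" "v < grid_next R v" "\<And>q. q \<in> R \<Longrightarrow> v < q \<Longrightarrow> grid_next R v \<le> q"
proof -
  have fin: "finite {q \<in> R. v < q}" and "2 \<in> {q \<in> R. v < q}" using assms by (auto simp: grid_def)
  then have "grid_next R v \<in> {q \<in> R. v < q}" unfolding grid_next_def by (intro Min_in) auto
  then show "grid_next R v \<in> R" "v < grid_next R v" by auto
  show "grid_next R v \<le> q" if "q \<in> R" "v < q" for q
    unfolding grid_next_def using that fin by (intro Min_le) auto
qed

lemma grid_floor_eq_iff:
  assumes R: "grid R" and t: "0 \<le> t" and v: "v \<in> R" "v < 2"
  shows "v \<le> t \<and> t < grid_next R v \<longleftrightarrow> grid_floor R t = v"
proof
  assume "v \<le> t \<and> t < grid_next R v"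
  then show "grid_floor R t = v"
    using grid_floor[OF R t] grid_next[OF R v(2)] v(1) by (smt (verit))
next
  assume "grid_floor R t = v"
  then show "v \<le> t \<and> t < grid_next R v"
    using grid_floor[OF R t] grid_next[OF R v(2)] by (smt (verit))
qed

text \<open>Floor and ceiling form an adjunction. For this reason sampling a half-line at grid
  floors replaces its end point by the grid ceiling.\<close>

lemma grid_floor_less_iff:
  assumes R: "grid R" and t: "0 \<le> t" and u: "u \<le> 2"
  shows "grid_floor R t < u \<longleftrightarrow> t < grid_ceiling R u"
  using grid_floor[OF R t] grid_ceiling[OF R u] by (smt (verit))

definition grid_points :: "real set \<Rightarrow> (real ^ 'm) set" where
  "grid_points R = {v \<in> unit_cube. \<forall>i. v $ i \<in> R}"

definition cell :: "real set \<Rightarrow> real ^ 'm::finite \<Rightarrow> 'm dspace" where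
  "cell R v = tensor (\<lambda>i. halfline (grid_next R (v $ i)) - halfline (v $ i))"

text \<open>Each cell is sampled at its lower corner: a coordinate lies below a given grid point
  exactly when its floor does, which matches the half-open octants in the definition of the
  space.\<close>

definition approx :: "real set \<Rightarrow> ('m::finite) dspace \<Rightarrow> 'm dspace" where
  "approx R f = (\<Sum>v\<in>grid_points R. dfun f v *\<^sub>R cell R v)"

lemma finite_grid_points:
  assumes "finite R"
  shows "finite (grid_points R :: (real ^ 'm::finite) set)"
proof -
  have "(grid_points R :: (real ^ 'm) set) \<subseteq> vec_lambda ` (UNIV \<rightarrow>\<^sub>E R)"
  proof
    fix v :: "real ^ 'm" assume "v \<in> grid_points R"
    then have "v = vec_lambda (vec_nth v)" "vec_nth v \<in> UNIV \<rightarrow>\<^sub>E R" by (auto simp: grid_points_def)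
    then show "v \<in> vec_lambda ` (UNIV \<rightarrow>\<^sub>E R)" by blast
  qed
  moreover have "finite (UNIV \<rightarrow>\<^sub>E R :: ('m \<Rightarrow> real) set)" using assms by (intro finite_PiE) auto
  ultimately show ?thesis using finite_subset finite_imageI by blast
qed

lemma dfun_cell:
  assumes R: "grid R" and t: "t \<in> unit_cube" and v: "v \<in> grid_points R"
  shows "dfun (cell R v) t = (if v = (\<chi> i. grid_floor R (t $ i)) then 1 else 0)"
proof -
  have ti: "0 \<le> t $ i" "t $ i \<le> 1" for i using t by (auto simp: unit_cube_def)
  have vi: "v $ i \<in> R" "v $ i < 2" for i
    using v by (auto simp: grid_points_def unit_cube_def intro: le_less_trans[of _ 1])
  have "dfun (halfline (grid_next R (v $ i)) - halfline (v $ i)) (vec (t $ i)) = (if grid_floor R (t $ i) = v $ i then 1 else 0)" for i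
    using grid_floor_eq_iff[OF R ti(1)[of i] vi[of i]] grid_next(2)[OF R vi(2)[of i]] ti[of i]
    by (auto simp: dfun_interval unit_cube_def simp del: dfun_simps)
  then have "dfun (cell R v) t = (\<Prod>i\<in>UNIV. if grid_floor R (t $ i) = v $ i then 1 else 0)"
    unfolding cell_def dfun_tensor by simp
  also have "\<dots> = (if v = (\<chi> i. grid_floor R (t $ i)) then 1 else 0)"
  proof (cases "v = (\<chi> i. grid_floor R (t $ i))")
    case False
    then obtain i where "grid_floor R (t $ i) \<noteq> v $ i" by (metis vec_eq_iff vec_lambda_beta)
    then show ?thesis using False by (intro trans[OF prod_zero]) auto
  qed auto
  finally show ?thesis .
qed

lemma grid_floor_in_grid_points:
  assumes "grid R" "t \<in> unit_cube"
  shows "(\<chi> i. grid_floor R (t $ i)) \<in> grid_points R"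
  using assms grid_floor[OF assms(1)] grid_floor_nonneg[OF assms(1)]
  by (auto simp: grid_points_def unit_cube_def intro: order_trans)

lemma dfun_approx:
  assumes R: "grid R" and t: "t \<in> unit_cube"
  shows "dfun (approx R f) t = dfun f (\<chi> i. grid_floor R (t $ i))"
proof -
  have "dfun (approx R f) t = (\<Sum>v\<in>grid_points R. if v = (\<chi> i. grid_floor R (t $ i)) then dfun f v else 0)"
    unfolding approx_def dfun_sum by (intro sum.cong) (simp_all add: dfun_cell[OF R t])
  also have "\<dots> = dfun f (\<chi> i. grid_floor R (t $ i))"
    using grid_floor_in_grid_points[OF R t] R by (simp add: finite_grid_points grid_def)
  finally show ?thesis .
qed

lemma norm_approx_le: "grid R \<Longrightarrow> norm (approx R f) \<le> norm f"
  by (rule norm_dspace_leI) (simp add: dfun_approx abs_dfun_le_norm)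

lemma linear_approx: "linear (approx R)"
  by (rule linearI) (simp_all add: approx_def scaleR_add_left sum.distrib scaleR_sum_right)

text \<open>Apply \<open>grid_floor_less_iff\<close> in each coordinate. End points move only to the
  right, hence the interest in right nullity.\<close>

lemma approx_tensor_halflines:
  assumes R: "grid R" and u: "\<And>i. u i \<le> 2"
  shows "approx R (tensor (\<lambda>i. halfline (u i))) = tensor (\<lambda>i. halfline (grid_ceiling R (u i)))"
proof (rule dspace_eqI)
  fix t :: "real ^ 'a" assume t: "t \<in> unit_cube"
  have ti: "0 \<le> t $ i" "t $ i \<le> 1" for i using t by (auto simp: unit_cube_def)
  have "dfun (halfline (u i)) (vec (grid_floor R (t $ i))) = dfun (halfline (grid_ceiling R (u i))) (vec (t $ i))" for i
    using grid_floor_less_iff[OF R ti(1)[of i] u[of i]] grid_floor(2)[OF R ti(1)[of i]]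
      grid_floor_nonneg[OF R ti(1)[of i]] ti[of i]
    by (simp add: halfline.rep_eq unit_cube_def)
  then show "dfun (approx R (tensor (\<lambda>i. halfline (u i)))) t = dfun (tensor (\<lambda>i. halfline (grid_ceiling R (u i)))) t"
    by (simp add: dfun_approx[OF R t] dfun_tensor)
qed

text \<open>The bound 2 guarantees that the grid ceilings of the end points exist. By
  \<open>halfline_min_2\<close> it excludes no product of half-lines.\<close>

abbreviation corner_boxes :: "('m::finite) dspace set" where
  "corner_boxes \<equiv> {tensor (\<lambda>i. halfline (u i)) | u. \<forall>i. u i \<le> 2}"

text \<open>Inclusion-exclusion over the set \<open>X\<close> of coordinates in which the lower end
  point is taken.\<close>

lemma cell_in_span:
  fixes v :: "real ^ 'm::finite"
  assumes R: "grid R" and v: "v \<in> grid_points R"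
  shows "cell R v \<in> span corner_boxes"
proof -
  have vi: "v $ i < 2" for i
    using v by (auto simp: grid_points_def unit_cube_def intro: le_less_trans[of _ 1])
  define w where "w = (\<lambda>X i. if i \<in> X then v $ i else grid_next R (v $ i))"
  have "cell R v = (\<Sum>X\<in>Pow UNIV. (- 1) ^ card X *\<^sub>R tensor (\<lambda>i. halfline (w X i)))"
  proof (rule dspace_eqI)
    fix t :: "real ^ 'm"
    have "dfun (cell R v) t = (\<Sum>X\<in>Pow UNIV. (- 1) ^ card X * (\<Prod>i\<in>X. dfun (halfline (v $ i)) (vec (t $ i))) *
        (\<Prod>i\<in>UNIV - X. dfun (halfline (grid_next R (v $ i))) (vec (t $ i))))"
      unfolding cell_def dfun_tensor dfun_simps by (rule prod_diff_conv_sum) simp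
    also have "\<dots> = (\<Sum>X\<in>Pow UNIV. dfun ((- 1) ^ card X *\<^sub>R tensor (\<lambda>i. halfline (w X i))) t)"
    proof (rule sum.cong)
      fix X :: "'m set"
      have "(\<Prod>i\<in>UNIV. dfun (halfline (w X i)) (vec (t $ i))) =
         (\<Prod>i\<in>UNIV - X. dfun (halfline (w X i)) (vec (t $ i))) * (\<Prod>i\<in>X. dfun (halfline (w X i)) (vec (t $ i)))"
        by (rule prod.subset_diff) auto
      then show "(- 1) ^ card X * (\<Prod>i\<in>X. dfun (halfline (v $ i)) (vec (t $ i))) *
          (\<Prod>i\<in>UNIV - X. dfun (halfline (grid_next R (v $ i))) (vec (t $ i))) =
          dfun ((- 1) ^ card X *\<^sub>R tensor (\<lambda>i. halfline (w X i))) t"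
        by (simp add: dfun_tensor w_def)
    qed simp
    finally show "dfun (cell R v) t = dfun (\<Sum>X\<in>Pow UNIV. (- 1) ^ card X *\<^sub>R tensor (\<lambda>i. halfline (w X i))) t"
      unfolding dfun_sum .
  qed
  moreover have "tensor (\<lambda>i. halfline (w X i)) \<in> corner_boxes" for X
  proof -
    have "\<forall>i. w X i \<le> 2"
      using vi grid_next(3)[OF R vi, of 2] R by (auto simp: w_def grid_def less_imp_le)
    then show ?thesis by blast
  qed
  ultimately show ?thesis
    by (simp only:) (intro span_sum span_scale span_base)
qed

lemma approx_in_span: "grid R \<Longrightarrow> approx R f \<in> span corner_boxes"
  unfolding approx_def by (intro span_sum span_scale cell_in_span)

text \<open>Only finitely many octants meet at \<open>t\<close>, so one radius serves them all; two
  points of the same octant are both within \<open>\<delta> / 2\<close> of the limit along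
  it.\<close>

lemma octant_oscillation:
  assumes "octant_limits f" "t \<in> unit_cube" "\<delta> > 0"
  obtains r where "r > 0" "\<And>s s'. s \<in> unit_cube \<Longrightarrow> s' \<in> unit_cube \<Longrightarrow> (\<And>i. \<bar>s $ i - t $ i\<bar> < r) \<Longrightarrow>
     (\<And>i. \<bar>s' $ i - t $ i\<bar> < r) \<Longrightarrow> (\<And>i. s $ i < t $ i \<longleftrightarrow> s' $ i < t $ i) \<Longrightarrow> \<bar>f s - f s'\<bar> \<le> \<delta>"
proof -
  define P where "P = (\<lambda>S l. (\<forall>i\<in>S. 0 < t $ i) \<longrightarrow>
      eventually (\<lambda>s. s \<in> octant t S \<longrightarrow> \<bar>f s - l\<bar> < \<delta> / 2) (nhds t))"
  define l where "l = (\<lambda>S. SOME l. P S l)"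
  have "\<exists>l. P S l" for S
  proof (cases "\<forall>i\<in>S. 0 < t $ i")
    case True
    then obtain l where "(f \<longlongrightarrow> l) (inf (nhds t) (principal (octant t S)))"
      using assms unfolding octant_limits_def by blast
    from tendstoD[OF this, of "\<delta> / 2"] \<open>\<delta> > 0\<close> show ?thesis
      unfolding P_def by (auto simp: eventually_inf_principal dist_real_def)
  qed (auto simp: P_def)
  then have "P S (l S)" for S unfolding l_def by (rule someI_ex)
  then have "eventually (\<lambda>s. (\<forall>i\<in>S. 0 < t $ i) \<longrightarrow> s \<in> octant t S \<longrightarrow> \<bar>f s - l S\<bar> < \<delta> / 2) (nhds t)" for S
    unfolding P_def by (cases "\<forall>i\<in>S. 0 < t $ i") auto
  then have "eventually (\<lambda>s. \<forall>S. (\<forall>i\<in>S. 0 < t $ i) \<longrightarrow> s \<in> octant t S \<longrightarrow> \<bar>f s - l S\<bar> < \<delta> / 2) (nhds t)"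
    by (intro eventually_all_finite)
  then obtain d where d: "d > 0"
    "\<And>s S. dist s t < d \<Longrightarrow> (\<forall>i\<in>S. 0 < t $ i) \<Longrightarrow> s \<in> octant t S \<Longrightarrow> \<bar>f s - l S\<bar> < \<delta> / 2"
    unfolding eventually_nhds_metric by blast
  \<comment> \<open>Coordinate distances below \<open>r\<close> give a Euclidean distance below
    \<open>d\<close> through the sum of the coordinates; the summand 1 makes this strict.\<close>
  define r where "r = d / (real CARD('a) + 1)"
  have r: "r > 0" using d(1) by (simp add: r_def)
  have close: "\<bar>f s - l {i. s $ i < t $ i}\<bar> < \<delta> / 2" if "s \<in> unit_cube" "\<And>i. \<bar>s $ i - t $ i\<bar> < r" for s
  proof (rule d(2))
    have "dist s t \<le> (\<Sum>i\<in>UNIV. \<bar>(s - t) $ i\<bar>)" unfolding dist_norm by (rule norm_le_l1_cart)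
    also have "\<dots> \<le> (\<Sum>i\<in>(UNIV :: 'a set). r)" using that(2) by (intro sum_mono) (simp add: less_imp_le)
    also have "\<dots> < d" using d(1) by (simp add: r_def field_simps)
    finally show "dist s t < d" .
    show "\<forall>i\<in>{i. s $ i < t $ i}. 0 < t $ i"
      using that(1) by (auto simp: unit_cube_def intro: le_less_trans)
    show "s \<in> octant t {i. s $ i < t $ i}" using that(1) by (auto simp: octant_def unit_cube_def)
  qed
  show thesis
  proof (rule that[OF r])
    fix s s' assume s: "s \<in> unit_cube" "\<And>i. \<bar>s $ i - t $ i\<bar> < r" and s': "s' \<in> unit_cube" "\<And>i. \<bar>s' $ i - t $ i\<bar> < r"
      and "\<And>i. s $ i < t $ i \<longleftrightarrow> s' $ i < t $ i"
    then have "l {i. s $ i < t $ i} = l {i. s' $ i < t $ i}" by simp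
    with close[OF s] close[OF s'] show "\<bar>f s - f s'\<bar> \<le> \<delta>" by linarith
  qed
qed

text \<open>If the grid contains the coordinates of the centres of a finite cover by boxes of small oscillation,
  then \<open>s\<close> and its grid floor lie in the same octant of a centre.\<close>

lemma approx_dense:
  fixes f :: "('m::finite) dspace"
  assumes \<delta>: "\<delta> > 0"
  obtains R where "grid R" "norm (f - approx R f) \<le> \<delta>"
proof -
  have "octant_limits (dfun f)" using dfun[of f] by simp
  then have "\<exists>r>0. \<forall>s s'. s \<in> unit_cube \<longrightarrow> s' \<in> unit_cube \<longrightarrow> (\<forall>i. \<bar>s $ i - t $ i\<bar> < r) \<longrightarrow>
     (\<forall>i. \<bar>s' $ i - t $ i\<bar> < r) \<longrightarrow> (\<forall>i. s $ i < t $ i \<longleftrightarrow> s' $ i < t $ i) \<longrightarrow> \<bar>dfun f s - dfun f s'\<bar> \<le> \<delta>"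
    if "t \<in> unit_cube" for t
    using octant_oscillation[OF _ that \<delta>] by metis
  then obtain r where r: "\<And>t. t \<in> unit_cube \<Longrightarrow> r t > 0"
    "\<And>t s s'. t \<in> unit_cube \<Longrightarrow> s \<in> unit_cube \<Longrightarrow> s' \<in> unit_cube \<Longrightarrow> (\<forall>i. \<bar>s $ i - t $ i\<bar> < r t) \<Longrightarrow>
     (\<forall>i. \<bar>s' $ i - t $ i\<bar> < r t) \<Longrightarrow> (\<forall>i. s $ i < t $ i \<longleftrightarrow> s' $ i < t $ i) \<Longrightarrow> \<bar>dfun f s - dfun f s'\<bar> \<le> \<delta>"
    by metis
  define U where "U = (\<lambda>t :: real ^ 'm. {s. \<forall>i. \<bar>s $ i - t $ i\<bar> < r t / 2})"
  have opU: "open (U t)" for t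
  proof -
    have "U t = (\<Inter>i. {s. \<bar>s $ i - t $ i\<bar> < r t / 2})" by (auto simp: U_def)
    also have "open \<dots>" by (intro open_INT ballI open_Collect_less continuous_intros) simp
    finally show ?thesis .
  qed
  have comp: "compact (unit_cube :: (real ^ 'm) set)" by (simp add: unit_cube_cbox)
  have cov: "unit_cube \<subseteq> (\<Union>t\<in>unit_cube. U t)" using r(1) by (force simp: U_def)
  obtain T where T: "T \<subseteq> unit_cube" "finite T" "unit_cube \<subseteq> (\<Union>t\<in>T. U t)"
    using compactE_image[OF comp opU cov] by metis
  \<comment> \<open>Besides the coordinates of the centres, the points
    \<open>t $ i - r t / 2\<close> are included: they keep the floor of a point of the half-size box
    \<open>U t\<close> from falling out of the box of radius \<open>r t\<close>.\<close>
  define R where "R = {0, 2} \<union> (\<lambda>(t, i). t $ i) ` (T \<times> UNIV) \<union> (\<lambda>(t, i). t $ i - r t / 2) ` (T \<times> UNIV)"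
  have R: "grid R" unfolding grid_def R_def using T(2) by auto
  have "norm (f - approx R f) \<le> \<delta>"
  proof (rule norm_dspace_leI)
    fix s :: "real ^ 'm" assume s: "s \<in> unit_cube"
    then obtain t where t: "t \<in> T" "s \<in> U t" using T(3) by blast
    have tR: "t $ i \<in> R" "t $ i - r t / 2 \<in> R" for i using t(1) by (force simp: R_def)+
    have si: "0 \<le> s $ i" for i using s by (simp add: unit_cube_def)
    have tc: "t \<in> unit_cube" using t T by blast
    have near: "\<bar>s $ i - t $ i\<bar> < r t / 2" for i using t(2) by (simp add: U_def)
    let ?s = "(\<chi> i. grid_floor R (s $ i)) :: real ^ 'm"
    have "\<bar>dfun f s - dfun f ?s\<bar> \<le> \<delta>"
    proof (rule r(2)[OF tc s])
      show "?s \<in> unit_cube" using grid_floor_in_grid_points[OF R s] by (simp add: grid_points_def)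
      show "\<forall>i. \<bar>s $ i - t $ i\<bar> < r t" 
      proof
        fix i show "\<bar>s $ i - t $ i\<bar> < r t" using near[of i] r(1)[OF tc] by linarith
      qed
      show "\<forall>i. \<bar>?s $ i - t $ i\<bar> < r t"
      proof
        fix i
        have "t $ i - r t / 2 \<le> grid_floor R (s $ i)"
          using near[of i] by (intro grid_floor(3)[OF R si tR(2)]) linarith
        then show "\<bar>?s $ i - t $ i\<bar> < r t"
          using grid_floor(2)[OF R si[of i]] near[of i] r(1)[OF tc] unfolding vec_lambda_beta by linarith
      qed
      show "\<forall>i. s $ i < t $ i \<longleftrightarrow> ?s $ i < t $ i"
      proof
        fix i show "s $ i < t $ i \<longleftrightarrow> ?s $ i < t $ i"
          using grid_floor(2)[OF R si[of i]] grid_floor(3)[OF R si[of i] tR(1)[of i]]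
          unfolding vec_lambda_beta by linarith
      qed
    qed
    then show "\<bar>dfun (f - approx R f) s\<bar> \<le> \<delta>" by (simp add: dfun_approx[OF R s])
  qed
  with R that show thesis by blast
qed

section \<open>Convergence of forms along adapted grids\<close>

lemma halfline_min_2: "halfline (min u 2) = halfline u"
  by (rule dspace_eqI) (auto simp: halfline.rep_eq unit_cube_def min_def)

lemma grid_sequence:
  assumes "countable Q" "0 \<in> Q" "2 \<in> Q"
  obtains R :: "nat \<Rightarrow> real set" where "\<And>n. grid (R n)" "\<And>n. R n \<subseteq> Q"
    "\<And>q. q \<in> Q \<Longrightarrow> eventually (\<lambda>n. q \<in> R n) sequentially"
proof
  have ne: "Q \<noteq> {}" using assms by auto
  let ?R = "\<lambda>n::nat. {0, 2} \<union> from_nat_into Q ` {..n}"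
  show "grid (?R n)" for n by (simp add: grid_def)
  show "?R n \<subseteq> Q" for n using assms from_nat_into[OF ne] by auto
  fix q assume "q \<in> Q"
  then obtain k where "from_nat_into Q k = q" using from_nat_into_surj[OF assms(1)] by metis
  then have "q \<in> ?R n" if "n \<ge> k" for n using that by auto
  then show "eventually (\<lambda>n. q \<in> ?R n) sequentially" unfolding eventually_sequentially by blast
qed

lemma grid_ceiling_eventually_eq:
  assumes "\<And>n. grid (R n)" "eventually (\<lambda>n. u \<in> R n) F" "u \<le> 2"
  shows "eventually (\<lambda>n. grid_ceiling (R n) u = u) F"
  using assms(2)
proof (rule eventually_mono)
  fix n assume "u \<in> R n"
  then show "grid_ceiling (R n) u = u"
    using grid_ceiling(2,3)[OF assms(1)[of n] assms(3)] by (meson antisym order_refl)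
qed

lemma grid_ceiling_tendsto:
  assumes R: "\<And>n. grid (R n)" and ev: "\<And>q. q \<in> \<rat> \<Longrightarrow> eventually (\<lambda>n. q \<in> R n) F" and u: "u \<le> 2"
  shows "((\<lambda>n. grid_ceiling (R n) u) \<longlongrightarrow> u) F"
proof (rule order_tendstoI)
  fix a assume "a < u"
  then show "eventually (\<lambda>n. a < grid_ceiling (R n) u) F"
    using grid_ceiling(2)[OF R u] by (intro always_eventually allI) (rule less_le_trans)
next
  fix a assume "u < a"
  then obtain q where q: "q \<in> \<rat>" "u < q" "q < a" using Rats_dense_in_real by blast
  from ev[OF q(1)] show "eventually (\<lambda>n. grid_ceiling (R n) u < a) F"
  proof (rule eventually_mono)
    fix n assume "q \<in> R n"
    then show "grid_ceiling (R n) u < a" using grid_ceiling(3)[OF R u, of q n] q by simp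
  qed
qed

text \<open>In one slot, convergence passes from \<open>B\<close> to its span by linearity and to
  the closure by a three-epsilon argument, with uniformity in \<open>n\<close> from the
  contractions; \<open>slotwise_extend\<close> treats all slots. The vectors \<open>A n h\<close>
  themselves need not converge to \<open>h\<close>.\<close>

lemma multilinear_form_on_converge_extend:
  fixes A :: "nat \<Rightarrow> 'e::real_normed_vector \<Rightarrow> 'e"
  assumes K: "finite K" and \<Phi>: "multilinear_form_on K \<Phi>"
    and lin: "\<And>n. linear (A n)" and norm: "\<And>n h. norm (A n h) \<le> norm h"
    and dense: "\<And>h \<delta>. \<delta> > 0 \<Longrightarrow> \<exists>b\<in>span B. norm (h - b) \<le> \<delta>"
    and base: "\<And>x. (\<And>k. k \<in> K \<Longrightarrow> x k \<in> B) \<Longrightarrow> (\<lambda>n. \<Phi> (\<lambda>k. A n (x k))) \<longlonglongrightarrow> \<Phi> x"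
  shows "(\<lambda>n. \<Phi> (\<lambda>k. A n (x k))) \<longlonglongrightarrow> \<Phi> x"
proof (rule slotwise_extend[where P = "\<lambda>x. (\<lambda>n. \<Phi> (\<lambda>k. A n (x k))) \<longlonglongrightarrow> \<Phi> x" and B = B and B' = UNIV and K = K])
  fix k x h
  assume k: "k \<in> K" and B: "\<And>b. b \<in> B \<Longrightarrow> (\<lambda>n. \<Phi> (\<lambda>l. A n ((x(k := b)) l))) \<longlonglongrightarrow> \<Phi> (x(k := b))"
  have upd: "(\<lambda>l. A n ((x(k := b)) l)) = (\<lambda>l. A n (x l))(k := A n b)" for n b by auto
  have sp: "(\<lambda>n. \<Phi> ((\<lambda>l. A n (x l))(k := A n b))) \<longlonglongrightarrow> \<Phi> (x(k := b))" if "b \<in> span B" for b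
    using that
  proof (induction b rule: span_induct_alt)
    case base
    have "\<Phi> (y(k := 0)) = 0" for y by (intro multilinear_form_on_zero[OF \<Phi> k]) simp
    then show ?case unfolding linear_0[OF lin] by (simp del: fun_upd_apply)
  next
    case (step c a b)
    have eq: "\<Phi> (y(k := c *\<^sub>R a' + b')) = c * \<Phi> (y(k := a')) + \<Phi> (y(k := b'))" for y a' b'
      using \<Phi> k by (simp only: multilinear_form_on_add multilinear_form_on_scale)
    have eqA: "A n (c *\<^sub>R a + b) = c *\<^sub>R A n a + A n b" for n
      using lin[of n] by (simp add: linear_add linear_scale)
    have "(\<lambda>n. \<Phi> ((\<lambda>l. A n (x l))(k := A n a))) \<longlonglongrightarrow> \<Phi> (x(k := a))"
      using B[OF step(1)] unfolding upd .
    from tendsto_add[OF tendsto_mult_left[OF this, of c] step(2)]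
    show ?case unfolding eq eqA .
  qed
  obtain C where C: "\<And>y. \<bar>\<Phi> y\<bar> \<le> C * (\<Prod>k\<in>K. norm (y k))"
    using \<Phi> unfolding multilinear_form_on_def by blast
  \<comment> \<open>A bound for the form as a function of slot \<open>k\<close>, valid for all
    \<open>n\<close> because the \<open>A n\<close> do not increase norms; the summand 1 allows
    division by \<open>D\<close>.\<close>
  define D where "D = \<bar>C\<bar> * (\<Prod>l\<in>K - {k}. norm (x l)) + 1"
  have Dpos: "D > 0" unfolding D_def by (intro add_nonneg_pos mult_nonneg_nonneg prod_nonneg) auto
  have bd: "\<bar>\<Phi> (y(k := a))\<bar> \<le> D * norm a" if "\<And>l. norm (y l) \<le> norm (x l)" for y a
  proof -
    have "(\<Prod>l\<in>K. norm ((y(k := a)) l)) = norm a * (\<Prod>l\<in>K - {k}. norm (y l))"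
      using prod.remove[OF K k, of "\<lambda>l. norm ((y(k := a)) l)"] by simp
    moreover have "(\<Prod>l\<in>K - {k}. norm (y l)) \<le> (\<Prod>l\<in>K - {k}. norm (x l))"
      using that by (intro prod_mono) auto
    ultimately have "C * (\<Prod>l\<in>K. norm ((y(k := a)) l)) \<le> \<bar>C\<bar> * (norm a * (\<Prod>l\<in>K - {k}. norm (x l)))"
      by (auto intro!: mult_mono mult_left_mono mult_nonneg_nonneg prod_nonneg)
    also have "\<dots> \<le> D * norm a" unfolding D_def by (simp add: algebra_simps)
    finally show ?thesis using C[of "y(k := a)"] by linarith
  qed
  have "(\<lambda>n. \<Phi> ((\<lambda>l. A n (x l))(k := A n h))) \<longlonglongrightarrow> \<Phi> (x(k := h))"
  proof (rule LIMSEQ_I)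
    fix \<epsilon> :: real assume \<epsilon>: "\<epsilon> > 0"
    obtain b where b: "b \<in> span B" "norm (h - b) \<le> \<epsilon> / (3 * D)"
      using dense[of "\<epsilon> / (3 * D)" h] \<epsilon> Dpos by auto
    then have b': "D * norm (h - b) \<le> \<epsilon> / 3" using Dpos by (simp add: field_simps)
    obtain N where N: "\<And>n. n \<ge> N \<Longrightarrow> norm (\<Phi> ((\<lambda>l. A n (x l))(k := A n b)) - \<Phi> (x(k := b))) < \<epsilon> / 3"
      using LIMSEQ_D[OF sp[OF b(1)], of "\<epsilon> / 3"] \<epsilon> by auto
    have "norm (\<Phi> ((\<lambda>l. A n (x l))(k := A n h)) - \<Phi> (x(k := h))) < \<epsilon>" if "n \<ge> N" for n
    proof -
      have "\<bar>\<Phi> ((\<lambda>l. A n (x l))(k := A n h)) - \<Phi> ((\<lambda>l. A n (x l))(k := A n b))\<bar> \<le> D * norm (A n (h - b))"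
        unfolding multilinear_form_on_diff[OF \<Phi> k, symmetric] linear_diff[OF lin, symmetric]
        by (rule bd[OF norm])
      also have "\<dots> \<le> \<epsilon> / 3" using mult_left_mono[OF norm[of n "h - b"], of D] Dpos b' by linarith
      finally have 1: "\<bar>\<Phi> ((\<lambda>l. A n (x l))(k := A n h)) - \<Phi> ((\<lambda>l. A n (x l))(k := A n b))\<bar> \<le> \<epsilon> / 3" .
      have "\<bar>\<Phi> (x(k := h)) - \<Phi> (x(k := b))\<bar> \<le> D * norm (h - b)"
        unfolding multilinear_form_on_diff[OF \<Phi> k, symmetric] by (rule bd) simp
      then have 2: "\<bar>\<Phi> (x(k := h)) - \<Phi> (x(k := b))\<bar> \<le> \<epsilon> / 3" using b' by linarith
      show ?thesis using 1 2 N[OF that] unfolding real_norm_def by linarith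
    qed
    then show "\<exists>N. \<forall>n\<ge>N. norm (\<Phi> ((\<lambda>l. A n (x l))(k := A n h)) - \<Phi> (x(k := h))) < \<epsilon>" by blast
  qed
  then show "(\<lambda>n. \<Phi> (\<lambda>l. A n ((x(k := h)) l))) \<longlonglongrightarrow> \<Phi> (x(k := h))" unfolding upd .
qed (use K base in auto)

text \<open>On corner boxes the approximation only moves the end points of half-lines, in
  \<open>j\<close> slots with all their coordinates; density does the rest. The grids depend on
  \<open>F\<close> and \<open>j\<close> but not on \<open>f\<close>, so the limit can be taken under
  an integral.\<close>

lemma approx_converges:
  fixes F :: "('m::finite) dspace list \<Rightarrow> real"
  assumes F: "bounded_multilinear F"
  obtains R where "\<And>n. grid (R n)"
    "\<And>f. (\<lambda>n. F (replicate j (approx (R n) f))) \<longlonglongrightarrow> F (replicate j f)"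
proof -
  define K where "K = {..<j} \<times> (UNIV :: 'm set)"
  define \<Phi> where "\<Phi> = (\<lambda>x. F (map (\<lambda>p. tensor (\<lambda>i. x (p, i))) [0..<j]))"
  have K: "finite K" by (simp add: K_def)
  have \<Phi>: "multilinear_form_on K \<Phi>" unfolding K_def \<Phi>_def by (rule multilinear_form_on_tensor[OF F])
  \<comment> \<open>The rationals make the ceilings converge. The points that are not right null are
    eventually in the grids, so that their ceilings do not move. As the grids stay inside
    \<open>Q\<close>, an end point off \<open>Q\<close> is approached strictly from the
    right.\<close>
  define Q where "Q = \<rat> \<union> {0, 2} \<union> (\<Union>k\<in>K. {t. \<not> right_null K \<Phi> k t})"
  have "countable Q" unfolding Q_def
    using K by (intro countable_Un countable_UN countable_rat countable_not_right_null[OF K \<Phi>])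
      (auto intro: countable_finite)
  then obtain R where R: "\<And>n. grid (R n)" "\<And>n. R n \<subseteq> Q"
    "\<And>q. q \<in> Q \<Longrightarrow> eventually (\<lambda>n. q \<in> R n) sequentially"
    by (rule grid_sequence) (auto simp: Q_def)
  have lim: "(\<lambda>n. \<Phi> (\<lambda>k. halfline (grid_ceiling (R n) (u k)))) \<longlonglongrightarrow> \<Phi> (\<lambda>k. halfline (u k))"
    if u: "\<And>k. u k \<le> 2" for u
  proof (rule tendsto_halflines_from_right[OF K \<Phi>, where Q = Q])
    fix k assume k: "k \<in> K"
    show "eventually (\<lambda>n. grid_ceiling (R n) (u k) = u k) sequentially" if "u k \<in> Q"
      using R that u by (intro grid_ceiling_eventually_eq)
    show "right_null K \<Phi> k (u k)" if "u k \<notin> Q" using that k by (auto simp: Q_def)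
    show "(\<lambda>n. grid_ceiling (R n) (u k)) \<longlonglongrightarrow> u k"
      using R u by (intro grid_ceiling_tendsto) (auto simp: Q_def)
    show "eventually (\<lambda>n. u k < grid_ceiling (R n) (u k)) sequentially" if "u k \<notin> Q"
    proof (intro always_eventually allI)
      fix n
      have "grid_ceiling (R n) (u k) \<noteq> u k"
        using grid_ceiling(1)[OF R(1)[of n] u[of k]] R(2)[of n] that by auto
      with grid_ceiling(2)[OF R(1)[of n] u[of k]] show "u k < grid_ceiling (R n) (u k)" by simp
    qed
  qed
  have "(\<lambda>n. F (map (\<lambda>p. approx (R n) (x p)) [0..<j])) \<longlonglongrightarrow> F (map x [0..<j])" for x
  proof (rule multilinear_form_on_converge_extend[where B = corner_boxes and A = "\<lambda>n. approx (R n)" and x = x and K = "{..<j}" and \<Phi> = "\<lambda>x. F (map x [0..<j])"])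
    show "\<exists>b\<in>span corner_boxes. norm (h - b) \<le> \<delta>" if \<delta>: "\<delta> > 0" for h :: "'m dspace" and \<delta>
    proof -
      obtain S where "grid S" "norm (h - approx S h) \<le> \<delta>" by (rule approx_dense[OF \<delta>])
      then show ?thesis by (intro bexI[of _ "approx S h"] approx_in_span)
    qed
    fix x :: "nat \<Rightarrow> 'm dspace" assume "\<And>p. p \<in> {..<j} \<Longrightarrow> x p \<in> corner_boxes"
    then have ex: "\<exists>u. x p = tensor (\<lambda>i. halfline (u i)) \<and> (\<forall>i. u i \<le> 2)" if "p < j" for p
      using that by simp
    define u where "u = (\<lambda>p. SOME u. x p = tensor (\<lambda>i. halfline (u i)) \<and> (\<forall>i. u i \<le> 2))"
    have u: "x p = tensor (\<lambda>i. halfline (u p i))" if "p < j" for p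
      using someI_ex[OF ex[OF that]] unfolding u_def by blast
    define v where "v = (\<lambda>(p, i). min (u p i) 2)"
    have x: "x p = tensor (\<lambda>i. halfline (v (p, i)))" if "p < j" for p
      using u[OF that] by (simp add: v_def halfline_min_2)
    have v: "v k \<le> 2" for k by (auto simp: v_def split: prod.split)
    have "F (map (\<lambda>p. approx (R n) (x p)) [0..<j]) = \<Phi> (\<lambda>k. halfline (grid_ceiling (R n) (v k)))" for n
      unfolding \<Phi>_def using x v R(1)
      by (intro arg_cong[of _ _ F]) (auto simp: approx_tensor_halflines)
    moreover have "F (map x [0..<j]) = \<Phi> (\<lambda>k. halfline (v k))"
      unfolding \<Phi>_def using x by (intro arg_cong[of _ _ F]) auto
    ultimately show "(\<lambda>n. F (map (\<lambda>p. approx (R n) (x p)) [0..<j])) \<longlonglongrightarrow> F (map x [0..<j])"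
      using lim[OF v] by simp
  qed (auto intro: multilinear_form_on_list[OF F] linear_approx norm_approx_le[OF R(1)])
  from this[of "\<lambda>_. f" for f] have "(\<lambda>n. F (replicate j (approx (R n) f))) \<longlonglongrightarrow> F (replicate j f)" for f
    by (simp add: map_replicate_const)
  with R(1) that show thesis by blast
qed

section \<open>Measurability and moments\<close>

lemma space_D_sigma [simp]: "space D_sigma = UNIV"
  unfolding D_sigma_def by (simp add: space_measure_of_conv)

lemma measurable_D_sigmaI:
  fixes X :: "'a \<Rightarrow> ('m::finite) dspace"
  assumes "\<And>t. t \<in> unit_cube \<Longrightarrow> (\<lambda>\<omega>. dfun (X \<omega>) t) \<in> borel_measurable M"
  shows "X \<in> M \<rightarrow>\<^sub>M D_sigma"
  unfolding D_sigma_def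
proof (rule measurable_measure_of)
  fix U :: "'m dspace set" assume "U \<in> {(\<lambda>f. dfun f t) -` A |t A. t \<in> unit_cube \<and> A \<in> sets borel}"
  then obtain t A where "U = (\<lambda>f. dfun f t) -` A" "t \<in> unit_cube" "A \<in> sets borel" by blast
  then have "X -` U \<inter> space M = (\<lambda>\<omega>. dfun (X \<omega>) t) -` A \<inter> space M" by auto
  also have "\<dots> \<in> sets M" using assms \<open>t \<in> unit_cube\<close> \<open>A \<in> sets borel\<close> by (intro measurable_sets)
  finally show "X -` U \<inter> space M \<in> sets M" .
qed auto

lemma measurable_dfun [measurable]: "(\<lambda>f. dfun f t) \<in> borel_measurable D_sigma"
proof (cases "t \<in> unit_cube")
  case True
  show ?thesis
  proof (rule measurableI)
    fix A :: "real set" assume "A \<in> sets borel"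
    with True show "(\<lambda>f. dfun f t) -` A \<inter> space D_sigma \<in> sets D_sigma"
      unfolding D_sigma_def by (subst sets_measure_of) (auto simp: space_measure_of_conv intro!: sigma_sets.Basic)
  qed auto
qed (simp add: dfun_outside)

lemma D_random_variable_measurable: "D_random_variable M X \<Longrightarrow> X \<in> M \<rightarrow>\<^sub>M D_sigma"
  unfolding D_random_variable_def by (intro measurable_D_sigmaI) blast

lemma measurable_approx: "grid R \<Longrightarrow> approx R \<in> D_sigma \<rightarrow>\<^sub>M D_sigma"
  by (rule measurable_D_sigmaI) (simp add: dfun_approx)

lemma measurable_scaleR_D: "(\<lambda>f. c *\<^sub>R f) \<in> D_sigma \<rightarrow>\<^sub>M D_sigma"
  by (rule measurable_D_sigmaI) simp

text \<open>The closed octant at \<open>t\<close> contains \<open>t\<close>, so the limit along it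
  is the value at \<open>t\<close>, and nearby rational points of this octant inherit the strict
  inequality. A coordinate equal to 1 cannot be increased but is rational itself. Hence the norm is
  a supremum over countably many evaluations.\<close>

lemma dfun_right_rational:
  fixes f :: "('m::finite) dspace"
  assumes t: "t \<in> unit_cube" and a: "a < \<bar>dfun f t\<bar>"
  obtains q where "q \<in> unit_cube" "\<forall>i. q $ i \<in> \<rat>" "a < \<bar>dfun f q\<bar>"
proof -
  let ?F = "inf (nhds t) (principal (octant t {}))"
  obtain l where l: "(dfun f \<longlongrightarrow> l) ?F"
    using dfun[of f] t unfolding octant_limits_def by blast
  have tt: "t \<in> octant t {}" using t by (auto simp: octant_def unit_cube_def)
  have "l = dfun f t"
  proof (rule ccontr)
    assume "l \<noteq> dfun f t"
    then have "eventually (\<lambda>s. dfun f s \<noteq> dfun f t) ?F"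
      using tendsto_imp_eventually_ne[OF l] by blast
    then have "eventually (\<lambda>s. s \<in> octant t {} \<longrightarrow> dfun f s \<noteq> dfun f t) (nhds t)"
      by (simp add: eventually_inf_principal)
    from eventually_nhds_x_imp_x[OF this] tt show False by simp
  qed
  with order_tendstoD(1)[OF tendsto_rabs[OF l]] a
  have "eventually (\<lambda>s. s \<in> octant t {} \<longrightarrow> a < \<bar>dfun f s\<bar>) (nhds t)"
    by (simp add: eventually_inf_principal)
  then obtain d where d: "d > 0" "\<And>s. dist s t < d \<Longrightarrow> s \<in> octant t {} \<Longrightarrow> a < \<bar>dfun f s\<bar>"
    unfolding eventually_nhds_metric by blast
  define r where "r = d / (real CARD('m) + 1)"
  have r: "r > 0" using d(1) by (simp add: r_def)
  have "\<exists>q\<in>\<rat>. t $ i \<le> q \<and> q \<le> 1 \<and> q - t $ i < r" for i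
  proof (cases "t $ i = 1")
    case True
    then show ?thesis using r by (intro bexI[of _ 1]) auto
  next
    case False
    moreover have "t $ i \<le> 1" using t by (simp add: unit_cube_def)
    ultimately have "t $ i < min 1 (t $ i + r)" using r by simp
    from Rats_dense_in_real[OF this] obtain q where "q \<in> \<rat>" "t $ i < q" "q < min 1 (t $ i + r)" by blast
    then show ?thesis by (intro bexI[of _ q]) auto
  qed
  then obtain p where p: "\<And>i. p i \<in> \<rat>" "\<And>i. t $ i \<le> p i" "\<And>i. p i \<le> 1" "\<And>i. p i - t $ i < r" by metis
  define q where "q = vec_lambda p"
  have "dist q t \<le> (\<Sum>i\<in>UNIV. \<bar>(q - t) $ i\<bar>)" unfolding dist_norm by (rule norm_le_l1_cart)
  also have "\<dots> \<le> (\<Sum>i\<in>(UNIV :: 'm set). r)"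
    using p(2,4) by (intro sum_mono) (simp add: q_def less_imp_le)
  also have "\<dots> < d" using d(1) by (simp add: r_def field_simps)
  finally have "dist q t < d" .
  moreover have "q \<in> octant t {}" using p by (simp add: octant_def q_def)
  ultimately have big: "a < \<bar>dfun f q\<bar>" by (rule d(2))
  have "0 \<le> p i" for i using t p(2)[of i] by (auto simp: unit_cube_def intro: order_trans)
  then have "q \<in> unit_cube" using p(3) by (simp add: q_def unit_cube_def)
  moreover have "\<forall>i. q $ i \<in> \<rat>" using p by (simp add: q_def)
  ultimately show thesis using big by (rule that)
qed

lemma measurable_norm_dspace: "(norm :: ('m::finite) dspace \<Rightarrow> real) \<in> borel_measurable D_sigma"
proof -
  define I where "I = {q :: real ^ 'm. q \<in> unit_cube \<and> (\<forall>i. q $ i \<in> \<rat>)}"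
  have "I \<subseteq> vec_lambda ` (UNIV \<rightarrow>\<^sub>E \<rat>)"
  proof
    fix v assume "v \<in> I"
    then have "v = vec_lambda (vec_nth v)" "vec_nth v \<in> UNIV \<rightarrow>\<^sub>E \<rat>" by (auto simp: I_def)
    then show "v \<in> vec_lambda ` (UNIV \<rightarrow>\<^sub>E \<rat>)" by (rule image_eqI)
  qed
  moreover have "countable (UNIV \<rightarrow>\<^sub>E \<rat> :: ('m \<Rightarrow> real) set)" by (intro countable_PiE countable_rat) simp
  ultimately have I: "countable I" by (rule countable_subset[OF _ countable_image])
  have I0: "0 \<in> I" by (simp add: I_def unit_cube_def)
  have bdd: "bdd_above ((\<lambda>q. \<bar>dfun f q\<bar>) ` I)" for f :: "'m dspace"
    by (rule bdd_aboveI2[of _ _ "norm f"]) (rule abs_dfun_le_norm)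
  have "norm f = (SUP q\<in>I. \<bar>dfun f q\<bar>)" for f :: "'m dspace"
  proof (rule antisym)
    show "norm f \<le> (SUP q\<in>I. \<bar>dfun f q\<bar>)"
    proof (rule norm_dspace_leI, rule ccontr)
      fix t :: "real ^ 'm" assume t: "t \<in> unit_cube" and "\<not> \<bar>dfun f t\<bar> \<le> (SUP q\<in>I. \<bar>dfun f q\<bar>)"
      then have "(SUP q\<in>I. \<bar>dfun f q\<bar>) < \<bar>dfun f t\<bar>" by simp
      then obtain q where "q \<in> unit_cube" "\<forall>i. q $ i \<in> \<rat>" "(SUP q\<in>I. \<bar>dfun f q\<bar>) < \<bar>dfun f q\<bar>"
        by (rule dfun_right_rational[OF t])
      moreover from this have "\<bar>dfun f q\<bar> \<le> (SUP q\<in>I. \<bar>dfun f q\<bar>)"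
        by (intro cSUP_upper[OF _ bdd]) (simp add: I_def)
      ultimately show False by simp
    qed
    show "(SUP q\<in>I. \<bar>dfun f q\<bar>) \<le> norm f"
      using I0 by (intro cSUP_least abs_dfun_le_norm) blast
  qed
  then have eq: "norm = (\<lambda>f :: 'm dspace. SUP q\<in>I. \<bar>dfun f q\<bar>)" by (rule ext)
  show ?thesis unfolding eq
    by (rule borel_measurable_cSUP[OF I]) (use bdd in measurable)
qed

lemma multilinear_replicate_sum:
  fixes F :: "'e::real_normed_vector list \<Rightarrow> real"
  assumes F: "bounded_multilinear F" and V: "finite V"
  shows "F (ps @ replicate j (\<Sum>v\<in>V. a v *\<^sub>R c v)) =
     (\<Sum>vs\<in>{vs. set vs \<subseteq> V \<and> length vs = j}. prod_list (map a vs) * F (ps @ map c vs))"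
\<comment> \<open>The prefix \<open>ps\<close> collects the slots that are already expanded.\<close>
proof (induction j arbitrary: ps)
  case 0
  have "{vs. set vs \<subseteq> V \<and> length vs = 0} = {[]}" by auto
  then show ?case by simp
next
  case (Suc j)
  let ?S = "\<Sum>v\<in>V. a v *\<^sub>R c v" and ?L = "{vs. set vs \<subseteq> V \<and> length vs = j}"
  have lin: "linear (\<lambda>h. F (ps @ h # replicate j ?S))" by (rule bounded_multilinear_lin[OF F])
  have "F (ps @ replicate (Suc j) ?S) = (\<Sum>v\<in>V. a v * F (ps @ c v # replicate j ?S))"
    using linear_sum[OF lin, of "\<lambda>v. a v *\<^sub>R c v" V] linear_scale[OF lin] by simp
  also have "\<dots> = (\<Sum>v\<in>V. a v * (\<Sum>vs\<in>?L. prod_list (map a vs) * F ((ps @ [c v]) @ map c vs)))"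
    using Suc[of "ps @ [c v]" for v] by simp
  also have "\<dots> = (\<Sum>v\<in>V. \<Sum>vs\<in>?L. prod_list (map a (v # vs)) * F (ps @ map c (v # vs)))"
    by (simp add: sum_distrib_left mult.assoc)
  also have "\<dots> = (\<Sum>vs\<in>?L. \<Sum>v\<in>V. prod_list (map a (v # vs)) * F (ps @ map c (v # vs)))"
    by (rule sum.swap)
  also have "\<dots> = (\<Sum>(vs, v)\<in>?L \<times> V. prod_list (map a (v # vs)) * F (ps @ map c (v # vs)))"
    by (rule sum.cartesian_product)
  also have "\<dots> = (\<Sum>vs\<in>{vs. set vs \<subseteq> V \<and> length vs = Suc j}. prod_list (map a vs) * F (ps @ map c vs))"
    unfolding lists_length_Suc_eq
    by (subst sum.reindex) (auto simp: inj_on_def case_prod_unfold comp_def)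
  finally show ?case .
qed

lemma approx_form_expansion:
  fixes F :: "('m::finite) dspace list \<Rightarrow> real"
  assumes "bounded_multilinear F" "grid R"
  shows "F (replicate j (approx R f)) =
     (\<Sum>vs\<in>{vs. set vs \<subseteq> grid_points R \<and> length vs = j}. prod_list (map (dfun f) vs) * F (map (cell R) vs))"
  using multilinear_replicate_sum[OF assms(1) finite_grid_points, of R "[]" j "dfun f" "cell R"] assms(2)
  unfolding approx_def grid_def by simp

lemma measurable_prod_list_dfun: "(\<lambda>f. prod_list (map (dfun f) vs)) \<in> borel_measurable D_sigma"
  by (induction vs) auto

lemma abs_prod_list_dfun_le: "\<bar>prod_list (map (dfun f) vs)\<bar> \<le> norm f ^ length vs"
  by (induction vs) (auto simp: abs_mult intro!: mult_mono abs_dfun_le_norm)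

lemma integrable_prod_list_dfun:
  assumes X: "X \<in> M \<rightarrow>\<^sub>M D_sigma" and "integrable M (\<lambda>\<omega>. norm (X \<omega>) ^ length vs)"
  shows "integrable M (\<lambda>\<omega>. prod_list (map (dfun (X \<omega>)) vs))"
  using assms(2)
proof (rule Bochner_Integration.integrable_bound)
  show "(\<lambda>\<omega>. prod_list (map (dfun (X \<omega>)) vs)) \<in> borel_measurable M"
    using measurable_compose[OF X measurable_prod_list_dfun] .
  show "AE \<omega> in M. norm (prod_list (map (dfun (X \<omega>)) vs)) \<le> norm (norm (X \<omega>) ^ length vs)"
    by (intro always_eventually allI) (simp add: abs_prod_list_dfun_le)
qed

lemma prod_list_map_nth: "prod_list (map a vs) = (\<Prod>i=1..length vs. a (vs ! (i - 1)))"
proof -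
  have "prod_list (map a vs) = (\<Prod>i<length vs. a (vs ! i))"
  proof -
    have "map a vs = map (\<lambda>i. a (vs ! i)) [0..<length vs]" by (rule nth_equalityI) auto
    then show ?thesis by (simp only: prod_list_map_upt)
  qed
  also have "\<dots> = (\<Prod>i=1..length vs. a (vs ! (i - 1)))"
    by (rule prod.reindex_bij_witness[of _ "\<lambda>i. i - 1" Suc]) auto
  finally show ?thesis .
qed

text \<open>Dominated convergence with the bound \<open>C * norm (X \<omega>) ^ j\<close>, which
  also covers the approximations because \<open>approx\<close> is a contraction. The mean of each
  approximation is a finite combination of moments of evaluations.\<close>

lemma form_moment_limit:
  fixes F :: "('m::finite) dspace list \<Rightarrow> real"
  assumes X: "X \<in> M \<rightarrow>\<^sub>M D_sigma" and int: "integrable M (\<lambda>\<omega>. norm (X \<omega>) ^ j)"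
    and F: "bounded_multilinear F" and meas: "(\<lambda>f. F (replicate j f)) \<in> borel_measurable D_sigma"
    and R: "\<And>n. grid (R n)"
    and lim: "\<And>f. (\<lambda>n. F (replicate j (approx (R n) f))) \<longlonglongrightarrow> F (replicate j f)"
  shows "(\<lambda>n. \<Sum>vs\<in>{vs. set vs \<subseteq> grid_points (R n) \<and> length vs = j}.
       (\<integral>\<omega>. prod_list (map (dfun (X \<omega>)) vs) \<partial>M) * F (map (cell (R n)) vs))
     \<longlonglongrightarrow> (\<integral>\<omega>. F (replicate j (X \<omega>)) \<partial>M)" and "integrable M (\<lambda>\<omega>. F (replicate j (X \<omega>)))"
proof -
  obtain C where C: "C \<ge> 0" "\<And>hs. \<bar>F hs\<bar> \<le> C * prod_list (map norm hs)"
    using bounded_multilinear_bound[OF F] by metis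
  have bound: "\<bar>F (replicate j f)\<bar> \<le> C * norm f ^ j" for f
    using C(2)[of "replicate j f"] by (simp add: prod_list_replicate)
  have meas_approx: "(\<lambda>f. F (replicate j (approx (R n) f))) \<in> borel_measurable D_sigma" for n
    using measurable_compose[OF measurable_approx[OF R] meas] .
  have "(\<lambda>n. \<integral>\<omega>. F (replicate j (approx (R n) (X \<omega>))) \<partial>M) \<longlonglongrightarrow> (\<integral>\<omega>. F (replicate j (X \<omega>)) \<partial>M)"
  proof (rule integral_dominated_convergence[where w = "\<lambda>\<omega>. C * norm (X \<omega>) ^ j"])
    show "(\<lambda>\<omega>. F (replicate j (X \<omega>))) \<in> borel_measurable M" using measurable_compose[OF X meas] .
    show "(\<lambda>\<omega>. F (replicate j (approx (R n) (X \<omega>)))) \<in> borel_measurable M" for n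
      using measurable_compose[OF X meas_approx] .
    show "AE \<omega> in M. norm (F (replicate j (approx (R n) (X \<omega>)))) \<le> C * norm (X \<omega>) ^ j" for n
    proof (intro always_eventually allI)
      fix \<omega>
      have "norm (F (replicate j (approx (R n) (X \<omega>)))) \<le> C * norm (approx (R n) (X \<omega>)) ^ j"
        using bound by simp
      also have "\<dots> \<le> C * norm (X \<omega>) ^ j"
        using C(1) norm_approx_le[OF R] by (intro mult_left_mono power_mono) auto
      finally show "norm (F (replicate j (approx (R n) (X \<omega>)))) \<le> C * norm (X \<omega>) ^ j" .
    qed
  qed (use int lim in auto)
  moreover have "integrable M (\<lambda>\<omega>. prod_list (map (dfun (X \<omega>)) vs))" if "length vs = j" for vs
    using integrable_prod_list_dfun[OF X, of vs] int that by simp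
  then have "(\<integral>\<omega>. F (replicate j (approx (R n) (X \<omega>))) \<partial>M) =
      (\<Sum>vs\<in>{vs. set vs \<subseteq> grid_points (R n) \<and> length vs = j}.
       (\<integral>\<omega>. prod_list (map (dfun (X \<omega>)) vs) \<partial>M) * F (map (cell (R n)) vs))" for n
    unfolding approx_form_expansion[OF F R]
    by (subst Bochner_Integration.integral_sum) auto
  ultimately show "(\<lambda>n. \<Sum>vs\<in>{vs. set vs \<subseteq> grid_points (R n) \<and> length vs = j}.
       (\<integral>\<omega>. prod_list (map (dfun (X \<omega>)) vs) \<partial>M) * F (map (cell (R n)) vs))
     \<longlonglongrightarrow> (\<integral>\<omega>. F (replicate j (X \<omega>)) \<partial>M)" by simp
  have "integrable M (\<lambda>\<omega>. C * norm (X \<omega>) ^ j)" using int by simp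
  then show "integrable M (\<lambda>\<omega>. F (replicate j (X \<omega>)))"
  proof (rule Bochner_Integration.integrable_bound)
    show "(\<lambda>\<omega>. F (replicate j (X \<omega>))) \<in> borel_measurable M" using measurable_compose[OF X meas] .
    show "AE \<omega> in M. norm (F (replicate j (X \<omega>))) \<le> norm (C * norm (X \<omega>) ^ j)"
      using bound C(1) by (intro always_eventually allI) (simp add: abs_mult)
  qed
qed

lemma form_moments_eq:
  fixes F :: "('m::finite) dspace list \<Rightarrow> real"
  assumes X: "X \<in> M \<rightarrow>\<^sub>M D_sigma" "integrable M (\<lambda>\<omega>. norm (X \<omega>) ^ j)"
    and Y: "Y \<in> N \<rightarrow>\<^sub>M D_sigma" "integrable N (\<lambda>\<omega>. norm (Y \<omega>) ^ j)"
    and F: "bounded_multilinear F" "(\<lambda>f. F (replicate j f)) \<in> borel_measurable D_sigma"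
    and eq: "\<And>vs. set vs \<subseteq> unit_cube \<Longrightarrow> length vs = j \<Longrightarrow>
      (\<integral>\<omega>. prod_list (map (dfun (X \<omega>)) vs) \<partial>M) = (\<integral>\<omega>. prod_list (map (dfun (Y \<omega>)) vs) \<partial>N)"
  shows "(\<integral>\<omega>. F (replicate j (X \<omega>)) \<partial>M) = (\<integral>\<omega>. F (replicate j (Y \<omega>)) \<partial>N)"
proof -
  \<comment> \<open>One sequence of grids, chosen from the form alone, serves both \<open>X\<close>
    and \<open>Y\<close>.\<close>
  obtain R where R: "\<And>n. grid (R n)"
    "\<And>f. (\<lambda>n. F (replicate j (approx (R n) f))) \<longlonglongrightarrow> F (replicate j f)"
    using approx_converges[OF F(1)] by blast
  have "(\<Sum>vs\<in>{vs. set vs \<subseteq> grid_points (R n) \<and> length vs = j}.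
       (\<integral>\<omega>. prod_list (map (dfun (X \<omega>)) vs) \<partial>M) * F (map (cell (R n)) vs)) =
     (\<Sum>vs\<in>{vs. set vs \<subseteq> grid_points (R n) \<and> length vs = j}.
       (\<integral>\<omega>. prod_list (map (dfun (Y \<omega>)) vs) \<partial>N) * F (map (cell (R n)) vs))" for n
  proof (rule sum.cong)
    fix vs :: "(real ^ 'm) list" assume "vs \<in> {vs. set vs \<subseteq> grid_points (R n) \<and> length vs = j}"
    then have "set vs \<subseteq> unit_cube" "length vs = j" by (auto simp: grid_points_def)
    from eq[OF this] show "(\<integral>\<omega>. prod_list (map (dfun (X \<omega>)) vs) \<partial>M) * F (map (cell (R n)) vs) =
       (\<integral>\<omega>. prod_list (map (dfun (Y \<omega>)) vs) \<partial>N) * F (map (cell (R n)) vs)" by simp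
  qed simp
  from form_moment_limit(1)[OF X F R, unfolded this] form_moment_limit(1)[OF Y F R]
  show ?thesis by (rule LIMSEQ_unique)
qed

section \<open>Taylor expansion\<close>

lemma bounded_linear_mform_apply: "bounded_linear (\<lambda>F. mform_apply F hs)"
proof (rule bounded_linear_intro[where K = "prod_list (map norm hs)"])
  fix F G :: "'a mform" and c :: real
  show "mform_apply (F + G) hs = mform_apply F hs + mform_apply G hs" by (simp add: plus_mform.rep_eq)
  show "mform_apply (c *\<^sub>R F) hs = c *\<^sub>R mform_apply F hs" by (simp add: scaleR_mform.rep_eq)
  show "norm (mform_apply F hs) \<le> norm F * prod_list (map norm hs)"
    using abs_mform_apply_le_norm[of F hs] by simp
qed

lemma mform_apply_diff: "mform_apply (F - G) hs = mform_apply F hs - mform_apply G hs"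
  by (rule linear_diff[OF bounded_linear.linear[OF bounded_linear_mform_apply]])

context
  fixes k :: nat and g :: "'a::real_normed_vector \<Rightarrow> real" and D :: "nat \<Rightarrow> 'a \<Rightarrow> 'a mform"
  assumes fd: "frechet_derivatives k g D"
begin

text \<open>For \<open>i \<le> k\<close> this is the \<open>i\<close>-th derivative of the real
  function sending \<open>r\<close> to \<open>g (r *\<^sub>R x)\<close>.\<close>

definition ray_derivative :: "'a \<Rightarrow> nat \<Rightarrow> real \<Rightarrow> real" where
  "ray_derivative x i r = mform_apply (D i (r *\<^sub>R x)) (replicate i x)"

lemma ray_derivative_0: "ray_derivative x 0 r = g (r *\<^sub>R x)"
  using fd by (simp add: ray_derivative_def frechet_derivatives_def)

lemma ray_derivative_at_0: "ray_derivative x i 0 = mform_apply (D i 0) (replicate i x)"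
  by (simp add: ray_derivative_def)

lemma DERIV_ray_derivative:
  assumes "i < k"
  shows "DERIV (ray_derivative x i) r :> ray_derivative x (Suc i) r"
proof -
  have "(D i has_derivative (\<lambda>h. mform_insert h (D (Suc i) (r *\<^sub>R x)))) (at (r *\<^sub>R x))"
    using fd assms unfolding frechet_derivatives_def by blast
  moreover have "((\<lambda>r. r *\<^sub>R x) has_derivative (\<lambda>h. h *\<^sub>R x)) (at r)"
    by (rule bounded_linear_imp_has_derivative[OF bounded_linear_scaleR_left])
  ultimately have "((\<lambda>r. D i (r *\<^sub>R x)) has_derivative (\<lambda>h. mform_insert (h *\<^sub>R x) (D (Suc i) (r *\<^sub>R x)))) (at r)"
    by (rule has_derivative_compose[rotated])
  from bounded_linear.has_derivative[OF bounded_linear_mform_apply this, of "replicate i x"]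
  have "(ray_derivative x i has_derivative
      (\<lambda>h. mform_apply (D (Suc i) (r *\<^sub>R x)) ((h *\<^sub>R x) # replicate i x))) (at r)"
    unfolding ray_derivative_def by (simp add: mform_insert.rep_eq)
  moreover have "mform_apply (D (Suc i) (r *\<^sub>R x)) ((h *\<^sub>R x) # replicate i x) = h * ray_derivative x (Suc i) r" for h
    using linear_scale[OF bounded_multilinear_lin[of "mform_apply (D (Suc i) (r *\<^sub>R x))" "[]" "replicate i x"]]
      mform_apply[of "D (Suc i) (r *\<^sub>R x)"] by (simp add: ray_derivative_def)
  ultimately show ?thesis by (simp add: has_field_derivative_def mult.commute[of _ "ray_derivative x (Suc i) r"])
qed

text \<open>Continuity of \<open>D i\<close> at 0 is given for \<open>i = k\<close> and follows from
  differentiability below. The filter \<open>nhds 0\<close> is used because the intermediate points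
  of \<open>ray_taylor\<close> are only known to be nonnegative.\<close>

lemma ray_derivative_tendsto:
  assumes "i \<le> k"
  shows "(ray_derivative x i \<longlongrightarrow> ray_derivative x i 0) (nhds 0)"
proof -
  have "isCont (D i) 0"
  proof (cases "i = k")
    case True
    then show ?thesis using fd by (auto simp: frechet_derivatives_def continuous_on_eq_continuous_at)
  next
    case False
    with assms have "i < k" by simp
    then have "(D i has_derivative (\<lambda>h. mform_insert h (D (Suc i) 0))) (at 0)"
      using fd unfolding frechet_derivatives_def by blast
    then show ?thesis by (rule has_derivative_continuous)
  qed
  moreover have "isCont (\<lambda>r. r *\<^sub>R x) 0" by (intro continuous_intros)
  ultimately have "isCont (\<lambda>r. D i (r *\<^sub>R x)) 0"
    using isCont_o2[of 0 "\<lambda>r. r *\<^sub>R x" "D i"] by simp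
  then have "isCont (ray_derivative x i) 0"
    unfolding ray_derivative_def by (rule bounded_linear.isCont[OF bounded_linear_mform_apply])
  then show ?thesis unfolding isCont_def tendsto_nhds_iff by simp
qed

lemma ray_taylor:
  assumes "i \<le> k" "0 < h"
  obtains \<xi> where "0 \<le> \<xi>" "\<xi> \<le> h"
    "g (h *\<^sub>R x) = (\<Sum>m<i. ray_derivative x m 0 / fact m * h ^ m) + ray_derivative x i \<xi> / fact i * h ^ i"
proof (cases "i = 0")
  \<comment> \<open>For \<open>i = 0\<close> the sum is empty and the remainder is the value itself,
    so \<open>\<xi> = h\<close>.\<close>
  case True
  then show thesis using that[of h] assms by (simp add: ray_derivative_0)
next
  case False
  have "\<exists>t>0. t < h \<and> g (h *\<^sub>R x) = (\<Sum>m<i. ray_derivative x m 0 / fact m * h ^ m) + ray_derivative x i t / fact i * h ^ i"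
    using assms False
    by (intro Maclaurin[where f = "\<lambda>r. g (r *\<^sub>R x)"]) (auto simp: ray_derivative_0 fun_eq_iff intro: DERIV_ray_derivative)
  then obtain t where "0 < t" "t < h"
    "g (h *\<^sub>R x) = (\<Sum>m<i. ray_derivative x m 0 / fact m * h ^ m) + ray_derivative x i t / fact i * h ^ i"
    by blast
  then show thesis by (intro that[of t] less_imp_le)
qed

text \<open>In the Lagrange form at \<open>h = 1\<close> the last term differs from its value at 0
  only through \<open>D k\<close> at \<open>\<xi> *\<^sub>R x\<close> and at 0; the Hoelder
  condition bounds this difference, and the factor \<open>1 / fact k\<close> is at most 1.\<close>

lemma taylor_remainder:
  assumes hoelder: "\<And>x y. norm (D k x - D k y) \<le> norm (x - y) powr \<alpha>" and \<alpha>: "0 < \<alpha>"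
  shows "\<bar>g x - (\<Sum>i\<le>k. mform_apply (D i 0) (replicate i x) / fact i)\<bar> \<le> norm x powr (real k + \<alpha>)"
proof -
  obtain \<xi> where \<xi>: "0 \<le> \<xi>" "\<xi> \<le> 1"
    and g: "g (1 *\<^sub>R x) = (\<Sum>m<k. ray_derivative x m 0 / fact m * 1 ^ m) + ray_derivative x k \<xi> / fact k * 1 ^ k"
    by (rule ray_taylor[OF order_refl zero_less_one])
  have "g x - (\<Sum>i\<le>k. mform_apply (D i 0) (replicate i x) / fact i) =
      (ray_derivative x k \<xi> - ray_derivative x k 0) / fact k"
    using g by (simp add: ray_derivative_at_0 lessThan_Suc_atMost[symmetric] diff_divide_distrib)
  also have "\<bar>\<dots>\<bar> \<le> \<bar>ray_derivative x k \<xi> - ray_derivative x k 0\<bar>"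
  proof -
    have "\<bar>a / fact k\<bar> \<le> \<bar>a\<bar>" for a :: real
      using fact_ge_1[of k, where 'a = real] divide_left_mono[of 1 "fact k" "\<bar>a\<bar>"] by simp
    then show ?thesis .
  qed
  also have "\<dots> = \<bar>mform_apply (D k (\<xi> *\<^sub>R x) - D k 0) (replicate k x)\<bar>"
    by (simp add: ray_derivative_def mform_apply_diff)
  also have "\<dots> \<le> norm (D k (\<xi> *\<^sub>R x) - D k 0) * norm x ^ k"
    using abs_mform_apply_le_norm[of "D k (\<xi> *\<^sub>R x) - D k 0" "replicate k x"] by (simp add: prod_list_replicate)
  also have "\<dots> \<le> norm x powr \<alpha> * norm x ^ k"
  proof (rule mult_right_mono)
    have "norm (D k (\<xi> *\<^sub>R x) - D k 0) \<le> norm (\<xi> *\<^sub>R x) powr \<alpha>" using hoelder[of "\<xi> *\<^sub>R x" 0] by simp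
    also have "\<dots> \<le> norm x powr \<alpha>"
      using \<xi> \<alpha> by (intro powr_mono2) (auto simp: mult_left_le_one_le)
    finally show "norm (D k (\<xi> *\<^sub>R x) - D k 0) \<le> norm x powr \<alpha>" .
  qed simp
  also have "\<dots> = norm x powr (real k + \<alpha>)"
    using \<alpha> by (cases "x = 0") (auto simp: powr_add powr_realpow)
  finally show ?thesis .
qed

end

lemma measurable_taylor_term:
  fixes g :: "('m::finite) dspace \<Rightarrow> real"
  assumes fd: "frechet_derivatives k g D" and g: "g \<in> borel_measurable D_sigma"
  shows "i \<le> k \<Longrightarrow> (\<lambda>x. mform_apply (D i 0) (replicate i x)) \<in> borel_measurable D_sigma"
proof (induction i rule: less_induct)
  case (less i)
  define h where "h = (\<lambda>n. 1 / real (Suc n))"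
  have h: "h n > 0" for n by (simp add: h_def)
  have h0: "h \<longlonglongrightarrow> 0" unfolding h_def by (rule LIMSEQ_Suc[OF lim_const_over_n])
  \<comment> \<open>Solving Taylor's formula at \<open>h n *\<^sub>R x\<close> for its last term:
    \<open>q n x\<close> is the \<open>i\<close>-th derivative along the ray at a point of [0, h n],
    hence tends to the derivative at 0.\<close>
  define q where "q = (\<lambda>n x. (g (h n *\<^sub>R x) -
      (\<Sum>m<i. mform_apply (D m 0) (replicate m x) / fact m * h n ^ m)) * fact i / h n ^ i)"
  show ?case
  proof (rule borel_measurable_LIMSEQ_real)
    show "q n \<in> borel_measurable D_sigma" for n
    proof -
      have [measurable]: "(\<lambda>x. g (h n *\<^sub>R x)) \<in> borel_measurable D_sigma"
        by (rule measurable_compose[OF measurable_scaleR_D g])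
      have [measurable]: "(\<lambda>x. mform_apply (D m 0) (replicate m x)) \<in> borel_measurable D_sigma" if "m \<in> {..<i}" for m
        using less that by auto
      show ?thesis unfolding q_def by measurable
    qed
    fix x :: "'m dspace"
    have "\<exists>\<xi>. 0 \<le> \<xi> \<and> \<xi> \<le> h n \<and> q n x = ray_derivative D x i \<xi>" for n
    proof -
      obtain \<xi> where "0 \<le> \<xi>" "\<xi> \<le> h n"
        "g (h n *\<^sub>R x) = (\<Sum>m<i. ray_derivative D x m 0 / fact m * h n ^ m) + ray_derivative D x i \<xi> / fact i * h n ^ i"
        by (rule ray_taylor[OF fd less.prems h])
      then show ?thesis using h[of n]
        by (intro exI[of _ \<xi>]) (simp add: q_def ray_derivative_at_0[OF fd])
    qed
    then obtain \<xi> where \<xi>: "\<And>n. 0 \<le> \<xi> n" "\<And>n. \<xi> n \<le> h n" "\<And>n. q n x = ray_derivative D x i (\<xi> n)"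
      by metis
    have "\<xi> \<longlonglongrightarrow> 0"
      by (rule tendsto_sandwich[OF _ _ tendsto_const h0]) (use \<xi> in auto)
    from filterlim_compose[OF ray_derivative_tendsto[OF fd less.prems] this]
    show "(\<lambda>n. q n x) \<longlonglongrightarrow> mform_apply (D i 0) (replicate i x)"
      unfolding \<xi>(3) ray_derivative_at_0[OF fd] .
  qed
qed

section \<open>Moment bounds and finiteness of the distance\<close>

lemma integrable_norm_power:
  assumes M: "prob_space M" and X: "X \<in> M \<rightarrow>\<^sub>M D_sigma"
    and fin: "(\<integral>\<^sup>+ \<omega>. ennreal (norm (X \<omega>) powr s) \<partial>M) < \<infinity>"
  shows "integrable M (\<lambda>\<omega>. norm (X \<omega>) powr s)"
    and "real j < s \<Longrightarrow> integrable M (\<lambda>\<omega>. norm (X \<omega>) ^ j)"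
proof -
  interpret prob_space M by (rule M)
  have nX [measurable]: "(\<lambda>\<omega>. norm (X \<omega>)) \<in> borel_measurable M"
    using measurable_compose[OF X measurable_norm_dspace] .
  show int: "integrable M (\<lambda>\<omega>. norm (X \<omega>) powr s)"
    by (rule integrableI_bounded) (use fin in auto)
  assume j: "real j < s"
  have "integrable M (\<lambda>\<omega>. 1 + norm (X \<omega>) powr s)" using int by simp
  then show "integrable M (\<lambda>\<omega>. norm (X \<omega>) ^ j)"
  proof (rule Bochner_Integration.integrable_bound)
    have "a ^ j \<le> 1 + a powr s" if "a \<ge> 0" for a :: real
    proof (cases "a \<le> 1")
      case True
      then have "a ^ j \<le> 1" using that by (simp add: power_le_one)
      then show ?thesis by (simp add: add_increasing2)
    next
      case False
      then have "a ^ j = a powr real j" by (simp add: powr_realpow)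
      also have "\<dots> \<le> a powr s" using False j by (intro powr_mono) auto
      finally show ?thesis by simp
    qed
    then show "AE \<omega> in M. norm (norm (X \<omega>) ^ j) \<le> norm (1 + norm (X \<omega>) powr s)"
      by (intro always_eventually allI) (simp add: abs_of_nonneg)
  qed simp
qed

text \<open>Taylor terms and remainder are integrable separately, and so is \<open>g\<close> of
  \<open>X\<close>. The bound on the right does not involve \<open>g\<close>, which makes the
  supremum over the class finite once the Taylor terms have equal means.\<close>

lemma zolotarev_taylor_bound:
  fixes g :: "('m::finite) dspace \<Rightarrow> real"
  assumes fd: "frechet_derivatives k g D" and g: "g \<in> borel_measurable D_sigma"
    and hoelder: "\<And>x y. norm (D k x - D k y) \<le> norm (x - y) powr \<alpha>" and \<alpha>: "0 < \<alpha>" and s: "s = real k + \<alpha>"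
    and M: "prob_space M" and X: "X \<in> M \<rightarrow>\<^sub>M D_sigma"
    and fin: "(\<integral>\<^sup>+ \<omega>. ennreal (norm (X \<omega>) powr s) \<partial>M) < \<infinity>"
  shows "\<bar>(\<integral>\<omega>. g (X \<omega>) \<partial>M) - (\<Sum>i\<le>k. (\<integral>\<omega>. mform_apply (D i 0) (replicate i (X \<omega>)) \<partial>M) / fact i)\<bar>
     \<le> (\<integral>\<omega>. norm (X \<omega>) powr s \<partial>M)"
proof -
  note meas = measurable_taylor_term[OF fd g]
  define T where "T = (\<lambda>x. \<Sum>i\<le>k. mform_apply (D i 0) (replicate i x) / fact i)"
  have int_term: "integrable M (\<lambda>\<omega>. mform_apply (D i 0) (replicate i (X \<omega>)))" if "i \<le> k" for i
  proof -
    have F: "bounded_multilinear (mform_apply (D i 0))" using mform_apply[of "D i 0"] by simp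
    obtain R where R: "\<And>n. grid (R n)"
      "\<And>f. (\<lambda>n. mform_apply (D i 0) (replicate i (approx (R n) f))) \<longlonglongrightarrow> mform_apply (D i 0) (replicate i f)"
      using approx_converges[OF F, of i thesis] by blast
    have "real i < s" using that s \<alpha> by simp
    from form_moment_limit(2)[OF X integrable_norm_power(2)[OF M X fin this] F meas[OF that] R]
    show ?thesis .
  qed
  have intT: "integrable M (\<lambda>\<omega>. T (X \<omega>))"
    unfolding T_def using int_term by (intro Bochner_Integration.integrable_sum integrable_divide) auto
  have int_norm: "integrable M (\<lambda>\<omega>. norm (X \<omega>) powr s)" by (rule integrable_norm_power(1)[OF M X fin])
  have gX: "(\<lambda>\<omega>. g (X \<omega>)) \<in> borel_measurable M" using measurable_compose[OF X g] .
  have rem: "\<bar>g x - T x\<bar> \<le> norm x powr s" for x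
    unfolding T_def s by (rule taylor_remainder[OF fd hoelder \<alpha>])
  have int_diff: "integrable M (\<lambda>\<omega>. g (X \<omega>) - T (X \<omega>))"
    by (rule Bochner_Integration.integrable_bound[OF int_norm])
      (use gX borel_measurable_integrable[OF intT] rem in auto)
  have "integrable M (\<lambda>\<omega>. (g (X \<omega>) - T (X \<omega>)) + T (X \<omega>))"
    by (rule Bochner_Integration.integrable_add[OF int_diff intT])
  then have intg: "integrable M (\<lambda>\<omega>. g (X \<omega>))" by simp
  have "(\<integral>\<omega>. T (X \<omega>) \<partial>M) = (\<Sum>i\<le>k. (\<integral>\<omega>. mform_apply (D i 0) (replicate i (X \<omega>)) \<partial>M) / fact i)"
    unfolding T_def using int_term by (subst Bochner_Integration.integral_sum) auto
  then have "(\<integral>\<omega>. g (X \<omega>) \<partial>M) - (\<Sum>i\<le>k. (\<integral>\<omega>. mform_apply (D i 0) (replicate i (X \<omega>)) \<partial>M) / fact i) =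
      (\<integral>\<omega>. g (X \<omega>) - T (X \<omega>) \<partial>M)"
    using Bochner_Integration.integral_diff[OF intg intT] by simp
  also have "\<bar>\<dots>\<bar> \<le> (\<integral>\<omega>. \<bar>g (X \<omega>) - T (X \<omega>)\<bar> \<partial>M)" by (rule integral_abs_bound)
  also have "\<dots> \<le> (\<integral>\<omega>. norm (X \<omega>) powr s \<partial>M)"
    using int_diff int_norm rem by (intro integral_mono) auto
  finally show ?thesis .
qed

lemma zolotarev_finite_if_moments_eq:
  fixes X :: "'a \<Rightarrow> ('m::finite) dspace" and Y :: "'b \<Rightarrow> 'm dspace"
  assumes M: "prob_space M" and N: "prob_space N"
    and X: "X \<in> M \<rightarrow>\<^sub>M D_sigma" and Y: "Y \<in> N \<rightarrow>\<^sub>M D_sigma"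
    and finX: "(\<integral>\<^sup>+ \<omega>. ennreal (norm (X \<omega>) powr s) \<partial>M) < \<infinity>"
    and finY: "(\<integral>\<^sup>+ \<omega>. ennreal (norm (Y \<omega>) powr s) \<partial>N) < \<infinity>"
    and eq: "\<And>l t. 0 < l \<Longrightarrow> real l < s \<Longrightarrow> (\<And>i. i \<in> {1..l} \<Longrightarrow> t i \<in> unit_cube) \<Longrightarrow>
      (\<integral>\<omega>. (\<Prod>i=1..l. dfun (X \<omega>) (t i)) \<partial>M) = (\<integral>\<omega>. (\<Prod>i=1..l. dfun (Y \<omega>) (t i)) \<partial>N)"
  shows "zolotarev_dist s M X N Y < \<infinity>"
proof -
  interpret M: prob_space M by (rule M)
  interpret N: prob_space N by (rule N)
  have eq_list: "(\<integral>\<omega>. prod_list (map (dfun (X \<omega>)) vs) \<partial>M) = (\<integral>\<omega>. prod_list (map (dfun (Y \<omega>)) vs) \<partial>N)"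
    if vs: "set vs \<subseteq> unit_cube" and l: "real (length vs) < s" for vs
  \<comment> \<open>Degree 0 is not among the moment assumptions; there both sides are the total
    mass 1.\<close>
  proof (cases "vs = []")
    case True
    then show ?thesis by (simp add: M.prob_space N.prob_space)
  next
    case False
    have "vs ! (i - 1) \<in> unit_cube" if "i \<in> {1..length vs}" for i
    proof -
      have "vs ! (i - 1) \<in> set vs" using that by (intro nth_mem) auto
      with vs show ?thesis by blast
    qed
    with eq[of "length vs" "\<lambda>i. vs ! (i - 1)"] False l show ?thesis unfolding prod_list_map_nth by simp
  qed
  define B where "B = (\<integral>\<omega>. norm (X \<omega>) powr s \<partial>M) + (\<integral>\<omega>. norm (Y \<omega>) powr s \<partial>N)"
  have "\<bar>(\<integral>\<omega>. g (X \<omega>) \<partial>M) - (\<integral>\<omega>. g (Y \<omega>) \<partial>N)\<bar> \<le> B" if "g \<in> zolotarev_class s" for g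
  proof -
    obtain k \<alpha> D where g: "g \<in> borel_measurable D_sigma" and s: "s = real k + \<alpha>" and \<alpha>: "0 < \<alpha>"
      and fd: "frechet_derivatives k g D" and hoelder: "\<And>x y. norm (D k x - D k y) \<le> norm (x - y) powr \<alpha>"
      using \<open>g \<in> zolotarev_class s\<close> unfolding zolotarev_class_def by blast
    have "(\<integral>\<omega>. mform_apply (D i 0) (replicate i (X \<omega>)) \<partial>M) = (\<integral>\<omega>. mform_apply (D i 0) (replicate i (Y \<omega>)) \<partial>N)"
      if "i \<le> k" for i
    proof (rule form_moments_eq[OF X _ Y])
      have i: "real i < s" using that s \<alpha> by simp
      show "integrable M (\<lambda>\<omega>. norm (X \<omega>) ^ i)" by (rule integrable_norm_power(2)[OF M X finX i])
      show "integrable N (\<lambda>\<omega>. norm (Y \<omega>) ^ i)" by (rule integrable_norm_power(2)[OF N Y finY i])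
      show "bounded_multilinear (mform_apply (D i 0))" using mform_apply[of "D i 0"] by simp
      show "(\<lambda>f. mform_apply (D i 0) (replicate i f)) \<in> borel_measurable D_sigma"
        by (rule measurable_taylor_term[OF fd g that])
      show "(\<integral>\<omega>. prod_list (map (dfun (X \<omega>)) vs) \<partial>M) = (\<integral>\<omega>. prod_list (map (dfun (Y \<omega>)) vs) \<partial>N)"
        if "set vs \<subseteq> unit_cube" "length vs = i" for vs
        using eq_list[OF that(1)] that(2) i by simp
    qed
    then have "(\<Sum>i\<le>k. (\<integral>\<omega>. mform_apply (D i 0) (replicate i (X \<omega>)) \<partial>M) / fact i) =
        (\<Sum>i\<le>k. (\<integral>\<omega>. mform_apply (D i 0) (replicate i (Y \<omega>)) \<partial>N) / fact i)"
      by (intro sum.cong) auto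
    with zolotarev_taylor_bound[OF fd g hoelder \<alpha> s M X finX] zolotarev_taylor_bound[OF fd g hoelder \<alpha> s N Y finY]
    show ?thesis unfolding B_def by linarith
  qed
  then have "zolotarev_dist s M X N Y \<le> ennreal B"
    unfolding zolotarev_dist_def by (intro SUP_least ennreal_leI)
  also have "\<dots> < \<infinity>" by simp
  finally show ?thesis .
qed

section \<open>Moments of linear functionals\<close>

lemma bounded_multilinear_power:
  fixes \<phi> :: "'a::real_normed_vector \<Rightarrow> real"
  assumes "bounded_linear \<phi>"
  shows "bounded_multilinear (\<lambda>hs. if length hs = j then prod_list (map \<phi> hs) else 0 :: real)"
proof -
  obtain B where B: "B > 0" "\<And>h. norm (\<phi> h) \<le> norm h * B"
    using bounded_linear.pos_bounded[OF assms] by metis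
  have "\<bar>prod_list (map \<phi> hs)\<bar> \<le> B ^ length hs * prod_list (map norm hs)" for hs
  proof (induction hs)
    case (Cons h hs)
    have "\<bar>\<phi> h\<bar> * \<bar>prod_list (map \<phi> hs)\<bar> \<le> (norm h * B) * (B ^ length hs * prod_list (map norm hs))"
      using B Cons by (intro mult_mono) auto
    then show ?case by (simp add: abs_mult mult_ac)
  qed simp
  then have "\<bar>if length hs = j then prod_list (map \<phi> hs) else 0\<bar> \<le> B ^ j * prod_list (map norm hs)" for hs
    using B(1) prod_list_norm_nonneg[of hs] by auto
  moreover have "linear (\<lambda>h. if length (hs[i := h]) = j then prod_list (map \<phi> (hs[i := h])) else 0)"
    if "i < length hs" for hs i
  proof -
    have "prod_list (map \<phi> (hs[i := h])) = (prod_list (map \<phi> (take i hs)) * prod_list (map \<phi> (drop (Suc i) hs))) * \<phi> h" for h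
      using that by (simp add: upd_conv_take_nth_drop)
    moreover have "linear \<phi>" by (rule bounded_linear.linear[OF assms])
    ultimately show ?thesis
      by (cases "length hs = j") (auto intro!: linearI simp: linear_add linear_scale algebra_simps)
  qed
  ultimately show ?thesis unfolding bounded_multilinear_def by blast
qed

text \<open>The \<open>j\<close>-th tensor power of \<open>\<phi>\<close>, set to 0 on lists of
  other lengths so that it lies in \<open>kforms j\<close>.\<close>

definition power_form :: "('a::real_normed_vector \<Rightarrow> real) \<Rightarrow> nat \<Rightarrow> 'a mform" where
  "power_form \<phi> j = Abs_mform (\<lambda>hs. if length hs = j then prod_list (map \<phi> hs) else 0)"

lemma power_form_apply:
  "bounded_linear \<phi> \<Longrightarrow> mform_apply (power_form \<phi> j) hs = (if length hs = j then prod_list (map \<phi> hs) else 0)"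
  unfolding power_form_def using bounded_multilinear_power[of \<phi> j] by (subst Abs_mform_inverse) auto

lemma mform_insert_power_form:
  assumes "bounded_linear \<phi>"
  shows "mform_insert h (power_form \<phi> (Suc j)) = \<phi> h *\<^sub>R power_form \<phi> j"
  by (rule mform_apply_inject[THEN iffD1], rule ext)
    (simp add: mform_insert.rep_eq scaleR_mform.rep_eq power_form_apply[OF assms])

lemma mform_insert_scaleR: "mform_insert h (c *\<^sub>R F) = c *\<^sub>R mform_insert h F"
  by (rule mform_apply_inject[THEN iffD1], rule ext) (simp add: mform_insert.rep_eq scaleR_mform.rep_eq)

text \<open>Truncated subtraction makes the coefficient vanish for \<open>j > l\<close>.\<close>

definition power_derivative :: "real \<Rightarrow> nat \<Rightarrow> ('a::real_normed_vector \<Rightarrow> real) \<Rightarrow> nat \<Rightarrow> 'a \<Rightarrow> 'a mform" where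
  "power_derivative c l \<phi> j x = (c * real (\<Prod>i<j. l - i) * \<phi> x ^ (l - j)) *\<^sub>R power_form \<phi> j"

lemma has_derivative_power_derivative:
  assumes \<phi>: "bounded_linear \<phi>"
  shows "(power_derivative c l \<phi> j has_derivative (\<lambda>h. mform_insert h (power_derivative c l \<phi> (Suc j) x))) (at x)"
proof -
  have "((\<lambda>x. \<phi> x ^ (l - j)) has_derivative (\<lambda>h. real (l - j) * \<phi> h * \<phi> x ^ (l - j - 1))) (at x)"
    using has_derivative_power[OF bounded_linear_imp_has_derivative[OF \<phi>], of "l - j" x UNIV]
    by (simp add: mult_ac)
  from has_derivative_scaleR_left[OF has_derivative_mult_right[OF this, of "c * real (\<Prod>i<j. l - i)"], of "power_form \<phi> j"]
  have "(power_derivative c l \<phi> j has_derivative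
     (\<lambda>h. (c * real (\<Prod>i<j. l - i) * (real (l - j) * \<phi> h * \<phi> x ^ (l - j - 1))) *\<^sub>R power_form \<phi> j)) (at x)"
    unfolding power_derivative_def .
  moreover have "(c * real (\<Prod>i<j. l - i) * (real (l - j) * \<phi> h * \<phi> x ^ (l - j - 1))) *\<^sub>R power_form \<phi> j =
      mform_insert h (power_derivative c l \<phi> (Suc j) x)" for h
    unfolding power_derivative_def mform_insert_scaleR mform_insert_power_form[OF \<phi>]
    by (simp add: mult_ac)
  ultimately show ?thesis by simp
qed

lemma frechet_derivatives_power:
  assumes \<phi>: "bounded_linear \<phi>"
  shows "frechet_derivatives k (\<lambda>x. c * \<phi> x ^ l) (power_derivative c l \<phi>)"
  unfolding frechet_derivatives_def
proof (intro conjI allI impI)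
  show "power_derivative c l \<phi> j x \<in> kforms j" for j x
    by (simp add: kforms_def power_derivative_def scaleR_mform.rep_eq power_form_apply[OF \<phi>])
  show "mform_apply (power_derivative c l \<phi> 0 x) [] = c * \<phi> x ^ l" for x
    by (simp add: power_derivative_def scaleR_mform.rep_eq power_form_apply[OF \<phi>])
  show "(power_derivative c l \<phi> j has_derivative (\<lambda>h. mform_insert h (power_derivative c l \<phi> (Suc j) x))) (at x)" for j x
    by (rule has_derivative_power_derivative[OF \<phi>])
  show "continuous_on UNIV (power_derivative c l \<phi> k)"
    using has_derivative_continuous[OF has_derivative_power_derivative[OF \<phi>]]
    by (simp add: continuous_on_eq_continuous_at)
qed

lemma power_in_zolotarev_class:
  fixes \<phi> :: "('m::finite) dspace \<Rightarrow> real"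
  assumes \<phi>: "bounded_linear \<phi>" "\<phi> \<in> borel_measurable D_sigma" and l: "real l < s"
  shows "(\<lambda>x. c * \<phi> x ^ l) \<in> zolotarev_class s"
proof -
  \<comment> \<open>The integer with \<open>k < s\<close> and \<open>s \<le> k + 1\<close>. As
    \<open>l < s\<close> forces \<open>l \<le> k\<close>, the exponent \<open>l - k\<close> is 0 and
    the \<open>k\<close>-th derivative is constant, whatever the factor \<open>c\<close>.\<close>
  define k where "k = nat (\<lceil>s\<rceil> - 1)"
  have k: "real k < s" "s \<le> real k + 1" "l \<le> k"
  proof -
    have pos: "\<lceil>s\<rceil> \<ge> 1" using l by linarith
    then have "real k = of_int \<lceil>s\<rceil> - 1" by (simp add: k_def)
    then show "real k < s" "s \<le> real k + 1" by linarith+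
    then show "l \<le> k" using l by linarith
  qed
  have "power_derivative c l \<phi> k x = power_derivative c l \<phi> k y" for x y
    using k(3) by (simp add: power_derivative_def)
  then have hoelder: "\<forall>x y. norm (power_derivative c l \<phi> k x - power_derivative c l \<phi> k y) \<le> norm (x - y) powr (s - real k)"
    by (metis diff_self norm_zero powr_ge_zero)
  have "(\<lambda>x. c * \<phi> x ^ l) \<in> borel_measurable D_sigma" using \<phi>(2) by measurable
  moreover have "s = real k + (s - real k)" "0 < s - real k" "s - real k \<le> 1" using k by simp_all
  ultimately show ?thesis
    using frechet_derivatives_power[OF \<phi>(1)] hoelder unfolding zolotarev_class_def by blast
qed

lemma power_moments_eq_if_zolotarev_finite:
  fixes X :: "'a \<Rightarrow> ('m::finite) dspace" and Y :: "'b \<Rightarrow> 'm dspace" and \<phi> :: "'m dspace \<Rightarrow> real"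
  assumes fin: "zolotarev_dist s M X N Y < \<infinity>"
    and \<phi>: "bounded_linear \<phi>" "\<phi> \<in> borel_measurable D_sigma" and l: "real l < s"
  shows "(\<integral>\<omega>. \<phi> (X \<omega>) ^ l \<partial>M) = (\<integral>\<omega>. \<phi> (Y \<omega>) ^ l \<partial>N)"
proof (rule ccontr)
  assume ne: "\<not> ?thesis"
  define d where "d = \<bar>(\<integral>\<omega>. \<phi> (X \<omega>) ^ l \<partial>M) - (\<integral>\<omega>. \<phi> (Y \<omega>) ^ l \<partial>N)\<bar>"
  have d: "d > 0" using ne by (simp add: d_def)
  obtain z where z: "z \<ge> 0" "zolotarev_dist s M X N Y = ennreal z"
    using fin by (cases "zolotarev_dist s M X N Y") auto
  \<comment> \<open>The test function \<open>n\<close> times the power separates the means by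
    \<open>n * d\<close>, more than the distance allows.\<close>
  obtain n :: nat where n: "z < real n * d"
    using ex_less_of_nat_mult[OF d, of z] by auto
  have "ennreal \<bar>(\<integral>\<omega>. real n * \<phi> (X \<omega>) ^ l \<partial>M) - (\<integral>\<omega>. real n * \<phi> (Y \<omega>) ^ l \<partial>N)\<bar> \<le> ennreal z"
    unfolding z(2)[symmetric] zolotarev_dist_def
    by (rule SUP_upper2[OF power_in_zolotarev_class[OF \<phi> l, of "real n"]]) simp
  moreover have "\<bar>(\<integral>\<omega>. real n * \<phi> (X \<omega>) ^ l \<partial>M) - (\<integral>\<omega>. real n * \<phi> (Y \<omega>) ^ l \<partial>N)\<bar> = real n * d"
    by (simp add: d_def right_diff_distrib[symmetric] abs_mult)
  ultimately show False using n z(1) by (simp add: ennreal_le_iff)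
qed

section \<open>Polarization of moments\<close>

lemma integrable_monomial:
  fixes X :: "'a \<Rightarrow> ('m::finite) dspace" and \<phi> :: "nat \<Rightarrow> 'm dspace \<Rightarrow> real"
  assumes X: "X \<in> M \<rightarrow>\<^sub>M D_sigma" and int: "integrable M (\<lambda>\<omega>. norm (X \<omega>) ^ n)"
    and \<phi>: "\<And>i. i < n \<Longrightarrow> bounded_linear (\<phi> i)" "\<And>i. i < n \<Longrightarrow> \<phi> i \<in> borel_measurable D_sigma"
  shows "integrable M (\<lambda>\<omega>. \<Prod>i<n. \<phi> i (X \<omega>))"
proof -
  have "\<exists>B. B \<ge> 0 \<and> (\<forall>h. \<bar>\<phi> i h\<bar> \<le> B * norm h)" if "i < n" for i
    using bounded_linear.nonneg_bounded[OF \<phi>(1)[OF that]] by (auto simp: mult.commute)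
  then obtain B where B: "\<And>i. i < n \<Longrightarrow> B i \<ge> 0" "\<And>i h. i < n \<Longrightarrow> \<bar>\<phi> i h\<bar> \<le> B i * norm h"
    by metis
  have "integrable M (\<lambda>\<omega>. (\<Prod>i<n. B i) * norm (X \<omega>) ^ n)" using int by simp
  then show ?thesis
  proof (rule Bochner_Integration.integrable_bound)
    have "(\<lambda>\<omega>. \<phi> i (X \<omega>)) \<in> borel_measurable M" if "i < n" for i
      using measurable_compose[OF X \<phi>(2)[OF that]] .
    then show "(\<lambda>\<omega>. \<Prod>i<n. \<phi> i (X \<omega>)) \<in> borel_measurable M"
      by (intro borel_measurable_prod) auto
    have "\<bar>\<Prod>i<n. \<phi> i h\<bar> \<le> (\<Prod>i<n. B i * norm h)" for h
      unfolding abs_prod using B by (intro prod_mono) auto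
    then have "\<bar>\<Prod>i<n. \<phi> i h\<bar> \<le> (\<Prod>i<n. B i) * norm h ^ n" for h
      by (simp add: prod.distrib)
    moreover have "0 \<le> (\<Prod>i<n. B i)" using B by (intro prod_nonneg) auto
    ultimately show "AE \<omega> in M. norm (\<Prod>i<n. \<phi> i (X \<omega>)) \<le> norm ((\<Prod>i<n. B i) * norm (X \<omega>) ^ n)"
      by (intro always_eventually allI) (simp add: abs_mult)
  qed
qed

lemma integrable_mixed_monomial:
  fixes X :: "'a \<Rightarrow> ('m::finite) dspace" and \<phi> :: "nat \<Rightarrow> 'm dspace \<Rightarrow> real"
  assumes X: "X \<in> M \<rightarrow>\<^sub>M D_sigma" "integrable M (\<lambda>\<omega>. norm (X \<omega>) ^ n)" and n: "n = b + q + r"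
    and \<psi>: "bounded_linear \<psi>" "\<psi> \<in> borel_measurable D_sigma"
    and \<mu>: "bounded_linear \<mu>" "\<mu> \<in> borel_measurable D_sigma"
    and \<phi>: "\<And>i. i < b \<Longrightarrow> bounded_linear (\<phi> i)" "\<And>i. i < b \<Longrightarrow> \<phi> i \<in> borel_measurable D_sigma"
  shows "integrable M (\<lambda>\<omega>. \<psi> (X \<omega>) ^ q * \<mu> (X \<omega>) ^ r * (\<Prod>i<b. \<phi> i (X \<omega>)))"
proof -
  define \<nu> where "\<nu> = (\<lambda>i. if i < b then \<phi> i else if i < b + q then \<psi> else \<mu>)"
  have "(\<Prod>i<n. \<nu> i x) = \<psi> x ^ q * \<mu> x ^ r * (\<Prod>i<b. \<phi> i x)" for x
  proof -
    have split: "{..<n} = ({..<b} \<union> {b..<b + q}) \<union> {b + q..<n}" using n by auto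
    have "(\<Prod>i<n. \<nu> i x) = (\<Prod>i\<in>{..<b} \<union> {b..<b + q}. \<nu> i x) * (\<Prod>i\<in>{b + q..<n}. \<nu> i x)"
      unfolding split by (rule prod.union_disjoint) auto
    also have "(\<Prod>i\<in>{..<b} \<union> {b..<b + q}. \<nu> i x) = (\<Prod>i<b. \<nu> i x) * (\<Prod>i\<in>{b..<b + q}. \<nu> i x)"
      by (rule prod.union_disjoint) auto
    also have "(\<Prod>i<b. \<nu> i x) = (\<Prod>i<b. \<phi> i x)" by (simp add: \<nu>_def)
    also have "(\<Prod>i\<in>{b..<b + q}. \<nu> i x) = \<psi> x ^ q" by (simp add: \<nu>_def)
    also have "(\<Prod>i\<in>{b + q..<n}. \<nu> i x) = \<mu> x ^ r" using n by (simp add: \<nu>_def)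
    finally show ?thesis by (simp add: mult_ac)
  qed
  moreover have "integrable M (\<lambda>\<omega>. \<Prod>i<n. \<nu> i (X \<omega>))"
    using \<psi> \<mu> \<phi> by (intro integrable_monomial[OF X]) (auto simp: \<nu>_def)
  ultimately show ?thesis by simp
qed

text \<open>Compare the coefficients of \<open>r\<close> in the moments of \<open>(\<mu> + r \<phi>) ^ a\<close>.\<close>

lemma polarization_of_moments:
  fixes X :: "'a \<Rightarrow> ('m::finite) dspace" and Y :: "'b \<Rightarrow> 'm dspace" and \<phi> :: "nat \<Rightarrow> 'm dspace \<Rightarrow> real"
  assumes X: "X \<in> M \<rightarrow>\<^sub>M D_sigma" "integrable M (\<lambda>\<omega>. norm (X \<omega>) ^ n)"
    and Y: "Y \<in> N \<rightarrow>\<^sub>M D_sigma" "integrable N (\<lambda>\<omega>. norm (Y \<omega>) ^ n)"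
    and pow: "\<And>\<mu> :: 'm dspace \<Rightarrow> real. bounded_linear \<mu> \<Longrightarrow> \<mu> \<in> borel_measurable D_sigma \<Longrightarrow>
       (\<integral>\<omega>. \<mu> (X \<omega>) ^ n \<partial>M) = (\<integral>\<omega>. \<mu> (Y \<omega>) ^ n \<partial>N)"
    and \<phi>: "\<And>i. i < n \<Longrightarrow> bounded_linear (\<phi> i)" "\<And>i. i < n \<Longrightarrow> \<phi> i \<in> borel_measurable D_sigma"
  shows "(\<integral>\<omega>. (\<Prod>i<n. \<phi> i (X \<omega>)) \<partial>M) = (\<integral>\<omega>. (\<Prod>i<n. \<phi> i (Y \<omega>)) \<partial>N)"
proof -
  \<comment> \<open>Interpolates between the pure power (\<open>b = 0\<close>) and the full product
    (\<open>b = n\<close>). The functional \<open>\<mu>\<close> stays arbitrary because the next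
    step replaces it by \<open>\<mu>\<close> plus a multiple of \<open>\<phi> b\<close>.\<close>
  have "(\<integral>\<omega>. \<mu> (X \<omega>) ^ (n - b) * (\<Prod>i<b. \<phi> i (X \<omega>)) \<partial>M) = (\<integral>\<omega>. \<mu> (Y \<omega>) ^ (n - b) * (\<Prod>i<b. \<phi> i (Y \<omega>)) \<partial>N)"
    if "b \<le> n" "bounded_linear \<mu>" "\<mu> \<in> borel_measurable D_sigma" for b and \<mu> :: "'m dspace \<Rightarrow> real"
    using that
  proof (induction b arbitrary: \<mu>)
    case 0
    then show ?case using pow by simp
  next
    case (Suc b)
    define a where "a = n - b"
    have a: "a > 0" "n - Suc b = a - 1" "b < n" "n = a + b" using Suc.prems by (auto simp: a_def)
    \<comment> \<open>The coefficient of \<open>r ^ q\<close> in the binomial expansion. For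
      \<open>q = 1\<close> it is \<open>a\<close> times the product with one more factor separated,
      and \<open>a > 0\<close> can be cancelled.\<close>
    define c where "c = (\<lambda>x q. real (a choose q) * (\<phi> b x ^ q * \<mu> x ^ (a - q) * (\<Prod>i<b. \<phi> i x)))"
    have q: "n = b + q + (a - q)" if "q \<le> a" for q using that a(4) by simp
    have intX: "integrable M (\<lambda>\<omega>. c (X \<omega>) q)" if "q \<le> a" for q
      unfolding c_def using Suc.prems \<phi> a(3)
      by (intro integrable_mult_right integrable_mixed_monomial[OF X q[OF that]]) auto
    have intY: "integrable N (\<lambda>\<omega>. c (Y \<omega>) q)" if "q \<le> a" for q
      unfolding c_def using Suc.prems \<phi> a(3)
      by (intro integrable_mult_right integrable_mixed_monomial[OF Y q[OF that]]) auto
    have expand: "(\<mu> x + r * \<phi> b x) ^ a * (\<Prod>i<b. \<phi> i x) = (\<Sum>q\<le>a. c x q * r ^ q)" for x r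
      unfolding add.commute[of "\<mu> x"] binomial_ring sum_distrib_right c_def
      by (intro sum.cong) (simp_all add: power_mult_distrib mult_ac)
    have "(\<Sum>q\<le>a. (\<integral>\<omega>. c (X \<omega>) q \<partial>M) * r ^ q) = (\<Sum>q\<le>a. (\<integral>\<omega>. c (Y \<omega>) q \<partial>N) * r ^ q)" for r
    proof -
      have "bounded_linear (\<lambda>x. \<mu> x + r * \<phi> b x)"
        using Suc.prems \<phi> a by (intro bounded_linear_add bounded_linear_const_mult) auto
      moreover have "(\<lambda>x. \<mu> x + r * \<phi> b x) \<in> borel_measurable D_sigma"
        using Suc.prems \<phi>(2)[OF a(3)] by measurable
      ultimately have "(\<integral>\<omega>. (\<mu> (X \<omega>) + r * \<phi> b (X \<omega>)) ^ a * (\<Prod>i<b. \<phi> i (X \<omega>)) \<partial>M) =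
          (\<integral>\<omega>. (\<mu> (Y \<omega>) + r * \<phi> b (Y \<omega>)) ^ a * (\<Prod>i<b. \<phi> i (Y \<omega>)) \<partial>N)"
        unfolding a_def using Suc.prems(1) by (intro Suc.IH) auto
      moreover have "(\<integral>\<omega>. (\<Sum>q\<le>a. c (X \<omega>) q * r ^ q) \<partial>M) = (\<Sum>q\<le>a. (\<integral>\<omega>. c (X \<omega>) q \<partial>M) * r ^ q)"
        using intX by (subst Bochner_Integration.integral_sum) auto
      moreover have "(\<integral>\<omega>. (\<Sum>q\<le>a. c (Y \<omega>) q * r ^ q) \<partial>N) = (\<Sum>q\<le>a. (\<integral>\<omega>. c (Y \<omega>) q \<partial>N) * r ^ q)"
        using intY by (subst Bochner_Integration.integral_sum) auto
      ultimately show ?thesis unfolding expand by simp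
    qed
    then have "\<forall>q\<le>a. (\<integral>\<omega>. c (X \<omega>) q \<partial>M) = (\<integral>\<omega>. c (Y \<omega>) q \<partial>N)"
      by (intro polyfun_eq_coeffs[THEN iffD1] allI)
    then have "(\<integral>\<omega>. c (X \<omega>) 1 \<partial>M) = (\<integral>\<omega>. c (Y \<omega>) 1 \<partial>N)" using a(1) by simp
    moreover have "c x 1 = real a * (\<mu> x ^ (n - Suc b) * (\<Prod>i<Suc b. \<phi> i x))" for x
      unfolding c_def a(2) by (simp add: mult_ac)
    ultimately show ?case using a(1) by simp
  qed
  from this[of n "\<lambda>_. 0"] show ?thesis by simp
qed

lemma bounded_linear_dfun: "bounded_linear (\<lambda>f. dfun f t)"
  by (rule bounded_linear_intro[where K = 1]) (simp_all add: abs_dfun_le_norm)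

theorem theorem9p2:
  fixes M :: "'a measure" and N :: "'b measure"
    and X :: "'a \<Rightarrow> ('m::finite) dspace" and Y :: "'b \<Rightarrow> 'm dspace"
    and s :: real
  assumes "prob_space M" and "prob_space N"
    and "D_random_variable M X" and "D_random_variable N Y"
    and "s > 0"
    and "(\<integral>\<^sup>+ \<omega>. ennreal (norm (X \<omega>) powr s) \<partial>M) < \<infinity>"
    and "(\<integral>\<^sup>+ \<omega>. ennreal (norm (Y \<omega>) powr s) \<partial>N) < \<infinity>"
  shows "zolotarev_dist s M X N Y < \<infinity> \<longleftrightarrow>
    (\<forall>l::nat. 0 < l \<and> real l < s \<longrightarrow>
      (\<forall>t :: nat \<Rightarrow> real ^ 'm. (\<forall>i\<in>{1..l}. t i \<in> unit_cube) \<longrightarrow>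
        (\<integral>\<omega>. (\<Prod>i=1..l. dfun (X \<omega>) (t i)) \<partial>M) = (\<integral>\<omega>. (\<Prod>i=1..l. dfun (Y \<omega>) (t i)) \<partial>N)))"
    (is "?fin \<longleftrightarrow> ?eq")
proof
  have X: "X \<in> M \<rightarrow>\<^sub>M D_sigma" and Y: "Y \<in> N \<rightarrow>\<^sub>M D_sigma"
    using assms(3,4) by (simp_all add: D_random_variable_measurable)
  show ?fin if ?eq
    by (rule zolotarev_finite_if_moments_eq[OF assms(1,2) X Y assms(6,7)]) (use that in blast)
  assume fin: ?fin
  show ?eq
  proof (intro allI impI, elim conjE)
    fix l :: nat and t :: "nat \<Rightarrow> real ^ 'm"
    assume l: "real l < s"
    have "(\<integral>\<omega>. (\<Prod>i<l. dfun (X \<omega>) (t (Suc i))) \<partial>M) = (\<integral>\<omega>. (\<Prod>i<l. dfun (Y \<omega>) (t (Suc i))) \<partial>N)"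
      by (rule polarization_of_moments[OF X _ Y _ power_moments_eq_if_zolotarev_finite[OF fin _ _ l]])
        (use integrable_norm_power(2)[OF assms(1) X assms(6) l] integrable_norm_power(2)[OF assms(2) Y assms(7) l]
          bounded_linear_dfun in auto)
    moreover have "(\<Prod>i=1..l. dfun f (t i)) = (\<Prod>i<l. dfun f (t (Suc i)))" for f
      by (rule prod.reindex_bij_witness[of _ Suc "\<lambda>i. i - 1"]) auto
    ultimately show "(\<integral>\<omega>. (\<Prod>i=1..l. dfun (X \<omega>) (t i)) \<partial>M) = (\<integral>\<omega>. (\<Prod>i=1..l. dfun (Y \<omega>) (t i)) \<partial>N)"
      by simp
  qed
qed

end
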